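(* Let $D\subset\mathbb C^n$ be a $\mathbb C$-convex domain containing no complex lines. Then for every $z\in D$ $$\frac{1}{(16\pi)^n}\le K_D(z)\,p_D^2(z)\le\frac{(2n)!}{(2\pi)^n}.$$
   Context: A domain $D\subset\mathbb C^n$ is $\mathbb C$-convex if every non-empty intersection of $D$ with a complex (affine) line is a simply connected domain (in particular connected). "Containing no complex lines" means $D$ contains no complex affine line. $K_D(z)=\sup\{|f(z)|^2: f\in L^2_h(D),\ \|f\|_D\le1\}$ is the Bergman kernel on the diagonal, where $L^2_h(D)$ is the space of holomorphic functions on $D$ that are square-integrable with respect to Lebesgue measure, with $L^2$-norm $\|\cdot\|_D$. Definition of $p_D(z^0)$ for $z^0\in D$: set $H_0=\mathbb C^n$, $D_0=D$. Inductively for $j=1,\dots,n$, let $d_{j,D}(z^0)$ be the distance from $z^0$ to the boundary of $D_{j-1}$ relative to the affine space $z^0+H_{j-1}$; choose a point $a^j$ in that relative boundary with $\|a^j-z^0\|=d_{j,D}(z^0)$; let $V_j=\mathbb C(a^j-z^0)$, let $H_j=V_j^\perp\cap H_{j-1}$ (orthogonal complement for the standard Hermitian product), and $D_j=D_{j-1}\cap(z^0+H_j)$. In particular $d_{1,D}(z^0)=\operatorname{dist}(z^0,\partial D)$. Put $p_D(z^0)=d_{1,D}(z^0)\cdots d_{n,D}(z^0)$. The choices of the nearest points $a^j$ are arbitrary and fixed; the statement holds for any such choices. *)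

theory Defs
  imports "HOL-Analysis.Analysis"
begin

definition complex_line :: "complex ^ 'n \<Rightarrow> complex ^ 'n \<Rightarrow> (complex ^ 'n) set" where
  "complex_line a b = {a + t *s b | t. True}"

definition is_complex_line :: "(complex ^ 'n) set \<Rightarrow> bool" where
  "is_complex_line L \<longleftrightarrow> (\<exists>a b. b \<noteq> 0 \<and> L = complex_line a b)"

definition domain_Cn :: "(complex ^ 'n::finite) set \<Rightarrow> bool" where
  "domain_Cn D \<longleftrightarrow> open D \<and> connected D \<and> D \<noteq> {}"

text \<open>The library's \<^const>\<open>simply_connected\<close> includes path-connectedness; the intersection of an
  open set with a line is automatically open in the line.\<close>

definition C_convex :: "(complex ^ 'n::finite) set \<Rightarrow> bool" where
  "C_convex D \<longleftrightarrow> (\<forall>L. is_complex_line L \<and> D \<inter> L \<noteq> {} \<longrightarrow> simply_connected (D \<inter> L))"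

definition contains_no_complex_line :: "(complex ^ 'n) set \<Rightarrow> bool" where
  "contains_no_complex_line D \<longleftrightarrow> \<not> (\<exists>L. is_complex_line L \<and> L \<subseteq> D)"

text \<open>Holomorphy on an open set: complex differentiability, i.e. the real Frechet derivative
  (additive and real-linear by \<^const>\<open>has_derivative\<close>) commutes with complex scalars.\<close>

definition holomorphic_Cn :: "(complex ^ 'n::finite \<Rightarrow> complex) \<Rightarrow> (complex ^ 'n) set \<Rightarrow> bool" where
  "holomorphic_Cn f D \<longleftrightarrow>
    (\<forall>z\<in>D. \<exists>f'. (f has_derivative f') (at z) \<and> (\<forall>c v. f' (c *s v) = c * f' v))"

definition L2h :: "(complex ^ 'n::finite) set \<Rightarrow> (complex ^ 'n \<Rightarrow> complex) set" where
  "L2h D = {f. holomorphic_Cn f D \<and> set_integrable lebesgue D (\<lambda>w. (norm (f w))\<^sup>2)}"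

definition L2_norm_on :: "(complex ^ 'n::finite) set \<Rightarrow> (complex ^ 'n \<Rightarrow> complex) \<Rightarrow> real" where
  "L2_norm_on D f = sqrt (set_lebesgue_integral lebesgue D (\<lambda>w. (norm (f w))\<^sup>2))"

text \<open>Valued in the extended nonnegative reals, so that the supremum exists unconditionally.\<close>

definition Bergman_kernel :: "(complex ^ 'n::finite) set \<Rightarrow> complex ^ 'n \<Rightarrow> ennreal" where
  "Bergman_kernel D z = (SUP f \<in> {f \<in> L2h D. L2_norm_on D f \<le> 1}. ennreal ((norm (f z))\<^sup>2))"

definition hermitian_inner :: "complex ^ 'n::finite \<Rightarrow> complex ^ 'n \<Rightarrow> complex" where
  "hermitian_inner u v = (\<Sum>i\<in>UNIV. u $ i * cnj (v $ i))"

definition hermitian_compl :: "(complex ^ 'n::finite) set \<Rightarrow> (complex ^ 'n) set" where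
  "hermitian_compl V = {w. \<forall>v\<in>V. hermitian_inner w v = 0}"

definition complex_span1 :: "complex ^ 'n \<Rightarrow> (complex ^ 'n) set" where
  "complex_span1 v = {c *s v | c. True}"

text \<open>For a base point \<open>z\<close> and a sequence of points \<open>a 1, a 2, \<dots>\<close> (the value \<open>a 0\<close> is never used),
  \<open>nest_H z a j\<close> and \<open>nest_D D z a j\<close> are the nested subspaces \<open>H\<^sub>j\<close> and slices \<open>D\<^sub>j\<close>.\<close>

primrec nest_H :: "complex ^ 'n::finite \<Rightarrow> (nat \<Rightarrow> complex ^ 'n) \<Rightarrow> nat \<Rightarrow> (complex ^ 'n) set" where
  "nest_H z a 0 = UNIV"
| "nest_H z a (Suc j) = hermitian_compl (complex_span1 (a (Suc j) - z)) \<inter> nest_H z a j"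

primrec nest_D :: "(complex ^ 'n::finite) set \<Rightarrow> complex ^ 'n \<Rightarrow> (nat \<Rightarrow> complex ^ 'n) \<Rightarrow> nat
    \<Rightarrow> (complex ^ 'n) set" where
  "nest_D D z a 0 = D"
| "nest_D D z a (Suc j) = nest_D D z a j \<inter> (+) z ` nest_H z a (Suc j)"

text \<open>The boundary of \<open>D\<^sub>j\<close> relative to the affine subspace \<open>z + H\<^sub>j\<close>.\<close>

definition nest_bd :: "(complex ^ 'n::finite) set \<Rightarrow> complex ^ 'n \<Rightarrow> (nat \<Rightarrow> complex ^ 'n) \<Rightarrow> nat
    \<Rightarrow> (complex ^ 'n) set" where
  "nest_bd D z a j = top_of_set ((+) z ` nest_H z a j) frontier_of nest_D D z a j"

text \<open>Used for \<open>1 \<le> j \<le> CARD('n)\<close> only.\<close>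

definition nest_d :: "(complex ^ 'n::finite) set \<Rightarrow> complex ^ 'n \<Rightarrow> (nat \<Rightarrow> complex ^ 'n) \<Rightarrow> nat
    \<Rightarrow> real" where
  "nest_d D z a j = infdist z (nest_bd D z a (j - 1))"

text \<open>\<open>a 1, \<dots>, a n\<close> is an admissible choice of successive nearest relative boundary points.\<close>

definition nearest_choice :: "(complex ^ 'n::finite) set \<Rightarrow> complex ^ 'n \<Rightarrow> (nat \<Rightarrow> complex ^ 'n)
    \<Rightarrow> bool" where
  "nearest_choice D z a \<longleftrightarrow>
    (\<forall>j\<in>{1..CARD('n)}. a j \<in> nest_bd D z a (j - 1) \<and> norm (a j - z) = nest_d D z a j)"

definition p_D :: "(complex ^ 'n::finite) set \<Rightarrow> complex ^ 'n \<Rightarrow> (nat \<Rightarrow> complex ^ 'n) \<Rightarrow> real" where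
  "p_D D z a = (\<Prod>j = 1..CARD('n). nest_d D z a j)"

end

theory Submission
  imports Defs "HOL-Complex_Analysis.Complex_Analysis" "HOL-Probability.Distributions"
begin

text \<open>A \<open>\<complex>\<close>-convex domain is linearly convex: through every point outside there is a complex hyperplane
  missing the domain. Moreover its images under complex functionals are simply connected. Both facts are
  proved with continuous logarithms (the Borsukian property), which can be chosen on each complex line
  separately.

  Let \<open>e\<^sub>j\<close> be the normalised vectors \<open>a\<^sub>j - z\<close>, which are orthonormal. The domain contains the discs of radius
  \<open>d\<^sub>j\<close> in the directions \<open>e\<^sub>j\<close>, hence by linear convexity the domain \<open>\<Sum> |t\<^sub>j| / d\<^sub>j < 1\<close>, of volume
  \<open>(2\<pi>)\<^sup>n (\<Prod> d\<^sub>j)\<^sup>2 / (2n)!\<close>; the mean value property gives the upper bound. For the lower bound, hyperplanes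
  through the \<open>a\<^sub>j\<close> missing the domain give functionals \<open>\<mu>\<^sub>j\<close> that are unipotent triangular with respect to
  \<open>e\<^sub>j\<close>, and the domain lies in the preimage of a product of simply connected planar domains, each of
  which omits \<open>d\<^sub>j\<close>. The Koebe quarter theorem bounds the planar Bergman kernels, and the product of the
  planar functions is a competitor for the domain.\<close>

section \<open>Logarithms on families of planar domains\<close>

text \<open>Homotopies chosen on different lines are hard to match, but logarithms are not: on a
  connected fibre a logarithm is unique up to a constant, so normalising it at one point makes the
  choices fit together. For connected open sets in the plane, existence of logarithms is equivalent
  to simple connectivity, hence the passage from lines to functionals through
  \<open>Borsukian\<close>. The constant 16\<pi> is the area \<pi> of the disc times the square of
  Koebe's 4. The constant (2n)!/(2\<pi>)^n comes from integrating exp(-N) for the gauge N of the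
  domain \<Sum>|t_j|/d_j < 1: each complex coordinate contributes 2\<pi> d_j^2, and homogeneity in
  real dimension 2n contributes (2n)!. Triangular functionals suffice for the lower bound, without
  orthogonality, because Lebesgue measure does not see shifts of one coordinate by functions of the
  earlier ones.\<close>

lemma continuous_logarithms_eq:
  fixes f h :: "'a::topological_space \<Rightarrow> complex"
  assumes "connected S" "continuous_on S f" "continuous_on S h"
    and eq: "\<And>x. x \<in> S \<Longrightarrow> exp (f x) = exp (h x)"
    and "a \<in> S" "norm (f a - h a) < 2 * pi" "x \<in> S"
  shows "f x = h x"
proof -
  \<comment> \<open>\<open>q\<close> is the difference of the two logarithms in units of 2\<pi>\<i>:
    continuous with integer values, hence constant on the connected set \<open>S\<close>.\<close>
  define q where "q \<equiv> \<lambda>x. Re ((f x - h x) / (2 * pi * \<i>))"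
  have int: "\<exists>n::int. f x = h x + 2 * of_int n * pi * \<i> \<and> q x = n" if x: "x \<in> S" for x
  proof -
    obtain n :: int where n: "f x = h x + (of_int (2 * n) * pi) * \<i>"
      using eq[OF x] exp_eq by metis
    then have "q x = n"
      by (simp add: q_def)
    with n show ?thesis
      by (intro exI[of _ n]) auto
  qed
  have "continuous_on S q"
    unfolding q_def using assms(2,3) by (intro continuous_intros) auto
  then have conn: "connected (q ` S)"
    using connected_continuous_image[OF _ assms(1)] by blast
  obtain n :: int where n: "f a = h a + 2 * of_int n * pi * \<i>" "q a = n"
    using int[OF \<open>a \<in> S\<close>] by blast
  \<comment> \<open>Closeness below 2\<pi> at \<open>a\<close>, rather than equality, already forces
    the integer to vanish; a logarithm can thus be identified from an approximate value at one
    point.\<close>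
  have "norm (f a - h a) = 2 * pi * \<bar>real_of_int n\<bar>"
    using n by (simp add: norm_mult)
  with assms(6) have "\<bar>real_of_int n\<bar> < 1"
    using pi_gt_zero by (simp add: mult_less_cancel_left2)
  then have "n = 0" by linarith
  obtain m :: int where m: "f x = h x + 2 * of_int m * pi * \<i>" "q x = m"
    using int[OF \<open>x \<in> S\<close>] by blast
  have "q x = q a"
  proof (rule ccontr)
    assume ne: "q x \<noteq> q a"
    have sub: "q ` S \<subseteq> \<int>"
      using int by (auto simp: Ints_def)
    have 1: "q x \<in> q ` S" "q a \<in> q ` S" using \<open>x \<in> S\<close> \<open>a \<in> S\<close> by auto
    have "{min (q x) (q a) .. max (q x) (q a)} \<subseteq> q ` S"
      using 1 by (intro connected_contains_Icc[OF conn]) (auto simp: min_def max_def)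
    \<comment> \<open>A connected set of reals containing two distinct integers also contains a
      half-integer.\<close>
    moreover have "min (q x) (q a) + 1/2 \<in> {min (q x) (q a) .. max (q x) (q a)}"
    proof -
      have "\<bar>q x - q a\<bar> \<ge> 1"
        using ne m(2) n(2) by (cases m n rule: linorder_cases) auto
      then show ?thesis by (auto simp: min_def max_def)
    qed
    ultimately have "min (q x) (q a) + 1/2 \<in> \<int>" using sub by blast
    moreover have "min (q x) (q a) = of_int (min m n)"
      using m(2) n(2) by (auto simp: min_def)
    ultimately obtain k :: int where "real_of_int (min m n) + 1/2 = of_int k"
      by (auto simp: Ints_def)
    then have "real_of_int (2 * min m n + 1) = real_of_int (2 * k)" by (simp add: algebra_simps)
    then have "2 * min m n + 1 = 2 * k" using of_int_eq_iff by blast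
    then show False by presburger
  qed
  with n(2) m(2) \<open>n = 0\<close> have "m = 0" by simp
  with m show ?thesis by simp
qed

text \<open>The logarithm is chosen on each fibre separately, normalised at the base point \<open>c0\<close>; it is
  continuous in the parameter because a path inside one fibre also lies in all nearby fibres.\<close>

lemma fibrewise_logarithm:
  fixes W :: "('a::metric_space \<times> complex) set" and g :: "'a \<times> complex \<Rightarrow> complex"
  assumes opW: "openin (top_of_set (Z \<times> UNIV)) W"
    and fib: "\<And>z. z \<in> Z \<Longrightarrow> simply_connected {c. (z, c) \<in> W}"
    and base: "\<And>z. z \<in> Z \<Longrightarrow> (z, c0) \<in> W"
    and contg: "continuous_on W g" and gnz: "\<And>w. w \<in> W \<Longrightarrow> g w \<noteq> 0"
    and contl: "continuous_on Z lam" and explam: "\<And>z. z \<in> Z \<Longrightarrow> exp (lam z) = g (z, c0)"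
  shows "\<exists>l. continuous_on W l \<and> (\<forall>w\<in>W. exp (l w) = g w)"
proof -
  obtain W' where W': "open W'" "W = (Z \<times> UNIV) \<inter> W'"
    using opW by (auto simp: openin_open)
  define F where "F \<equiv> \<lambda>z. {c. (z, c) \<in> W}"
  have F_open: "open (F z)" if "z \<in> Z" for z
  proof -
    have "F z = (\<lambda>c. (z, c)) -` W'" using that W' by (auto simp: F_def)
    then show ?thesis using W'(1) by (auto intro!: open_vimage continuous_intros)
  qed
  have "\<exists>l. continuous_on (F z) l \<and> (\<forall>c\<in>F z. exp (l c) = g (z, c)) \<and> l c0 = lam z" if z: "z \<in> Z" for z
  proof -
    have "continuous_on (F z) (\<lambda>c. g (z, c))"
      by (rule continuous_on_compose2[OF contg]) (auto simp: F_def intro!: continuous_intros)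
    moreover have "simply_connected (F z)" using fib[OF z] by (simp add: F_def)
    moreover have "locally path_connected (F z)"
      using F_open[OF z] open_imp_locally_path_connected by blast
    ultimately obtain l where l: "continuous_on (F z) l" "\<And>c. c \<in> F z \<Longrightarrow> g (z, c) = exp (l c)"
      by (rule continuous_logarithm_on_simply_connected) (auto simp: F_def gnz)
    have "exp (lam z) = exp (l c0)"
      using base[OF z] explam[OF z] l(2)[of c0] by (simp add: F_def)
    then show ?thesis
      using l by (intro exI[of _ "\<lambda>c. l c + (lam z - l c0)"])
        (auto intro!: continuous_intros simp: exp_add exp_diff)
  qed
  then obtain lz where lz: "\<And>z. z \<in> Z \<Longrightarrow> continuous_on (F z) (lz z)"
    "\<And>z c. z \<in> Z \<Longrightarrow> c \<in> F z \<Longrightarrow> exp (lz z c) = g (z, c)" "\<And>z. z \<in> Z \<Longrightarrow> lz z c0 = lam z"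
    by metis
  define l where "l \<equiv> \<lambda>(z, c). lz z c"
  have "continuous (at w within W) l" if w: "w \<in> W" for w
  proof -
    obtain z1 c1 where wzc: "w = (z1, c1)" by fastforce
    with w W' have z1: "z1 \<in> Z" by auto
    have c1: "c1 \<in> F z1" using w wzc by (simp add: F_def)
    have c0: "c0 \<in> F z1" using base[OF z1] by (simp add: F_def)
    have "path_connected (F z1)"
      using fib[OF z1] simply_connected_imp_path_connected by (auto simp: F_def)
    then obtain \<gamma> where \<gamma>: "path \<gamma>" "path_image \<gamma> \<subseteq> F z1" "pathstart \<gamma> = c0" "pathfinish \<gamma> = c1"
      using c0 c1 unfolding path_connected_def by metis
    obtain r where r: "r > 0" "cball c1 r \<subseteq> F z1"
      using F_open[OF z1] c1 open_contains_cball by metis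
    \<comment> \<open>\<open>K\<close> joins the base point \<open>c0\<close> to a whole
      neighbourhood of \<open>c1\<close> inside the single fibre over \<open>z1\<close>; being
      compact, it lies in all nearby fibres by the tube lemma.\<close>
    define K where "K \<equiv> path_image \<gamma> \<union> cball c1 r"
    have K: "compact K" "K \<subseteq> F z1" "c0 \<in> K"
      using \<gamma> r compact_path_image[OF \<gamma>(1)] pathstart_in_path_image[of \<gamma>] by (auto simp: K_def)
    have Kcon: "connected K"
      unfolding K_def using \<gamma> r pathfinish_in_path_image[of \<gamma>]
      by (intro connected_Un connected_path_image) auto
    \<comment> \<open>\<open>h\<close> compares \<open>g\<close> at the parameters \<open>z\<close>
      and \<open>z1\<close>. For \<open>z\<close> near \<open>z1\<close> it is within 1/2 of 1 on
      \<open>K\<close>, so its principal logarithm is continuous and small.\<close>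
    define h where "h \<equiv> \<lambda>(z, c). g (z, c) / g (z1, c)"
    define V where "V \<equiv> W \<inter> (UNIV \<times> F z1)"
    have opV: "openin (top_of_set (Z \<times> UNIV)) V"
    proof -
      have "V = (Z \<times> UNIV) \<inter> (W' \<inter> (UNIV \<times> F z1))"
        using W' by (auto simp: V_def)
      then show ?thesis
        using W'(1) F_open[OF z1] by (auto simp: openin_open intro!: open_Int open_Times exI[of _ "W' \<inter> (UNIV \<times> F z1)"])
    qed
    have conth: "continuous_on V h"
      unfolding h_def split_def V_def using z1
      by (intro continuous_intros continuous_on_compose2[OF contg]) (auto simp: F_def gnz)
    have "openin (top_of_set V) (V \<inter> h -` ball 1 (1/2))"
      using conth by (intro continuous_openin_preimage_gen) auto
    then have "openin (top_of_set (Z \<times> UNIV)) (V \<inter> h -` ball 1 (1/2))"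
      using opV openin_trans by blast
    then obtain O' where O': "open O'" "V \<inter> h -` ball 1 (1/2) = (Z \<times> UNIV) \<inter> O'"
      by (auto simp: openin_open)
    have "{z1} \<times> K \<subseteq> O'"
    proof clarify
      fix c assume c: "c \<in> K"
      then have "(z1, c) \<in> W" using K by (auto simp: F_def)
      then have "(z1, c) \<in> V \<inter> h -` ball 1 (1/2)"
        using gnz[of "(z1, c)"] by (auto simp: V_def h_def F_def)
      with O' show "(z1, c) \<in> O'" by auto
    qed
    then obtain X where X: "z1 \<in> X" "open X" "X \<times> K \<subseteq> O'"
      using Elementary_Topology.tube_lemma[OF K(1) O'(1)] by metis
    have "\<forall>\<^sub>F z in at z1 within Z. dist (lam z) (lam z1) < 1"
      using contl z1 by (auto simp: continuous_on_def tendsto_iff)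
    then obtain Y where Y: "open Y" "z1 \<in> Y" "\<And>z. z \<in> Y \<Longrightarrow> z \<in> Z \<Longrightarrow> dist (lam z) (lam z1) < 1"
      by (auto simp: eventually_at_topological) (metis dist_self zero_less_one)
    have hK: "(z, c) \<in> W \<and> norm (h (z, c) - 1) < 1/2" if "z \<in> X" "z \<in> Z" "c \<in> K" for z c
    proof -
      have "(z, c) \<in> (Z \<times> UNIV) \<inter> O'" using that X(3) by auto
      then have "(z, c) \<in> V \<inter> h -` ball 1 (1/2)" using O'(2) by simp
      then show ?thesis by (auto simp: V_def dist_norm norm_minus_commute)
    qed
    \<comment> \<open>Both sides are logarithms of the same function on the connected set
      \<open>K\<close>, and at \<open>c0\<close> they differ by less than 2 < 2\<pi>, so they agree.
      The right-hand side is visibly continuous in both variables, which is what continuity of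
      \<open>l\<close> at \<open>w\<close> requires.\<close>
    have near: "l (z, c) = l (z1, c) + Ln (h (z, c))"
      if z: "z \<in> X" "z \<in> Y" "z \<in> Z" and c: "c \<in> K" for z c
    proof -
      have hh: "h (z, c) \<noteq> 0" "h (z, c) \<notin> \<real>\<^sub>\<le>\<^sub>0" if "c \<in> K" for c
      proof -
        have n: "norm (h (z, c) - 1) < 1/2" using hK that z by blast
        then show "h (z, c) \<noteq> 0" by auto
        have "\<bar>Re (h (z, c) - 1)\<bar> < 1/2" using n abs_Re_le_cmod[of "h (z, c) - 1"] by linarith
        then have "Re (h (z, c) - 1) > - 1" by linarith
        then have "Re (h (z, c)) > 0" by simp
        then show "h (z, c) \<notin> \<real>\<^sub>\<le>\<^sub>0" by (auto simp: complex_nonpos_Reals_iff)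
      qed
      have Ksub: "K \<subseteq> F z" using hK z by (auto simp: F_def)
      have "lz z c = lz z1 c + Ln (h (z, c))"
      proof (rule continuous_logarithms_eq[OF Kcon, of "lz z" "\<lambda>c. lz z1 c + Ln (h (z, c))" c0 c])
        show "continuous_on K (lz z)"
          using lz(1)[OF z(3)] Ksub continuous_on_subset by blast
        have "continuous_on K (\<lambda>c. h (z, c))"
          using hK z K by (intro continuous_on_compose2[OF conth]) (auto simp: V_def intro!: continuous_intros)
        then show "continuous_on K (\<lambda>c. lz z1 c + Ln (h (z, c)))"
          by (intro continuous_intros continuous_on_subset[OF lz(1)[OF z1] K(2)]) (auto dest: hh)
        show "exp (lz z x) = exp (lz z1 x + Ln (h (z, x)))" if x: "x \<in> K" for x
        proof -
          have "x \<in> F z1" "x \<in> F z" using K Ksub x by auto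
          moreover have "g (z1, x) \<noteq> 0" using \<open>x \<in> F z1\<close> gnz by (simp add: F_def)
          ultimately show ?thesis
            using hh[OF x] lz(2)[OF z1] lz(2)[OF z(3)] by (simp add: exp_add h_def)
        qed
        show "c0 \<in> K" "c \<in> K" using K c by auto
        have "norm (Ln (h (z, c0))) \<le> 1"
        proof -
          have n: "norm (h (z, c0) - 1) < 1/2" using hK K z by blast
          have "norm (Ln (1 + (h (z, c0) - 1))) \<le> 2 * norm (h (z, c0) - 1)"
            by (rule norm_Ln_le) (use n in auto)
          with n show ?thesis by simp
        qed
        moreover have "norm (lam z - lam z1) < 1" using Y(3)[of z] z by (simp add: dist_norm)
        moreover have "norm (lam z - lam z1 - Ln (h (z, c0))) \<le> norm (lam z - lam z1) + norm (Ln (h (z, c0)))"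
          by (rule norm_triangle_ineq4)
        ultimately have "norm (lam z - lam z1 - Ln (h (z, c0))) < 2" by linarith
        moreover have "2 < 2 * pi" using pi_gt3 by linarith
        ultimately show "norm (lz z c0 - (lz z1 c0 + Ln (h (z, c0)))) < 2 * pi"
          using lz(3)[OF z1] lz(3)[OF z(3)] by (simp add: algebra_simps)
      qed
      then show ?thesis by (simp add: l_def)
    qed
    have h1: "h (z1, c1) = 1" using w wzc gnz by (auto simp: h_def)
    have opN: "open ((X \<inter> Y) \<times> ball c1 r)" using X Y by (auto intro!: open_Times)
    have wN: "w \<in> (X \<inter> Y) \<times> ball c1 r" using X Y r wzc by auto
    have wV: "w \<in> V" using w wzc c1 by (simp add: V_def)
    have "((\<lambda>u. lz z1 (snd u) + Ln (h u)) \<longlongrightarrow> lz z1 c1 + Ln 1) (at w within V)"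
    proof (intro tendsto_intros)
      have "continuous_on V (\<lambda>u. lz z1 (snd u))"
        by (rule continuous_on_compose2[OF lz(1)[OF z1]]) (auto simp: V_def intro!: continuous_intros)
      then show "((\<lambda>u. lz z1 (snd u)) \<longlongrightarrow> lz z1 c1) (at w within V)"
        using wV wzc by (auto simp: continuous_on_def)
      show "(h \<longlongrightarrow> 1) (at w within V)"
        using conth wV h1 wzc by (auto simp: continuous_on_def)
    qed auto
    moreover have "at w within V = at w within W"
      unfolding V_def using F_open[OF z1] c1 wzc
      by (intro at_within_nhd[of w "UNIV \<times> F z1"]) (auto intro!: open_Times)
    moreover have "\<forall>\<^sub>F u in at w within W. lz z1 (snd u) + Ln (h u) = l u"
      unfolding eventually_at_topological
    proof (intro exI conjI ballI impI)
      fix u assume u: "u \<in> (X \<inter> Y) \<times> ball c1 r" "u \<noteq> w" "u \<in> W"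
      then have "fst u \<in> Z" "snd u \<in> K" using W' by (auto simp: K_def)
      then show "lz z1 (snd u) + Ln (h u) = l u"
        using near[of "fst u" "snd u"] u by (auto simp: l_def)
    qed (use opN wN in auto)
    ultimately have "(l \<longlongrightarrow> lz z1 c1 + Ln 1) (at w within W)"
      using Lim_transform_eventually by force
    then show ?thesis
      using wzc by (simp add: continuous_within l_def)
  qed
  then have "continuous_on W l" by (simp add: continuous_on_eq_continuous_within)
  moreover have "exp (l w) = g w" if "w \<in> W" for w
    using that lz(2) W' by (cases w) (auto simp: l_def F_def)
  ultimately show ?thesis by blast
qed

text \<open>Local sections make \<open>\<pi>\<close> act like a quotient map: over
  \<open>U x\<close> the descended function is \<open>l\<close> composed with the section
  \<open>s x\<close>, and continuity is a local matter.\<close>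

lemma continuous_descends:
  fixes \<pi> :: "'a::topological_space \<Rightarrow> 'b::t2_space" and l :: "'a \<Rightarrow> 'c::topological_space"
  assumes contl: "continuous_on S l" and const: "\<And>x y. x \<in> S \<Longrightarrow> y \<in> S \<Longrightarrow> \<pi> x = \<pi> y \<Longrightarrow> l x = l y"
    and im: "\<pi> ` S = T"
    and U: "\<And>x. x \<in> S \<Longrightarrow> open (U x)" "\<And>x. x \<in> S \<Longrightarrow> \<pi> x \<in> U x"
    and s: "\<And>x. x \<in> S \<Longrightarrow> continuous_on (U x \<inter> T) (s x)"
      "\<And>x t. x \<in> S \<Longrightarrow> t \<in> U x \<inter> T \<Longrightarrow> s x t \<in> S"
      "\<And>x t. x \<in> S \<Longrightarrow> t \<in> U x \<inter> T \<Longrightarrow> \<pi> (s x t) = t"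
  shows "\<exists>m. continuous_on T m \<and> (\<forall>x\<in>S. l x = m (\<pi> x))"
proof -
  define m where "m \<equiv> \<lambda>t. l (SOME x. x \<in> S \<and> \<pi> x = t)"
  have m: "l x = m (\<pi> x)" if x: "x \<in> S" for x
    unfolding m_def
  proof (rule someI2[of _ x])
    show "x \<in> S \<and> \<pi> x = \<pi> x" using x by simp
    show "l x = l y" if "y \<in> S \<and> \<pi> y = \<pi> x" for y
      by (rule const) (use x that in simp_all)
  qed
  have "continuous (at t within T) m" if t: "t \<in> T" for t
  proof -
    obtain x where x: "x \<in> S" "\<pi> x = t" using im t by blast
    have "continuous_on (U x \<inter> T) (\<lambda>t. l (s x t))"
      by (rule continuous_on_compose2[OF contl s(1)]) (use x s(2) in blast)+
    then have "continuous_on (U x \<inter> T) m"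
    proof (rule continuous_on_eq)
      show "l (s x t) = m t" if "t \<in> U x \<inter> T" for t
        using m[OF s(2)[OF x(1) that]] s(3)[OF x(1) that] by simp
    qed
    moreover have tU: "t \<in> U x" using U(2)[OF x(1)] x(2) by simp
    ultimately have "continuous (at t within U x \<inter> T) m"
      using t by (simp add: continuous_on_eq_continuous_within)
    moreover have "at t within U x \<inter> T = at t within T"
      by (rule at_within_nhd[OF tU U(1)[OF x(1)]]) blast
    ultimately show ?thesis by (simp add: continuous_within)
  qed
  then have "continuous_on T m" by (simp add: continuous_on_eq_continuous_within)
  moreover have "\<forall>x\<in>S. l x = m (\<pi> x)" using m by (intro ballI)
  ultimately show ?thesis by (intro exI[of _ m] conjI)
qed

lemma continuous_logarithm_constant_on_connected:
  fixes l :: "'a::topological_space \<Rightarrow> complex"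
  assumes "connected S" "continuous_on S l" "\<And>x y. x \<in> S \<Longrightarrow> y \<in> S \<Longrightarrow> exp (l x) = exp (l y)"
    and "x \<in> S" "y \<in> S"
  shows "l x = l y"
proof (rule continuous_logarithms_eq[of S l "\<lambda>_. l y" y x])
  show "exp (l u) = exp (l y)" if "u \<in> S" for u using assms(3)[OF that assms(5)] .
qed (use assms(1,2,4,5) in auto)

text \<open>Pull \<open>f\<close> back along \<open>\<pi>\<close> and take a logarithm on
  \<open>S\<close>. On a connected fibre the pulled-back function is constant, so its logarithm is
  constant too and descends through the local sections.\<close>

lemma Borsukian_image:
  fixes S :: "'a::real_normed_vector set" and T :: "'b::real_normed_vector set"
  assumes S: "Borsukian S" and cont: "continuous_on S \<pi>" and im: "\<pi> ` S = T"
    and fib: "\<And>t. t \<in> T \<Longrightarrow> connected {x \<in> S. \<pi> x = t}"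
    and U: "\<And>x. x \<in> S \<Longrightarrow> open (U x)" "\<And>x. x \<in> S \<Longrightarrow> \<pi> x \<in> U x"
    and s: "\<And>x. x \<in> S \<Longrightarrow> continuous_on (U x \<inter> T) (s x)"
      "\<And>x t. x \<in> S \<Longrightarrow> t \<in> U x \<inter> T \<Longrightarrow> s x t \<in> S"
      "\<And>x t. x \<in> S \<Longrightarrow> t \<in> U x \<inter> T \<Longrightarrow> \<pi> (s x t) = t"
  shows "Borsukian T"
  unfolding Borsukian_continuous_logarithm
proof (intro allI impI)
  fix f :: "'b \<Rightarrow> complex" assume f: "continuous_on T f \<and> f \<in> T \<rightarrow> - {0}"
  have "continuous_on S (\<lambda>x. f (\<pi> x))"
    by (rule continuous_on_compose2[of T f S \<pi>, OF _ cont]) (use f im in blast)+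
  moreover have "(\<lambda>x. f (\<pi> x)) \<in> S \<rightarrow> - {0}" using f im by blast
  ultimately obtain l where l: "continuous_on S l" "\<And>x. x \<in> S \<Longrightarrow> f (\<pi> x) = exp (l x)"
    using S[unfolded Borsukian_continuous_logarithm, rule_format, of "\<lambda>x. f (\<pi> x)"] by auto
  have const: "l x = l y" if xy: "x \<in> S" "y \<in> S" "\<pi> x = \<pi> y" for x y
  proof (rule continuous_logarithm_constant_on_connected[OF fib[of "\<pi> x"]])
    show "continuous_on {z \<in> S. \<pi> z = \<pi> x} l" by (rule continuous_on_subset[OF l(1)]) auto
    show "exp (l u) = exp (l v)" if "u \<in> {z \<in> S. \<pi> z = \<pi> x}" "v \<in> {z \<in> S. \<pi> z = \<pi> x}" for u v
      using that l(2)[of u] l(2)[of v] by simp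
      show "\<pi> x \<in> T" using xy(1) im by blast
  qed (use xy in auto)
  have "\<exists>m. continuous_on T m \<and> (\<forall>x\<in>S. l x = m (\<pi> x))"
    by (rule continuous_descends[OF l(1) const im U s])
  then obtain m where m: "continuous_on T m" "\<And>x. x \<in> S \<Longrightarrow> l x = m (\<pi> x)"
    by blast
  have "f t = exp (m t)" if t: "t \<in> T" for t
  proof -
    obtain x where "x \<in> S" "t = \<pi> x" using t im by blast
    then show ?thesis using m(2)[of x] l(2)[of x] by simp
  qed
  then show "\<exists>g. continuous_on T g \<and> (\<forall>x\<in>T. f x = exp (g x))"
    using m(1) by blast
qed

text \<open>Near each parameter a constant section exists, so a logarithm exists over a small ball; a
  partition of unity glues these to a function that agrees with a logarithm of \<open>g\<close> up to a
  constant on every fibre, and the quotient descends to the base, where it has a logarithm.\<close>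

lemma Borsukian_base_logarithm:
  fixes W :: "('a::real_normed_vector \<times> complex) set" and g :: "'a \<times> complex \<Rightarrow> complex"
  assumes B: "compact B" "Borsukian B"
    and opW: "openin (top_of_set (B \<times> UNIV)) W"
    and fib: "\<And>t. t \<in> B \<Longrightarrow> simply_connected {c. (t, c) \<in> W}"
    and ne: "\<And>t. t \<in> B \<Longrightarrow> {c. (t, c) \<in> W} \<noteq> {}"
    and contg: "continuous_on W g" and gnz: "\<And>w. w \<in> W \<Longrightarrow> g w \<noteq> 0"
  shows "\<exists>l. continuous_on W l \<and> (\<forall>w\<in>W. exp (l w) = g w)"
proof -
  have WB: "fst w \<in> B" if "w \<in> W" for w
    using openin_imp_subset[OF opW] that by auto
  obtain W' where W': "open W'" "W = (B \<times> UNIV) \<inter> W'"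
    using opW by (auto simp: openin_open)
  \<comment> \<open>The logarithm is required up to distance \<open>2 * r\<close>, while the weight
    introduced below vanishes beyond \<open>r\<close>: on the overlap the weighted logarithm is 0,
    so it extends continuously by zero.\<close>
  define P where "P \<equiv> \<lambda>t r l. r > 0 \<and> continuous_on {w \<in> W. dist t (fst w) < 2 * r} l \<and>
      (\<forall>w\<in>W. dist t (fst w) < 2 * r \<longrightarrow> exp (l w) = g w)"
  have "\<exists>r l. P t r l" if t: "t \<in> B" for t
  proof -
    obtain x where x: "(t, x) \<in> W" using ne[OF t] by auto
    define h where "h \<equiv> \<lambda>s. g (s, x) / g (t, x)"
    define V where "V \<equiv> {s \<in> B. (s, x) \<in> W}"
    have opV: "openin (top_of_set B) V"
    proof -
      have "V = B \<inter> (\<lambda>s. (s, x)) -` W'" using W' by (auto simp: V_def)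
      moreover have "open ((\<lambda>s. (s, x)) -` W')"
        using W'(1) by (intro open_vimage) (auto intro!: continuous_intros)
      ultimately show ?thesis by (auto simp: openin_open)
    qed
    have conth: "continuous_on V h"
      unfolding h_def using gnz[OF x]
      by (intro continuous_intros continuous_on_compose2[OF contg]) (auto simp: V_def)
    have "openin (top_of_set V) (V \<inter> h -` ball 1 1)"
      using conth by (intro continuous_openin_preimage_gen) auto
    then have op2: "openin (top_of_set B) (V \<inter> h -` ball 1 1)"
      using opV openin_trans by blast
    moreover have "t \<in> V \<inter> h -` ball 1 1" using t x gnz[OF x] by (auto simp: V_def h_def)
    ultimately obtain e where e: "e > 0" "ball t e \<inter> B \<subseteq> V \<inter> h -` ball 1 1"
      unfolding openin_contains_ball by blast
    define Z where "Z \<equiv> B \<inter> ball t e"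
    have Z: "s \<in> V" "norm (h s - 1) < 1" if "s \<in> Z" for s
    proof -
      have "s \<in> V \<inter> h -` ball 1 1" using e(2) that by (auto simp: Z_def)
      then show "s \<in> V" "norm (h s - 1) < 1" by (auto simp: dist_norm norm_minus_commute)
    qed
    have hn: "h s \<notin> \<real>\<^sub>\<le>\<^sub>0" "h s \<noteq> 0" if "s \<in> Z" for s
    proof -
      have "\<bar>Re (h s - 1)\<bar> < 1" using Z(2)[OF that] abs_Re_le_cmod[of "h s - 1"] by linarith
      then have "Re (h s - 1) > - 1" by linarith
      then have "Re (h s) > 0" by simp
      then show "h s \<notin> \<real>\<^sub>\<le>\<^sub>0" "h s \<noteq> 0" by (auto simp: complex_nonpos_Reals_iff)
    qed
    have sub: "W \<inter> (Z \<times> UNIV) \<subseteq> W" by blast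
    have "\<exists>l. continuous_on (W \<inter> (Z \<times> UNIV)) l \<and> (\<forall>w\<in>W \<inter> (Z \<times> UNIV). exp (l w) = g w)"
    proof (rule fibrewise_logarithm[of Z "W \<inter> (Z \<times> UNIV)" x g "\<lambda>s. Ln (h s) + Ln (g (t, x))"])
      have "W \<inter> (Z \<times> UNIV) = (Z \<times> UNIV) \<inter> W'" using W' by (auto simp: Z_def)
      then show "openin (top_of_set (Z \<times> UNIV)) (W \<inter> Z \<times> UNIV)" using W'(1) by (auto simp: openin_open)
      show "simply_connected {c. (z, c) \<in> W \<inter> Z \<times> UNIV}" if "z \<in> Z" for z
        using fib[of z] that by (simp add: Z_def)
      show "(z, x) \<in> W \<inter> Z \<times> UNIV" if "z \<in> Z" for z using Z(1)[OF that] that by (auto simp: V_def)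
      show "continuous_on Z (\<lambda>s. Ln (h s) + Ln (g (t, x)))"
        using Z(1) by (intro continuous_intros continuous_on_subset[OF conth]) (auto dest: hn)
      show "exp (Ln (h z) + Ln (g (t, x))) = g (z, x)" if "z \<in> Z" for z
        using hn(2)[OF that] gnz[OF x] by (simp add: exp_add h_def)
    qed (use gnz continuous_on_subset[OF contg sub] in auto)
    then obtain l where l: "continuous_on (W \<inter> (Z \<times> UNIV)) l" "\<And>w. w \<in> W \<inter> (Z \<times> UNIV) \<Longrightarrow> exp (l w) = g w"
      by blast
    have eq: "{w \<in> W. dist t (fst w) < 2 * (e/2)} = W \<inter> (Z \<times> UNIV)"
      using WB by (auto simp: Z_def)
    show ?thesis
      unfolding P_def
    proof (intro exI conjI ballI impI)
      show "e / 2 > 0" using e by simp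
      show "continuous_on {w \<in> W. dist t (fst w) < 2 * (e/2)} l" using l(1) unfolding eq .
      show "exp (l w) = g w" if "w \<in> W" "dist t (fst w) < 2 * (e/2)" for w
        using l(2)[of w] that eq by blast
    qed
  qed
  then obtain r ll where P: "\<And>t. t \<in> B \<Longrightarrow> P t (r t) (ll t)" by metis
  have r: "r t > 0" if "t \<in> B" for t using P[OF that] by (simp add: P_def)
  have ll: "continuous_on {w \<in> W. dist t (fst w) < 2 * r t} (ll t)"
    "\<And>w. w \<in> W \<Longrightarrow> dist t (fst w) < 2 * r t \<Longrightarrow> exp (ll t w) = g w" if "t \<in> B" for t
    using P[OF that] by (simp_all add: P_def)
  have cover: "B \<subseteq> (\<Union>t\<in>B. ball t (r t))" using r by force
  obtain I where I: "I \<subseteq> B" "finite I" "B \<subseteq> (\<Union>t\<in>I. ball t (r t))"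
    by (rule compactE_image[OF B(1) open_ball cover])
  define \<rho> where "\<rho> \<equiv> \<lambda>t s. max 0 (r t - dist t s)"
  define \<sigma> where "\<sigma> \<equiv> \<lambda>s. \<Sum>t\<in>I. \<rho> t s"
  have cont\<rho>: "continuous_on X (\<rho> t)" for t X unfolding \<rho>_def by (intro continuous_intros)
  have \<rho>0: "\<rho> t s \<ge> 0" for t s by (simp add: \<rho>_def)
  have \<rho>pos: "dist t s < r t" if "\<rho> t s \<noteq> 0" for t s using that by (auto simp: \<rho>_def max_def split: if_splits)
  have \<sigma>pos: "\<sigma> s > 0" if s: "s \<in> B" for s
  proof -
    obtain t where t: "t \<in> I" "s \<in> ball t (r t)" using I(3) s by blast
    then have "\<rho> t s > 0" by (simp add: \<rho>_def)
    then show ?thesis unfolding \<sigma>_def using t I(2) \<rho>0 by (intro sum_pos2[of I t]) auto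
  qed
  \<comment> \<open>After division by \<open>\<sigma>\<close> the weights sum to one and depend only
    on the base point. Local logarithms differ by constants on a fibre, so this average differs from
    each relevant one by a constant there; only a function of the base point remains to be
    corrected.\<close>
  define l where "l \<equiv> \<lambda>w. (\<Sum>t\<in>I. of_real (\<rho> t (fst w)) * ll t w) / of_real (\<sigma> (fst w))"
  have cont1: "continuous_on W (\<lambda>w. of_real (\<rho> t (fst w)) * ll t w)" if t: "t \<in> I" for t
  proof -
    define S where "S \<equiv> {w \<in> W. dist t (fst w) < 2 * r t}"
    define T where "T \<equiv> {w \<in> W. dist t (fst w) > r t}"
    have rt: "r t > 0" using r t I(1) by auto
    have ST: "W = S \<union> T" using rt by (force simp: S_def T_def)
    have S': "S = W \<inter> (\<lambda>w. dist t (fst w)) -` {..<2 * r t}" and T': "T = W \<inter> (\<lambda>w. dist t (fst w)) -` {r t<..}"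
      by (auto simp: S_def T_def)
    have "openin (top_of_set W) S"
      unfolding S' by (rule continuous_openin_preimage_gen) (auto intro!: continuous_intros)
    moreover have "openin (top_of_set W) T"
      unfolding T' by (rule continuous_openin_preimage_gen) (auto intro!: continuous_intros)
    ultimately have oS: "openin (top_of_set (S \<union> T)) S" "openin (top_of_set (S \<union> T)) T"
      unfolding ST by simp_all
    have "continuous_on (S \<union> T) (\<lambda>w. if dist t (fst w) < 2 * r t then of_real (\<rho> t (fst w)) * ll t w else 0)"
    proof (rule continuous_on_cases_local_open[OF oS])
      show "continuous_on S (\<lambda>w. complex_of_real (\<rho> t (fst w)) * ll t w)"
        using ll(1)[of t] t I(1) unfolding S_def
        by (intro continuous_intros continuous_on_compose2[OF cont\<rho>[of UNIV]]) auto
      show "of_real (\<rho> t (fst w)) * ll t w = 0"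
        if "w \<in> S \<and> \<not> dist t (fst w) < 2 * r t \<or> w \<in> T \<and> dist t (fst w) < 2 * r t" for w
        using that \<rho>pos[of t "fst w"] by (auto simp: S_def T_def)
    qed simp
    then show ?thesis
      unfolding ST[symmetric]
    proof (rule continuous_on_eq)
      show "(if dist t (fst w) < 2 * r t then of_real (\<rho> t (fst w)) * ll t w else 0) = of_real (\<rho> t (fst w)) * ll t w"
        for w
        using \<rho>pos[of t "fst w"] rt by (cases "\<rho> t (fst w) = 0") auto
    qed
  qed
  have contl: "continuous_on W l"
    unfolding l_def
  proof (rule continuous_on_divide)
    show "continuous_on W (\<lambda>w. \<Sum>t\<in>I. of_real (\<rho> t (fst w)) * ll t w)"
      by (rule continuous_on_sum) (rule cont1)
    show "continuous_on W (\<lambda>w. complex_of_real (\<sigma> (fst w)))"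
      unfolding \<sigma>_def by (intro continuous_intros continuous_on_compose2[OF cont\<rho>[of UNIV]]) auto
    show "\<forall>w\<in>W. complex_of_real (\<sigma> (fst w)) \<noteq> 0"
      using \<sigma>pos WB by force
  qed
  have fibconn: "connected {w \<in> W. fst w = t}" if t: "t \<in> B" for t
  proof -
    have "connected ((\<lambda>c. (t, c)) ` {c. (t, c) \<in> W})"
      using fib[OF t] by (intro connected_continuous_image continuous_intros simply_connected_imp_connected)
    moreover have "(\<lambda>c. (t, c)) ` {c. (t, c) \<in> W} = {w \<in> W. fst w = t}" by force
    ultimately show ?thesis by simp
  qed
  have diff: "exp (l w - l v) = g w / g v" if w: "w \<in> W" and v: "v \<in> W" and wv: "fst w = fst v" for w v
  proof -
    have t: "fst v \<in> B" using WB v by blast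
    obtain i where i: "i \<in> I" "dist i (fst v) < r i"
      using I(3) t by auto
    have iB: "i \<in> B" using i I(1) by blast
    have const: "ll j w - ll j v = ll i w - ll i v" if j: "j \<in> I" "dist j (fst v) < r j" for j
    proof -
      have jB: "j \<in> B" using j I(1) by blast
      have c: "continuous_on {u \<in> W. fst u = fst v} (ll k)" "\<And>u. u \<in> W \<Longrightarrow> fst u = fst v \<Longrightarrow> exp (ll k u) = g u"
        if k: "k \<in> B" "dist k (fst v) < r k" for k
      proof -
        have "{u \<in> W. fst u = fst v} \<subseteq> {w \<in> W. dist k (fst w) < 2 * r k}"
          using k r[OF k(1)] by auto
        then show "continuous_on {u \<in> W. fst u = fst v} (ll k)"
          using ll(1)[OF k(1)] continuous_on_subset by blast
        show "exp (ll k u) = g u" if "u \<in> W" "fst u = fst v" for u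
          using ll(2)[OF k(1) that(1)] that(2) k r[OF k(1)] by simp
      qed
      have "(\<lambda>u. ll j u - ll i u) w = (\<lambda>u. ll j u - ll i u) v"
      proof (rule continuous_logarithm_constant_on_connected[OF fibconn[OF t]])
        show "continuous_on {w \<in> W. fst w = fst v} (\<lambda>u. ll j u - ll i u)"
          using c(1)[OF jB j(2)] c(1)[OF iB i(2)] by (intro continuous_intros)
        have 1: "exp (ll j x - ll i x) = 1" if "x \<in> {w \<in> W. fst w = fst v}" for x
          using c(2)[OF jB j(2), of x] c(2)[OF iB i(2), of x] that gnz by (auto simp: exp_diff)
        show "exp (ll j x - ll i x) = exp (ll j y - ll i y)"
          if "x \<in> {w \<in> W. fst w = fst v}" "y \<in> {w \<in> W. fst w = fst v}" for x y
          using 1[OF that(1)] 1[OF that(2)] by simp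
      qed (use w v wv in auto)
      then show ?thesis by (simp add: algebra_simps)
    qed
    have "(\<Sum>j\<in>I. of_real (\<rho> j (fst v)) * ll j w) - (\<Sum>j\<in>I. of_real (\<rho> j (fst v)) * ll j v)
        = (\<Sum>j\<in>I. of_real (\<rho> j (fst v)) * (ll i w - ll i v))"
      unfolding sum_subtractf[symmetric]
    proof (rule sum.cong[OF refl])
      fix j assume j: "j \<in> I"
      show "of_real (\<rho> j (fst v)) * ll j w - of_real (\<rho> j (fst v)) * ll j v = of_real (\<rho> j (fst v)) * (ll i w - ll i v)"
      proof (cases "\<rho> j (fst v) = 0")
        case False
        then show ?thesis using const[OF j \<rho>pos[OF False]] by (simp flip: right_diff_distrib)
      qed simp
    qed
    also have "\<dots> = of_real (\<sigma> (fst v)) * (ll i w - ll i v)"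
      unfolding \<sigma>_def by (simp add: sum_distrib_right)
    finally have "l w - l v = ll i w - ll i v"
      unfolding l_def wv using \<sigma>pos[OF t] by (simp add: divide_simps mult.commute)
    moreover have "exp (ll i w) = g w" "exp (ll i v) = g v"
      using ll(2)[OF iB w] ll(2)[OF iB v] wv i(2) r[OF iB] by simp_all
    ultimately show ?thesis by (simp add: exp_diff)
  qed
  have "\<exists>H. continuous_on B H \<and> (\<forall>w\<in>W. g w * exp (- l w) = H (fst w))"
  proof (rule continuous_descends[where \<pi> = fst and U = "\<lambda>w. (\<lambda>s. (s, snd w)) -` W'" and s = "\<lambda>w s. (s, snd w)"])
    show "continuous_on W (\<lambda>w. g w * exp (- l w))" by (intro continuous_intros contg contl)
    show "g x * exp (- l x) = g y * exp (- l y)" if "x \<in> W" "y \<in> W" "fst x = fst y" for x y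
      using diff[OF that] gnz[OF that(2)] by (simp add: exp_diff exp_minus field_simps)
    show "fst ` W = B"
    proof
      show "fst ` W \<subseteq> B" using WB by blast
      show "B \<subseteq> fst ` W" using ne by force
    qed
    show "open ((\<lambda>s. (s, snd x)) -` W')" for x :: "'a \<times> complex"
      by (intro open_vimage W'(1)) (auto intro!: continuous_intros)
    show "fst x \<in> (\<lambda>s. (s, snd x)) -` W'" if "x \<in> W" for x using that W'(2) by simp
    show "(t, snd x) \<in> W" if "t \<in> (\<lambda>s. (s, snd x)) -` W' \<inter> B" for t and x :: "'a \<times> complex" using that W'(2) by simp
  qed (auto intro!: continuous_intros)
  then obtain H where H: "continuous_on B H" "\<And>w. w \<in> W \<Longrightarrow> g w * exp (- l w) = H (fst w)" by blast
  have Hnz: "H t \<noteq> 0" if "t \<in> B" for t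
  proof -
    obtain c where "(t, c) \<in> W" using ne[of t] \<open>t \<in> B\<close> by blast
    then show ?thesis using H(2)[of "(t, c)"] gnz[of "(t, c)"] by auto
  qed
  have "H \<in> B \<rightarrow> - {0}" using Hnz by blast
  then obtain \<eta> where \<eta>: "continuous_on B \<eta>" "\<forall>t\<in>B. H t = exp (\<eta> t)"
    using B(2)[unfolded Borsukian_continuous_logarithm, rule_format, of H] H(1) by blast
  show ?thesis
  proof (intro exI conjI ballI)
    show "continuous_on W (\<lambda>w. l w + \<eta> (fst w))"
      using WB by (intro continuous_intros contl continuous_on_compose2[OF \<eta>(1)]) auto
    show "exp (l w + \<eta> (fst w)) = g w" if w: "w \<in> W" for w
      using \<eta>(2) H(2)[OF w] WB[OF w] by (simp add: exp_add exp_minus field_simps)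
  qed
qed

section \<open>Complex lines through the origin and the projective line\<close>

lemma no_logarithm_on_circle:
  assumes "continuous_on (sphere 0 1) l"
  shows "\<exists>z::complex. norm z = 1 \<and> exp (l z) \<noteq> z"
proof (rule ccontr)
  assume "\<not> ?thesis"
  then have l: "exp (l z) = z" if "norm z = 1" for z using that by blast
  \<comment> \<open>Along the real line, \<open>l (cis x)\<close> and
    \<open>\<i> * of_real x + l 1\<close> are two logarithms of \<open>cis x\<close> that agree at
    0; after one full turn the value of \<open>l\<close> at 1 would have grown by
    2\<pi>\<i>.\<close>
  have "l (cis (2 * pi)) = \<i> * of_real (2 * pi) + l 1"
  proof (rule continuous_logarithms_eq[of UNIV "\<lambda>x. l (cis x)" "\<lambda>x. \<i> * of_real x + l 1" 0])
    show "continuous_on UNIV (\<lambda>x. l (cis x))"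
      by (rule continuous_on_compose2[OF assms]) (auto simp: cis_conv_exp intro!: continuous_intros)
    show "exp (l (cis x)) = exp (\<i> * complex_of_real x + l 1)" for x
      using l[of "cis x"] l[of 1] by (simp add: exp_add cis_conv_exp)
  qed (auto intro!: continuous_intros)
  then show False by simp
qed

text \<open>The line of slope \<open>t\<close> is parametrised by its first coordinate
  \<open>c\<close>, which can vanish only at the excluded origin. The closed disc of slopes is
  compact and convex, so the base carries logarithms and \<open>c\<close> gets one over this whole
  half of the projective line.\<close>

lemma chart_logarithm:
  fixes \<Omega> :: "(complex \<times> complex) set"
  assumes op: "open \<Omega>" and ne0: "(0, 0) \<notin> \<Omega>"
    and sc: "\<And>t. simply_connected {c. (c, c * t) \<in> \<Omega>}" and ne: "\<And>t. {c. (c, c * t) \<in> \<Omega>} \<noteq> {}"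
  shows "\<exists>l. continuous_on {(t, c). norm t \<le> 1 \<and> (c, c * t) \<in> \<Omega>} l \<and>
    (\<forall>t c. norm t \<le> 1 \<and> (c, c * t) \<in> \<Omega> \<longrightarrow> exp (l (t, c)) = c)"
proof -
  define W where "W \<equiv> (cball (0::complex) 1 \<times> UNIV) \<inter> (\<lambda>w. (snd w, snd w * fst w)) -` \<Omega>"
  have W: "W = {(t, c). norm t \<le> 1 \<and> (c, c * t) \<in> \<Omega>}" by (auto simp: W_def)
  have "\<exists>l. continuous_on W l \<and> (\<forall>w\<in>W. exp (l w) = snd w)"
  proof (rule Borsukian_base_logarithm)
    show "compact (cball (0::complex) 1)" "Borsukian (cball (0::complex) 1)"
      by (auto intro: convex_imp_Borsukian)
    show "openin (top_of_set (cball 0 1 \<times> UNIV)) W"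
      unfolding W_def by (rule continuous_openin_preimage_gen[OF _ op]) (intro continuous_intros)
    show "simply_connected {c. (t, c) \<in> W}" "{c. (t, c) \<in> W} \<noteq> {}" if "t \<in> cball 0 1" for t
      using that sc[of t] ne[of t] by (auto simp: W)
    show "snd w \<noteq> 0" if "w \<in> W" for w using that ne0 by (auto simp: W)
  qed (intro continuous_intros)
  then show ?thesis unfolding W by auto
qed

text \<open>The complex lines through the origin cannot all meet such a set: otherwise logarithms of the two
  coordinates, taken over the two hemispheres of the projective line, would differ by a logarithm
  of \<open>t\<close> on the equator.\<close>

lemma no_simply_connected_lines_through_origin:
  fixes \<Omega> :: "(complex \<times> complex) set"
  assumes op: "open \<Omega>" and ne0: "(0, 0) \<notin> \<Omega>"
    and sc: "\<And>a b. (a, b) \<noteq> (0, 0) \<Longrightarrow> simply_connected {c. (c * a, c * b) \<in> \<Omega>}"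
    and ne: "\<And>a b. (a, b) \<noteq> (0, 0) \<Longrightarrow> {c. (c * a, c * b) \<in> \<Omega>} \<noteq> {}"
  shows False
proof -
  \<comment> \<open>Exchanging the coordinates turns slopes of modulus at least 1 into slopes of
    modulus at most 1, so the same chart covers the other hemisphere.\<close>
  define \<Omega>' where "\<Omega>' \<equiv> (\<lambda>w. (snd w, fst w)) -` \<Omega>"
  have op': "open \<Omega>'"
    unfolding \<Omega>'_def by (intro open_vimage op) (auto intro!: continuous_intros)
  obtain l1 where l1: "continuous_on {(t, c). norm t \<le> 1 \<and> (c, c * t) \<in> \<Omega>} l1"
    "\<And>t c. norm t \<le> 1 \<Longrightarrow> (c, c * t) \<in> \<Omega> \<Longrightarrow> exp (l1 (t, c)) = c"
    using chart_logarithm[OF op ne0] sc[of 1] ne[of 1] by auto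
  have "\<exists>l. continuous_on {(t, c). norm t \<le> 1 \<and> (c, c * t) \<in> \<Omega>'} l \<and>
    (\<forall>t c. norm t \<le> 1 \<and> (c, c * t) \<in> \<Omega>' \<longrightarrow> exp (l (t, c)) = c)"
    using ne0 sc[of _ 1] ne[of _ 1] by (intro chart_logarithm op') (auto simp: \<Omega>'_def)
  then obtain l2 where l2: "continuous_on {(t, c). norm t \<le> 1 \<and> (c * t, c) \<in> \<Omega>} l2"
    "\<And>t c. norm t \<le> 1 \<Longrightarrow> (c * t, c) \<in> \<Omega> \<Longrightarrow> exp (l2 (t, c)) = c"
    by (auto simp: \<Omega>'_def)
  define S where "S \<equiv> {w. norm (fst w) = 1 \<and> (snd w, snd w * fst w) \<in> \<Omega>}"
  \<comment> \<open>On the equator the second chart sees the line of slope \<open>t\<close> with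
    slope \<open>inverse t\<close> and parameter \<open>c * t\<close>. The difference of the
    logarithms of the two coordinates is a logarithm of \<open>t\<close> alone, hence constant on
    fibres.\<close>
  define d where "d \<equiv> \<lambda>w::complex \<times> complex. l2 (inverse (fst w), snd w * fst w) - l1 w"
  have cancel: "c * t * inverse t = c" if "norm t = 1" for c t :: complex
    using that by (cases "t = 0") auto
  have contd: "continuous_on S d"
    unfolding d_def
  proof (intro continuous_intros)
    show "continuous_on S (\<lambda>w. l2 (inverse (fst w), snd w * fst w))"
      by (rule continuous_on_compose2[OF l2(1)])
        (auto simp: S_def norm_inverse cancel intro!: continuous_intros)
    show "continuous_on S l1" by (rule continuous_on_subset[OF l1(1)]) (auto simp: S_def)
  qed
  have expd: "exp (d w) = fst w" if "w \<in> S" for w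
  proof -
    have "fst w \<noteq> 0" "snd w \<noteq> 0" using that ne0 by (auto simp: S_def)
    moreover have "exp (l1 w) = snd w"
      using that l1(2)[of "fst w" "snd w"] by (auto simp: S_def)
    moreover have "exp (l2 (inverse (fst w), snd w * fst w)) = snd w * fst w"
      using that \<open>fst w \<noteq> 0\<close> by (intro l2(2)) (auto simp: S_def norm_inverse cancel)
    ultimately show ?thesis by (simp add: d_def exp_diff)
  qed
  have "\<exists>m. continuous_on (sphere 0 1) m \<and> (\<forall>w\<in>S. d w = m (fst w))"
  proof (rule continuous_descends[OF contd,
        where U = "\<lambda>w. (\<lambda>t. (snd w, snd w * t)) -` \<Omega>" and s = "\<lambda>w t. (t, snd w)"])
    show "d x = d y" if xy: "x \<in> S" "y \<in> S" "fst x = fst y" for x y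
    proof (rule continuous_logarithm_constant_on_connected[of "{w \<in> S. fst w = fst x}" d x y])
      have nz: "(1::complex, fst x) \<noteq> (0, 0)" by simp
      have "connected ((\<lambda>c. (fst x, c)) ` {c. (c * 1, c * fst x) \<in> \<Omega>})"
        by (intro connected_continuous_image continuous_intros simply_connected_imp_connected sc[OF nz])
      moreover have "(\<lambda>c. (fst x, c)) ` {c. (c * 1, c * fst x) \<in> \<Omega>} = {w \<in> S. fst w = fst x}"
        using xy by (force simp: S_def)
      ultimately show "connected {w \<in> S. fst w = fst x}" by simp
      show "continuous_on {w \<in> S. fst w = fst x} d" by (rule continuous_on_subset[OF contd]) auto
      show "exp (d u) = exp (d v)" if "u \<in> {w \<in> S. fst w = fst x}" "v \<in> {w \<in> S. fst w = fst x}" for u v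
        using that expd[of u] expd[of v] by simp
    qed (use xy in auto)
    show "fst ` S = sphere 0 1"
    proof
      show "fst ` S \<subseteq> sphere 0 1" by (auto simp: S_def)
      show "sphere 0 1 \<subseteq> fst ` S"
      proof
        fix t :: complex assume t: "t \<in> sphere 0 1"
        obtain c where "(c * 1, c * t) \<in> \<Omega>" using ne[of 1 t] by auto
        then have "(t, c) \<in> S" using t by (simp add: S_def)
        then show "t \<in> fst ` S" by force
      qed
    qed
    show "open ((\<lambda>t. (snd x, snd x * t)) -` \<Omega>)" for x :: "complex \<times> complex"
      by (intro open_vimage op) (auto intro!: continuous_intros)
  qed (auto simp: S_def intro!: continuous_intros)
  then obtain m where m: "continuous_on (sphere 0 1) m" "\<And>w. w \<in> S \<Longrightarrow> d w = m (fst w)" by blast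
  obtain t where t: "norm t = 1" "exp (m t) \<noteq> t" using no_logarithm_on_circle[OF m(1)] by blast
  obtain c where "(c * 1, c * t) \<in> \<Omega>" using ne[of 1 t] by auto
  then have "(t, c) \<in> S" using t by (simp add: S_def)
  then show False using m(2)[of "(t, c)"] expd[of "(t, c)"] t by simp
qed

section \<open>Linear convexity\<close>

lemma hermitian_inner_add_left: "hermitian_inner (x + y) m = hermitian_inner x m + hermitian_inner y m"
  and hermitian_inner_diff_left: "hermitian_inner (x - y) m = hermitian_inner x m - hermitian_inner y m"
  and hermitian_inner_scale_left: "hermitian_inner (c *s x) m = c * hermitian_inner x m"
  and hermitian_inner_scale_right: "hermitian_inner x (c *s m) = cnj c * hermitian_inner x m"
  and hermitian_inner_zero_left [simp]: "hermitian_inner 0 m = 0"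
  by (simp_all add: hermitian_inner_def sum.distrib sum_subtractf sum_distrib_left algebra_simps)

lemma hermitian_inner_cnj: "cnj (hermitian_inner x y) = hermitian_inner y x"
  by (simp add: hermitian_inner_def mult.commute)

lemma Re_hermitian_inner: "Re (hermitian_inner x y) = x \<bullet> y"
  by (simp add: hermitian_inner_def inner_vec_def inner_complex_def)

lemma hermitian_inner_self: "hermitian_inner x x = of_real ((norm x)\<^sup>2)"
proof -
  have "Im (hermitian_inner x x) = 0"
    using hermitian_inner_cnj[of x x] by (metis complex_cnj_cancel_iff add.inverse_inverse cnj.simps(2) complex_eq_iff equal_neg_zero)
  then show ?thesis
    by (simp add: complex_eq_iff Re_hermitian_inner power2_norm_eq_inner)
qed

lemma continuous_on_hermitian_inner [continuous_intros]:
  "continuous_on S f \<Longrightarrow> continuous_on S (\<lambda>x. hermitian_inner (f x) m)"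
  unfolding hermitian_inner_def by (intro continuous_intros)

lemma continuous_on_scalar_vec [continuous_intros]:
  fixes f :: "'a::topological_space \<Rightarrow> complex" and g :: "'a \<Rightarrow> complex ^ 'n"
  assumes "continuous_on S f" "continuous_on S g"
  shows "continuous_on S (\<lambda>x. f x *s g x)"
  unfolding vector_scalar_mult_def using assms by (intro continuous_intros)

section \<open>Complex affine sections and functional images of C-convex sets\<close>

lemma C_convex_simply_connected_slice:
  fixes D :: "(complex ^ 'n::finite) set"
  assumes D: "C_convex D" and b: "b \<noteq> 0" and ne: "{c. p + c *s b \<in> D} \<noteq> {}"
  shows "simply_connected {c. p + c *s b \<in> D}"
proof -
  obtain i where i: "b $ i \<noteq> 0" using b by (auto simp: vec_eq_iff)
  have "is_complex_line (complex_line p b)" using b by (auto simp: is_complex_line_def)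
  moreover have "D \<inter> complex_line p b \<noteq> {}" using ne by (auto simp: complex_line_def)
  ultimately have "simply_connected (D \<inter> complex_line p b)" using D by (auto simp: C_convex_def)
  moreover have "{c. p + c *s b \<in> D} homeomorphic D \<inter> complex_line p b"
    unfolding homeomorphic_def
  proof (intro exI homeomorphismI)
    show "continuous_on {c. p + c *s b \<in> D} (\<lambda>c. p + c *s b)"
      "continuous_on (D \<inter> complex_line p b) (\<lambda>w. (w $ i - p $ i) / b $ i)"
      using i by (auto intro!: continuous_intros)
  qed (use i in \<open>auto simp: complex_line_def\<close>)
  ultimately show ?thesis using homeomorphic_simply_connected_eq by blast
qed

text \<open>Encoded by closure under complex lines through two points, because such lines are the
  only means of moving around in a C-convex set; no direction space has to be named.\<close>

definition complex_affine :: "(complex ^ 'n) set \<Rightarrow> bool" where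
  "complex_affine A \<longleftrightarrow> (\<forall>x\<in>A. \<forall>y\<in>A. \<forall>c. x + c *s (y - x) \<in> A)"

lemma complex_affineD: "complex_affine A \<Longrightarrow> x \<in> A \<Longrightarrow> y \<in> A \<Longrightarrow> x + c *s (y - x) \<in> A"
  unfolding complex_affine_def by blast

text \<open>The complex line through two points of the section stays in \<open>A\<close>, and
  C-convexity makes its part inside \<open>D\<close> connected.\<close>

lemma connected_C_convex_Int:
  fixes D :: "(complex ^ 'n::finite) set"
  assumes D: "C_convex D" and A: "complex_affine A"
  shows "connected (D \<inter> A)"
  unfolding connected_iff_connected_component
proof (intro ballI)
  fix x y assume x: "x \<in> D \<inter> A" and y: "y \<in> D \<inter> A"
  show "connected_component (D \<inter> A) x y"
  proof (cases "x = y")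
    case True
    then show ?thesis using x connected_component_refl by blast
  next
    case False
    define S where "S \<equiv> {c. x + c *s (y - x) \<in> D}"
    have 01: "0 \<in> S" "1 \<in> S" using x y by (auto simp: S_def)
    have "simply_connected S"
      unfolding S_def
    proof (rule C_convex_simply_connected_slice[OF D])
      show "y - x \<noteq> 0" using False by simp
      show "{c. x + c *s (y - x) \<in> D} \<noteq> {}" using 01(1) unfolding S_def by blast
    qed
    then have "connected ((\<lambda>c. x + c *s (y - x)) ` S)"
      by (intro connected_continuous_image continuous_intros simply_connected_imp_connected)
    moreover have "(\<lambda>c. x + c *s (y - x)) ` S \<subseteq> D \<inter> A"
      using complex_affineD[OF A, of x y] x y unfolding S_def by blast
    moreover have "x \<in> (\<lambda>c. x + c *s (y - x)) ` S" "y \<in> (\<lambda>c. x + c *s (y - x)) ` S"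
      using 01 by (auto intro!: image_eqI[of x _ 0] image_eqI[of y _ 1])
    ultimately show ?thesis unfolding connected_component_def by blast
  qed
qed

text \<open>The section is swept out by complex lines through one point \<open>p\<close>: the pairs
  \<open>(z, c)\<close> with \<open>p + c *s (z - p)\<close> in \<open>D\<close> have simply
  connected fibres. A logarithm there, normalised at \<open>c = 0\<close>, restricts at
  \<open>c = 1\<close> to a logarithm of \<open>f\<close>.\<close>

lemma Borsukian_C_convex_Int:
  fixes D :: "(complex ^ 'n::finite) set"
  assumes opD: "open D" and D: "C_convex D" and A: "complex_affine A"
  shows "Borsukian (D \<inter> A)"
proof (cases "D \<inter> A = {}")
  case True
  then show ?thesis using Borsukian_empty by metis
next
  case False
  then obtain p where p: "p \<in> D \<inter> A" by blast
  show ?thesis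
    unfolding Borsukian_continuous_logarithm
  proof (intro allI impI)
    fix f :: "complex ^ 'n \<Rightarrow> complex" assume f: "continuous_on (D \<inter> A) f \<and> f \<in> D \<inter> A \<rightarrow> - {0}"
    define h where "h \<equiv> \<lambda>w::(complex ^ 'n) \<times> complex. p + snd w *s (fst w - p)"
    define W where "W \<equiv> ((D \<inter> A) \<times> UNIV) \<inter> h -` D"
    have conth: "continuous_on X h" for X unfolding h_def by (intro continuous_intros)
    have hA: "h w \<in> D \<inter> A" if "w \<in> W" for w
      using complex_affineD[OF A, of p "fst w" "snd w"] that p unfolding W_def h_def by (cases w) (simp del: vector_ssub_ldistrib)
    have W_iff: "(z, c) \<in> W \<longleftrightarrow> z \<in> D \<inter> A \<and> p + c *s (z - p) \<in> D" for z c
      by (auto simp: W_def h_def)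
    have "\<exists>l. continuous_on W l \<and> (\<forall>w\<in>W. exp (l w) = f (h w))"
    proof (rule fibrewise_logarithm[of "D \<inter> A" W 0 "\<lambda>w. f (h w)" "\<lambda>_. Ln (f p)"])
      show "openin (top_of_set ((D \<inter> A) \<times> UNIV)) W"
        unfolding W_def by (rule continuous_openin_preimage_gen[OF conth opD])
      show "simply_connected {c. (z, c) \<in> W}" if z: "z \<in> D \<inter> A" for z
      \<comment> \<open>At \<open>z = p\<close> the line degenerates to a point and the fibre of
        parameters is the whole plane.\<close>
      proof (cases "z = p")
        case True
        then have "{c. (z, c) \<in> W} = UNIV" using z by (auto simp: W_iff)
        then show ?thesis by (simp add: convex_imp_simply_connected)
      next
        case False
        have "{c. (z, c) \<in> W} = {c. p + c *s (z - p) \<in> D}" using z by (auto simp: W_iff)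
        moreover have "0 \<in> {c. p + c *s (z - p) \<in> D}" using p by simp
        ultimately show ?thesis
          using C_convex_simply_connected_slice[OF D, of "z - p" p] False by (metis empty_iff right_minus_eq)
      qed
      show "(z, 0) \<in> W" if "z \<in> D \<inter> A" for z using that p by (auto simp: W_iff)
      show "continuous_on W (\<lambda>w. f (h w))"
        by (rule continuous_on_compose2[OF conjunct1[OF f] conth]) (use hA in blast)
      show "f (h w) \<noteq> 0" if "w \<in> W" for w using f hA[OF that] by (auto simp: Pi_iff)
      show "exp (Ln (f p)) = f (h (z, 0))" for z
      proof -
        have "f p \<noteq> 0" using f p by (auto simp: Pi_iff)
        then show ?thesis by (simp add: h_def)
      qed
    qed (rule continuous_on_const)
    then obtain l where l: "continuous_on W l" "\<And>w. w \<in> W \<Longrightarrow> exp (l w) = f (h w)"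
      by blast
    have in_W: "(z, 1) \<in> W" if "z \<in> D \<inter> A" for z using that by (auto simp: W_iff)
    have "continuous_on (D \<inter> A) (\<lambda>z. l (z, 1))"
      by (rule continuous_on_compose2[OF l(1)]) (use in_W in \<open>auto intro!: continuous_intros\<close>)
    moreover have "f z = exp (l (z, 1))" if "z \<in> D \<inter> A" for z
      using l(2)[OF in_W[OF that]] by (simp add: h_def)
    ultimately show "\<exists>g. continuous_on (D \<inter> A) g \<and> (\<forall>x\<in>D \<inter> A. f x = exp (g x))"
      by (intro exI[of _ "\<lambda>z. l (z, 1)"] conjI ballI)
  qed
qed

text \<open>Translating along \<open>b\<close>, on which the functional is 1, gives openness and
  local sections; the fibres are again complex affine sections of \<open>D\<close>, hence connected.
  The image therefore inherits logarithms from \<open>D \<inter> A\<close>, and for connected open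
  planar sets this means simple connectivity.\<close>

lemma functional_image_C_convex:
  fixes D :: "(complex ^ 'n::finite) set"
  assumes opD: "open D" and D: "C_convex D" and A: "complex_affine A"
    and Ab: "\<And>x c. x \<in> A \<Longrightarrow> x + c *s b \<in> A" and b: "hermitian_inner b m = 1"
  shows "open ((\<lambda>x. hermitian_inner x m) ` (D \<inter> A))"
    and "simply_connected ((\<lambda>x. hermitian_inner x m) ` (D \<inter> A))"
proof -
  define \<phi> where "\<phi> \<equiv> \<lambda>x. hermitian_inner x m"
  define T where "T \<equiv> \<phi> ` (D \<inter> A)"
  define s where "s \<equiv> \<lambda>x t. x + (t - \<phi> x) *s b"
  define U where "U \<equiv> \<lambda>x. s x -` D"
  have conts: "continuous_on X (s x)" for X x unfolding s_def by (intro continuous_intros)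
  have opU: "open (U x)" for x
    unfolding U_def using opD conts by (intro open_vimage) auto
  have phis: "\<phi> (s x t) = t" for x t
    using b by (simp only: \<phi>_def s_def hermitian_inner_add_left hermitian_inner_scale_left) simp
  have xU: "\<phi> x \<in> U x" if "x \<in> D" for x using that by (simp add: U_def s_def)
  have sA: "s x t \<in> A" if "x \<in> A" for x t unfolding s_def using that by (rule Ab)
  have UT: "U x \<subseteq> T" if "x \<in> A" for x
  proof
    fix t assume "t \<in> U x"
    then have "s x t \<in> D \<inter> A" using sA[OF that] by (auto simp: U_def)
    then show "t \<in> T" unfolding T_def using phis[of x t] by (intro image_eqI[of t \<phi> "s x t"]) auto
  qed
  have opT: "open T"
  proof (subst open_subopen, intro ballI)
    fix t assume "t \<in> T"
    then obtain x where "x \<in> D \<inter> A" "t = \<phi> x" by (auto simp: T_def)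
    then show "\<exists>Ta. open Ta \<and> t \<in> Ta \<and> Ta \<subseteq> T"
      using opU xU UT by (intro exI[of _ "U x"]) auto
  qed
  have cont: "continuous_on X \<phi>" for X unfolding \<phi>_def by (intro continuous_intros)
  have im: "\<phi> ` (D \<inter> A) = T" by (simp add: T_def)
  have "Borsukian T"
  proof (rule Borsukian_image[OF Borsukian_C_convex_Int[OF opD D A] cont im])
    fix t
    have "complex_affine {x \<in> A. \<phi> x = t}"
      unfolding complex_affine_def
    proof (intro ballI allI)
      fix x y c assume xy: "x \<in> {x \<in> A. \<phi> x = t}" "y \<in> {x \<in> A. \<phi> x = t}"
      have "\<phi> (x + c *s (y - x)) = \<phi> x + c * (\<phi> y - \<phi> x)"
        by (simp only: \<phi>_def hermitian_inner_add_left hermitian_inner_diff_left hermitian_inner_scale_left)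
      with xy show "x + c *s (y - x) \<in> {x \<in> A. \<phi> x = t}"
        using complex_affineD[OF A, of x y c] by (simp del: vector_ssub_ldistrib)
    qed
    then have "connected (D \<inter> {x \<in> A. \<phi> x = t})" using connected_C_convex_Int[OF D] by blast
    moreover have "D \<inter> {x \<in> A. \<phi> x = t} = {x \<in> D \<inter> A. \<phi> x = t}" by auto
    ultimately show "connected {x \<in> D \<inter> A. \<phi> x = t}" by simp
  next
    show "open (U x)" "continuous_on (U x \<inter> T) (s x)" for x by (rule opU, rule conts)
    show "\<phi> x \<in> U x" if "x \<in> D \<inter> A" for x using that xU by blast
    show "s x t \<in> D \<inter> A" if "x \<in> D \<inter> A" "t \<in> U x \<inter> T" for x t
      using sA that unfolding U_def by blast
    show "\<phi> (s x t) = t" for x t by (rule phis)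
  qed
  moreover have "connected T"
    unfolding T_def by (intro connected_continuous_image cont connected_C_convex_Int D A)
  ultimately show "open ((\<lambda>x. hermitian_inner x m) ` (D \<inter> A))"
    "simply_connected ((\<lambda>x. hermitian_inner x m) ` (D \<inter> A))"
    using opT simply_connected_eq_Borsukian[OF opT] unfolding im[symmetric, unfolded \<phi>_def] by auto
qed

section \<open>Complex subspaces and saturation along them\<close>

lemma hermitian_orthogonal_part:
  assumes V: "vec.subspace V"
  shows "\<exists>v\<in>V. \<forall>u\<in>V. hermitian_inner u (b - v) = 0"
proof -
  have "subspace V"
  proof (rule subspaceI)
    show "c *\<^sub>R x \<in> V" if "x \<in> V" for c x
    proof -
      have "c *\<^sub>R x = (of_real c :: complex) *s x" by (simp add: vec_eq_iff) (simp add: scaleR_conv_of_real)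
      then show ?thesis using vec.subspace_scale[OF V that] by simp
    qed
  qed (use V vec.subspace_0 vec.subspace_add in blast)+
  then have sp: "span V = V" by simp
  obtain y z where yz: "y \<in> span V" "\<And>w. w \<in> span V \<Longrightarrow> orthogonal z w" "b = y + z"
    using orthogonal_subspace_decomp_exists[of V b] by blast
  \<comment> \<open>Real orthogonality upgrades to Hermitian orthogonality because \<open>V\<close>
    is stable under \<open>\<i>\<close>: testing against \<open>u\<close> and
    \<open>\<i> *s u\<close> kills the real and the imaginary part.\<close>
  have z: "hermitian_inner u z = 0" if u: "u \<in> V" for u
  proof -
    have "Re (hermitian_inner u z) = 0"
      using yz(2)[of u] u sp by (simp add: Re_hermitian_inner orthogonal_def inner_commute)
    moreover have "Re (hermitian_inner (\<i> *s u) z) = 0"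
      using yz(2)[of "\<i> *s u"] vec.subspace_scale[OF V u] sp
      by (simp add: Re_hermitian_inner orthogonal_def inner_commute)
    ultimately show ?thesis by (simp add: hermitian_inner_scale_left complex_eq_iff)
  qed
  moreover have "b - y = z" using yz(3) by simp
  ultimately show ?thesis using yz(1) sp by blast
qed

lemma functional_vanishing_on_subspace:
  assumes V: "vec.subspace V" and b: "b \<notin> V"
  obtains m where "\<And>u. u \<in> V \<Longrightarrow> hermitian_inner u m = 0" "hermitian_inner b m = 1"
proof -
  obtain v where v: "v \<in> V" "\<And>u. u \<in> V \<Longrightarrow> hermitian_inner u (b - v) = 0"
    using hermitian_orthogonal_part[OF V] by blast
  have "b - v \<noteq> 0" using b v(1) by auto
  then have nz: "hermitian_inner (b - v) (b - v) \<noteq> 0" by (simp add: hermitian_inner_self)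
  have bb: "hermitian_inner b (b - v) = hermitian_inner (b - v) (b - v)"
    using v by (simp add: hermitian_inner_diff_left)
  show ?thesis
  proof
    have self: "cnj (hermitian_inner (b - v) (b - v)) = hermitian_inner (b - v) (b - v)"
      by (rule hermitian_inner_cnj)
    show "hermitian_inner u (inverse (hermitian_inner (b - v) (b - v)) *s (b - v)) = 0" if "u \<in> V" for u
      using v(2)[OF that] by (simp only: hermitian_inner_scale_right) simp
    show "hermitian_inner b (inverse (hermitian_inner (b - v) (b - v)) *s (b - v)) = 1"
      using nz bb self by (simp only: hermitian_inner_scale_right complex_cnj_inverse) simp
  qed
qed


text \<open>For a subspace \<open>V\<close> this is the preimage of the image of \<open>D\<close> in
  the quotient by \<open>V\<close>; it allows work modulo \<open>V\<close> without leaving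
  \<open>complex ^ 'n\<close>.\<close>

definition subspace_saturation :: "(complex ^ 'n) set \<Rightarrow> (complex ^ 'n) set \<Rightarrow> (complex ^ 'n) set" where
  "subspace_saturation V D = {x. \<exists>v\<in>V. x + v \<in> D}"

lemma open_subspace_saturation:
  assumes "open D"
  shows "open (subspace_saturation V D)"
proof -
  have "subspace_saturation V D = (\<Union>v\<in>V. (\<lambda>x. x + v) -` D)"
    by (auto simp: subspace_saturation_def)
  moreover have "open ((\<lambda>x. x + v) -` D)" for v
    by (intro open_vimage assms continuous_intros)
  ultimately show ?thesis by auto
qed

text \<open>Let \<open>A\<close> be the affine space through \<open>p\<close> spanned by
  \<open>b\<close> and \<open>V\<close>, and let \<open>m\<close> vanish on \<open>V\<close> with
  value 1 at \<open>b\<close>. The slice is a translate of the image of \<open>D \<inter> A\<close>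
  under \<open>m\<close>; if \<open>b\<close> lies in \<open>V\<close>, it is the whole plane
  instead.\<close>

lemma simply_connected_saturation_slice:
  fixes D :: "(complex ^ 'n::finite) set"
  assumes opD: "open D" and D: "C_convex D" and V: "vec.subspace V"
    and ne: "{c. p + c *s b \<in> subspace_saturation V D} \<noteq> {}"
  shows "simply_connected {c. p + c *s b \<in> subspace_saturation V D}"
proof (cases "b \<in> V")
  case True
  obtain c v where cv: "v \<in> V" "p + c *s b + v \<in> D" using ne by (auto simp: subspace_saturation_def)
  have "p + d *s b \<in> subspace_saturation V D" for d
  proof -
    have "v + (c - d) *s b \<in> V"
      using V True cv(1) by (intro vec.subspace_add vec.subspace_scale)
    moreover have "p + d *s b + (v + (c - d) *s b) = p + c *s b + v"
      by (simp add: vector_sub_rdistrib)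
    ultimately show ?thesis using cv(2) unfolding subspace_saturation_def by (metis (mono_tags) mem_Collect_eq)
  qed
  then have "{c. p + c *s b \<in> subspace_saturation V D} = UNIV" by auto
  then show ?thesis by (simp add: convex_imp_simply_connected)
next
  case False
  obtain m where m: "\<And>u. u \<in> V \<Longrightarrow> hermitian_inner u m = 0" "hermitian_inner b m = 1"
    using functional_vanishing_on_subspace[OF V False] by metis
  define A where "A = {p + c *s b + v | c v. v \<in> V}"
  have A: "complex_affine A"
    unfolding complex_affine_def
  proof (intro ballI allI)
    fix x y c assume "x \<in> A" "y \<in> A"
    then obtain c1 v1 c2 v2 where x: "x = p + c1 *s b + v1" "v1 \<in> V" and y: "y = p + c2 *s b + v2" "v2 \<in> V"
      by (auto simp: A_def)
    have "v1 + c *s (v2 - v1) \<in> V"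
      using V x y by (intro vec.subspace_add vec.subspace_scale vec.subspace_diff)
    moreover have "x + c *s (y - x) = p + (c1 + c * (c2 - c1)) *s b + (v1 + c *s (v2 - v1))"
      unfolding x y by (simp add: vec_eq_iff algebra_simps)
    ultimately show "x + c *s (y - x) \<in> A" unfolding A_def by blast
  qed
  have Ab: "x + c *s b \<in> A" if "x \<in> A" for x c
  proof -
    obtain c1 v1 where x: "x = p + c1 *s b + v1" "v1 \<in> V" using \<open>x \<in> A\<close> by (auto simp: A_def)
    have "x + c *s b = p + (c1 + c) *s b + v1" unfolding x by (simp add: vec_eq_iff algebra_simps)
    then show ?thesis using x(2) unfolding A_def by blast
  qed
  have val: "hermitian_inner (p + c *s b + v) m = hermitian_inner p m + c" if "v \<in> V" for c v
    using m(1)[OF that] m(2) by (simp add: hermitian_inner_add_left hermitian_inner_scale_left)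
  have eq: "(\<lambda>x. hermitian_inner x m) ` (D \<inter> A) = (+) (hermitian_inner p m) ` {c. p + c *s b \<in> subspace_saturation V D}"
    (is "?L = ?R")
  proof
    show "?L \<subseteq> ?R"
    proof
      fix t assume "t \<in> ?L"
      then obtain c v where "v \<in> V" "p + c *s b + v \<in> D" "t = hermitian_inner (p + c *s b + v) m"
        by (auto simp: A_def)
      then show "t \<in> ?R" using val by (auto simp: subspace_saturation_def)
    qed
    show "?R \<subseteq> ?L"
    proof
      fix t assume "t \<in> ?R"
      then obtain c v where cv: "v \<in> V" "p + c *s b + v \<in> D" "t = hermitian_inner p m + c"
        by (auto simp: subspace_saturation_def)
      have "p + c *s b + v \<in> D \<inter> A" using cv unfolding A_def by blast
      moreover have "t = hermitian_inner (p + c *s b + v) m" using val cv by simp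
      ultimately show "t \<in> ?L" by blast
    qed
  qed
  have "simply_connected ?L" by (rule functional_image_C_convex(2)[OF opD D A Ab m(2)])
  then show ?thesis
    unfolding eq using homeomorphic_simply_connected_eq homeomorphic_translation by blast
qed

text \<open>A maximal complex affine subspace through \<open>p\<close> missing \<open>D\<close> is a hyperplane: in codimension at least
  two, modulo that subspace all lines through \<open>p\<close> in some plane would meet \<open>D\<close>.\<close>

theorem C_convex_imp_linearly_convex:
  fixes D :: "(complex ^ 'n::finite) set"
  assumes opD: "open D" and D: "C_convex D" and ne: "D \<noteq> {}" and p: "p \<notin> D"
  obtains m where "\<And>x. x \<in> D \<Longrightarrow> hermitian_inner (x - p) m \<noteq> 0"
proof -
  define Q where "Q = (\<lambda>V. vec.subspace V \<and> (\<forall>v\<in>V. p + v \<notin> D))"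
  have Q0: "Q {0}" using p by (simp add: Q_def)
  have "vec.dim V \<le> CARD('n)" for V :: "(complex ^ 'n) set"
    using vec.dim_subset_UNIV[of V] by (simp add: vec.dimension_def card_cart_basis)
  then obtain V where V: "Q V" "\<And>V'. Q V' \<Longrightarrow> vec.dim V' \<le> vec.dim V"
    using ex_has_greatest_nat[of Q "{0}" vec.dim "Suc CARD('n)"] Q0 less_Suc_eq_le by blast
  then have sub: "vec.subspace V" and Vp: "\<And>v. v \<in> V \<Longrightarrow> p + v \<notin> D" by (auto simp: Q_def)
  \<comment> \<open>Maximality of \<open>V\<close>: adjoining any direction outside it must make the
    enlarged affine space meet \<open>D\<close>.\<close>
  have hit: "\<exists>c. \<exists>v\<in>V. p + c *s b + v \<in> D" if b: "b \<notin> V" for b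
  proof (rule ccontr)
    assume no: "\<not> (\<exists>c. \<exists>v\<in>V. p + c *s b + v \<in> D)"
    define V' where "V' = vec.span (insert b V)"
    have "p + w \<notin> D" if w: "w \<in> V'" for w
    proof -
      obtain c where "w - c *s b \<in> vec.span V"
        using w vec.span_breakdown_eq unfolding V'_def by blast
      then have "w - c *s b \<in> V" using sub vec.span_eq_iff by blast
      then have "p + c *s b + (w - c *s b) \<notin> D" using no by blast
      then show ?thesis by simp
    qed
    then have "Q V'" by (simp add: Q_def V'_def vec.subspace_span)
    then have "vec.dim V' \<le> vec.dim V" using V(2) by blast
    moreover have VV': "V \<subseteq> V'" unfolding V'_def using vec.span_superset by blast
    moreover have "vec.subspace V'" by (simp add: V'_def vec.subspace_span)
    ultimately have "V = V'" using sub vec.subspace_dim_equal by blast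
    moreover have "b \<in> V'" unfolding V'_def by (intro vec.span_base) simp
    ultimately show False using b by simp
  qed
  obtain x0 where x0: "x0 \<in> D" using ne by blast
  define b1 where "b1 = x0 - p"
  have b1: "b1 \<notin> V" using Vp[of b1] x0 by (auto simp: b1_def)
  obtain m where m: "\<And>u. u \<in> V \<Longrightarrow> hermitian_inner u m = 0" "hermitian_inner b1 m = 1"
    using functional_vanishing_on_subspace[OF sub b1] by metis
  show ?thesis
  \<comment> \<open>If the kernel of \<open>m\<close> lies in \<open>V\<close>, the space missing
    \<open>D\<close> is already a hyperplane and \<open>m\<close> is the wanted functional.
    Otherwise a kernel vector \<open>b2\<close> outside \<open>V\<close> is independent of
    \<open>b1\<close> modulo \<open>V\<close>.\<close>
  proof (cases "\<exists>b. hermitian_inner b m = 0 \<and> b \<notin> V")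
    case False
    have "hermitian_inner (x - p) m \<noteq> 0" if "x \<in> D" for x
      using False Vp[of "x - p"] that by auto
    then show ?thesis by (rule that)
  next
    case True
    then obtain b2 where b2: "hermitian_inner b2 m = 0" "b2 \<notin> V" by blast
    have ind: "a *s b1 + c *s b2 \<notin> V" if ac: "(a, c) \<noteq> (0, 0)" for a c
    proof
      assume inV: "a *s b1 + c *s b2 \<in> V"
      have "hermitian_inner (a *s b1 + c *s b2) m = a"
        using m(2) b2(1) by (simp add: hermitian_inner_add_left hermitian_inner_scale_left)
      then have a: "a = 0" using m(1)[OF inV] by simp
      then have "c \<noteq> 0" "c *s b2 \<in> V" using ac inV by auto
      then have "inverse c *s (c *s b2) \<in> V" using vec.subspace_scale[OF sub] by blast
      then show False using \<open>c \<noteq> 0\<close> b2(2) by simp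
    qed
    define h where "h = (\<lambda>w. p + (fst w *s b1 + snd w *s b2))"
    \<comment> \<open>\<open>\<Omega>\<close> describes the saturated domain in the plane through
      \<open>p\<close> spanned by \<open>b1\<close> and \<open>b2\<close>. Its origin is
      \<open>p\<close>, hence omitted, while by \<open>hit\<close> every complex line through the
      origin meets it.\<close>
    define \<Omega> where "\<Omega> = h -` subspace_saturation V D"
    have slice: "{d. (d * a, d * c) \<in> \<Omega>} = {d. p + d *s (a *s b1 + c *s b2) \<in> subspace_saturation V D}" for a c
      by (simp add: \<Omega>_def h_def vector_add_ldistrib)
    have slice_ne: "{d. (d * a, d * c) \<in> \<Omega>} \<noteq> {}" if ac: "(a, c) \<noteq> (0, 0)" for a c
    proof -
      obtain d v where "v \<in> V" "p + d *s (a *s b1 + c *s b2) + v \<in> D" using hit[OF ind[OF ac]] by blast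
      then have "d \<in> {d. (d * a, d * c) \<in> \<Omega>}" unfolding slice subspace_saturation_def by blast
      then show ?thesis by blast
    qed
    have False
    proof (rule no_simply_connected_lines_through_origin[of \<Omega>])
      show "open \<Omega>"
        unfolding \<Omega>_def h_def
        by (intro open_vimage open_subspace_saturation opD continuous_intros)
      show "(0, 0) \<notin> \<Omega>" using Vp by (simp add: \<Omega>_def h_def subspace_saturation_def)
      show "{d. (d * a, d * c) \<in> \<Omega>} \<noteq> {}" if "(a, c) \<noteq> (0, 0)" for a c by (rule slice_ne[OF that])
      show "simply_connected {d. (d * a, d * c) \<in> \<Omega>}" if "(a, c) \<noteq> (0, 0)" for a c
        using slice_ne[OF that] unfolding slice by (rule simply_connected_saturation_slice[OF opD D sub])
    qed
    then show ?thesis ..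
  qed
qed

section \<open>Areas of holomorphic images and the Koebe quarter theorem\<close>

lemma bounded_linear_complex_to_real2: "bounded_linear (\<lambda>z. vector [Re z, Im z] :: real ^ 2)"
  unfolding linear_conv_bounded_linear[symmetric]
  by (rule linearI) (auto simp: vec_eq_iff forall_2)

text \<open>Identifies the plane as \<open>complex\<close> with the plane as
  \<open>real ^ 2\<close>, where derivatives have matrices and determinants.\<close>

lemma lborel_real2_eq_distr_complex:
  "distr lborel borel (\<lambda>z. vector [Re z, Im z] :: real ^ 2) = lborel"
proof (rule lborel_eqI[symmetric])
  have meas: "(\<lambda>z. vector [Re z, Im z] :: real ^ 2) \<in> borel_measurable borel"
    by (intro borel_measurable_continuous_onI linear_continuous_on bounded_linear_complex_to_real2)
  have B: "Basis = {axis 1 1, axis 2 1 :: real ^ 2}"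
    by (auto simp: Basis_vec_def UNIV_2)
  have ne: "axis 1 1 \<noteq> (axis 2 1 :: real ^ 2)" by (auto simp: axis_eq_axis)
  fix l u :: "real ^ 2" assume lu: "\<And>b. b \<in> Basis \<Longrightarrow> l \<bullet> b \<le> u \<bullet> b"
  then have lu': "l $ 1 \<le> u $ 1" "l $ 2 \<le> u $ 2" using lu[of "axis 1 1"] lu[of "axis 2 1"] by (auto simp: B inner_axis)
  have "(\<lambda>z. vector [Re z, Im z] :: real ^ 2) -` box l u = box (Complex (l $ 1) (l $ 2)) (Complex (u $ 1) (u $ 2))"
    unfolding box_complex_eq by (auto simp: mem_box B inner_axis)
  then have "emeasure (distr lborel borel (\<lambda>z. vector [Re z, Im z] :: real ^ 2)) (box l u)
      = emeasure lborel (box (Complex (l $ 1) (l $ 2)) (Complex (u $ 1) (u $ 2)))"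
    using meas by (subst emeasure_distr) auto
  also have "\<dots> = ennreal ((u $ 1 - l $ 1) * (u $ 2 - l $ 2))"
    using lu' by (subst emeasure_lborel_box) (auto simp: Basis_complex_def)
  also have "\<dots> = ennreal (\<Prod>b\<in>Basis. (u - l) \<bullet> b)"
    using ne by (simp add: B inner_axis)
  finally show "emeasure (distr lborel borel (\<lambda>z. vector [Re z, Im z] :: real ^ 2)) (box l u) = ennreal (\<Prod>b\<in>Basis. (u - l) \<bullet> b)" .
qed simp

text \<open>The real Jacobian of a holomorphic map is the squared modulus of its derivative.
  Substitution is carried out on \<open>real ^ 2\<close> for absolutely integrable functions, which
  is where the finiteness of the right-hand side enters.\<close>

lemma nn_integral_holomorphic_change_of_variables:
  fixes f f' :: "complex \<Rightarrow> complex" and h :: "complex \<Rightarrow> real"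
  assumes S [measurable]: "S \<in> sets borel" and fS [measurable]: "f ` S \<in> sets borel"
    and der: "\<And>z. z \<in> S \<Longrightarrow> (f has_field_derivative f' z) (at z)" and contf': "continuous_on S f'"
    and inj: "inj_on f S"
    and h [measurable]: "h \<in> borel_measurable borel" and h0: "\<And>w. 0 \<le> h w"
    and fin: "(\<integral>\<^sup>+w. ennreal (h w) * indicator (f ` S) w \<partial>lborel) < \<infinity>"
  shows "(\<integral>\<^sup>+z. ennreal ((norm (f' z))\<^sup>2 * h (f z)) * indicator S z \<partial>lborel)
    = (\<integral>\<^sup>+w. ennreal (h w) * indicator (f ` S) w \<partial>lborel)"
proof -
  define \<phi> :: "complex \<Rightarrow> real ^ 2" where "\<phi> = (\<lambda>z. vector [Re z, Im z])"
  define \<psi> :: "real ^ 2 \<Rightarrow> complex" where "\<psi> = (\<lambda>y. Complex (y $ 1) (y $ 2))"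
  have \<phi>\<psi>: "\<phi> (\<psi> y) = y" for y by (simp add: \<phi>_def \<psi>_def vec_eq_iff forall_2)
  have \<psi>\<phi>: "\<psi> (\<phi> z) = z" for z by (simp add: \<phi>_def \<psi>_def)
  have lin\<phi>: "bounded_linear \<phi>"
    unfolding \<phi>_def by (rule bounded_linear_complex_to_real2)
  have lin\<psi>: "bounded_linear \<psi>"
    unfolding \<psi>_def linear_conv_bounded_linear[symmetric]
    by (rule linearI) (auto simp: complex_eq_iff)
  have [measurable]: "\<phi> \<in> borel_measurable borel" "\<psi> \<in> borel_measurable borel"
    using lin\<phi> lin\<psi> by (auto intro!: borel_measurable_continuous_onI linear_continuous_on)
  have distr: "distr lborel borel \<phi> = lborel" unfolding \<phi>_def by (rule lborel_real2_eq_distr_complex)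
  have trans: "(\<integral>\<^sup>+y. F y \<partial>lborel) = (\<integral>\<^sup>+z. F (\<phi> z) \<partial>lborel)" if "F \<in> borel_measurable borel" for F :: "real ^ 2 \<Rightarrow> ennreal"
    using that by (subst distr[symmetric]) (simp add: nn_integral_distr)
  define S' where "S' = \<psi> -` S"
  define g where "g = (\<lambda>y. \<phi> (f (\<psi> y)))"
  define g' where "g' = (\<lambda>y v. \<phi> (f' (\<psi> y) * \<psi> v))"
  define H where "H = (\<lambda>y. h (\<psi> y))"
  have S': "S' \<in> sets borel" unfolding S'_def by (rule measurable_sets_borel[OF _ S]) simp
  have H: "H \<in> borel_measurable borel" unfolding H_def by measurable
  have gS: "g ` S' = \<psi> -` (f ` S)"
  proof
    show "g ` S' \<subseteq> \<psi> -` (f ` S)" by (auto simp: g_def S'_def \<psi>\<phi>)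
    show "\<psi> -` (f ` S) \<subseteq> g ` S'"
    proof
      fix y assume "y \<in> \<psi> -` (f ` S)"
      then obtain z where z: "z \<in> S" "\<psi> y = f z" by auto
      then have "y = g (\<phi> z)" by (metis \<phi>\<psi> \<psi>\<phi> g_def)
      moreover have "\<phi> z \<in> S'" using z by (simp add: S'_def \<psi>\<phi>)
      ultimately show "y \<in> g ` S'" by blast
    qed
  qed
  have gSb: "g ` S' \<in> sets borel" unfolding gS by (rule measurable_sets_borel[OF _ fS]) simp
  have derg: "(g has_derivative g' y) (at y within S')" if "y \<in> S'" for y
  proof -
    have "(f has_derivative (*) (f' (\<psi> y))) (at (\<psi> y))"
      using der[of "\<psi> y"] that by (simp add: S'_def has_field_derivative_def)
    then have "((\<lambda>y. f (\<psi> y)) has_derivative (\<lambda>v. f' (\<psi> y) * \<psi> v)) (at y)"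
      using has_derivative_compose[OF bounded_linear_imp_has_derivative[OF lin\<psi>]] by blast
    then have "(g has_derivative g' y) (at y)"
      unfolding g_def g'_def by (rule bounded_linear.has_derivative[OF lin\<phi>])
    then show ?thesis by (rule has_derivative_at_withinI)
  qed
  have injg: "inj_on g S'"
    using inj unfolding inj_on_def g_def S'_def by (metis \<phi>\<psi> \<psi>\<phi> vimageE)
  \<comment> \<open>Multiplication by u + \<i>v has the matrix with rows (u, -v) and (v, u).\<close>
  have det: "\<bar>det (matrix (g' y))\<bar> = (norm (f' (\<psi> y)))\<^sup>2" for y
  proof -
    have "det (matrix (g' y)) = (Re (f' (\<psi> y)))\<^sup>2 + (Im (f' (\<psi> y)))\<^sup>2"
      by (simp add: det_2 matrix_def g'_def \<phi>_def \<psi>_def axis_def power2_eq_square)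
    then show ?thesis by (simp add: cmod_power2)
  qed
  obtain r where r: "r \<ge> 0" "(\<integral>\<^sup>+w. ennreal (h w) * indicator (f ` S) w \<partial>lborel) = ennreal r"
    using fin by (cases "\<integral>\<^sup>+w. ennreal (h w) * indicator (f ` S) w \<partial>lborel") auto
  have "(\<integral>\<^sup>+y. ennreal (H y * indicator (g ` S') y) \<partial>lborel) = ennreal r"
  proof -
    have "(\<integral>\<^sup>+y. ennreal (H y * indicator (g ` S') y) \<partial>lborel) = (\<integral>\<^sup>+z. ennreal (H (\<phi> z) * indicator (g ` S') (\<phi> z)) \<partial>lborel)"
      using gSb H by (intro trans) auto
    also have "\<dots> = (\<integral>\<^sup>+w. ennreal (h w) * indicator (f ` S) w \<partial>lborel)"
      by (intro nn_integral_cong) (auto simp: H_def \<psi>\<phi> gS h0 split: split_indicator)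
    finally show ?thesis using r by simp
  qed
  then have "((\<lambda>y. H y * indicator (g ` S') y) has_integral r) UNIV"
    using gSb H r(1) h0
    by (subst has_integral_iff_nn_integral_lebesgue) (auto simp: H_def nn_integral_completion intro!: measurable_completion)
  moreover have "(\<lambda>y. H y * indicator (g ` S') y) = (\<lambda>y. if y \<in> g ` S' then H y else 0)"
    by (auto split: split_indicator)
  ultimately have HI: "(H has_integral r) (g ` S')"
    by (simp only: has_integral_restrict_UNIV)
  have Habs: "H absolutely_integrable_on g ` S'"
    using HI h0 by (intro nonnegative_absolutely_integrable_1) (auto simp: H_def)
  \<comment> \<open>\<open>vec\<close> passes to values in \<open>real ^ 1\<close>, the form in
    which the vector-valued substitution rule applies.\<close>
  have "((\<lambda>y. vec (H y)) :: real ^ 2 \<Rightarrow> real ^ 1) absolutely_integrable_on (g ` S') \<and>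
      integral (g ` S') (\<lambda>y. vec (H y) :: real ^ 1) = vec r"
    using Habs HI
    unfolding absolutely_integrable_on_1_iff integral_on_1_eq
    by (auto simp: integral_unique)
  then have "(\<lambda>y. \<bar>det (matrix (g' y))\<bar> *\<^sub>R (vec (H (g y)) :: real ^ 1)) absolutely_integrable_on S' \<and>
      integral S' (\<lambda>y. \<bar>det (matrix (g' y))\<bar> *\<^sub>R (vec (H (g y)) :: real ^ 1)) = vec r"
    using has_absolute_integral_change_of_variables[of S' g g' "\<lambda>y. vec (H y) :: real ^ 1" "vec r"] S' derg injg by auto
  then have "((\<lambda>y. (norm (f' (\<psi> y)))\<^sup>2 * H (g y)) has_integral r) S'"
    unfolding absolutely_integrable_on_1_iff integral_on_1_eq det absolutely_integrable_on_def
    by (auto simp: has_integral_iff)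
  then have "(\<integral>\<^sup>+y. ennreal ((norm (f' (\<psi> y)))\<^sup>2 * H (g y)) * indicator S' y \<partial>lborel) = ennreal r"
    by (intro nn_integral_has_integral_lebesgue') (auto simp: H_def h0)
  moreover have "(\<integral>\<^sup>+y. ennreal ((norm (f' (\<psi> y)))\<^sup>2 * H (g y)) * indicator S' y \<partial>lborel)
      = (\<integral>\<^sup>+z. ennreal ((norm (f' z))\<^sup>2 * h (f z)) * indicator S z \<partial>lborel)"
  proof -
    have contf: "continuous_on S f"
      using der by (meson DERIV_continuous_on has_field_derivative_at_within)
    have "f' \<in> borel_measurable (restrict_space borel S)" "f \<in> borel_measurable (restrict_space borel S)"
      using contf contf' by (auto intro: borel_measurable_continuous_on_restrict)
    then have "(\<lambda>z. ennreal ((norm (f' z))\<^sup>2 * h (f z))) \<in> borel_measurable (restrict_space borel S)"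
      by measurable
    then have m [measurable]: "(\<lambda>z. ennreal ((norm (f' z))\<^sup>2 * h (f z)) * indicator S z) \<in> borel_measurable borel"
      by (subst (asm) borel_measurable_restrict_space_iff_ennreal) auto
    have "(\<lambda>y. (\<lambda>z. ennreal ((norm (f' z))\<^sup>2 * h (f z)) * indicator S z) (\<psi> y)) \<in> borel_measurable borel"
      by measurable
    moreover have eq: "ennreal ((norm (f' (\<psi> y)))\<^sup>2 * H (g y)) * indicator S' y
        = (\<lambda>z. ennreal ((norm (f' z))\<^sup>2 * h (f z)) * indicator S z) (\<psi> y)" for y
      by (auto simp: H_def g_def \<psi>\<phi> S'_def split: split_indicator)
    ultimately show ?thesis
      unfolding eq by (subst trans) (simp_all add: \<psi>\<phi>)
  qed
  ultimately show ?thesis using r by simp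
qed

section \<open>Mean values over circles\<close>

lemma has_integral_circle_mean_value:
  fixes f :: "complex \<Rightarrow> complex"
  assumes holf: "f holomorphic_on cball z r" and r: "r > 0"
  shows "((\<lambda>t. f (z + of_real r * cis t)) has_integral of_real (2 * pi) * f z) {0..2 * pi}"
proof -
  have "((\<lambda>u. f u / (u - z)) has_contour_integral (2 * of_real pi * \<i> * f z)) (circlepath z r)"
    using Cauchy_integral_circlepath_simple[OF holf, of z] r by simp
  then have "((\<lambda>t. f (z + r * cis t) / (z + r * cis t - z) * r * \<i> * cis t) has_integral (2 * of_real pi * \<i> * f z)) {0..2 * pi}"
    unfolding circlepath_def by (subst (asm) has_contour_integral_part_circlepath_iff) auto
  moreover have "(\<lambda>t. f (z + r * cis t) / (z + r * cis t - z) * r * \<i> * cis t) = (\<lambda>t. \<i> * f (z + r * cis t))"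
    using r by (auto simp: fun_eq_iff field_simps)
  ultimately have "((\<lambda>t. (- \<i>) * (\<i> * f (z + r * cis t))) has_integral (- \<i>) * (2 * of_real pi * \<i> * f z)) {0..2 * pi}"
    by (intro has_integral_mult_right) auto
  moreover have "(- \<i>) * (2 * of_real pi * \<i> * f z) = of_real (2 * pi) * f z"
    by (simp add: complex_eq_iff)
  moreover have "(- \<i>) * (\<i> * w) = w" for w by (simp add: complex_eq_iff)
  ultimately show ?thesis by (simp only:)
qed

text \<open>With a = f z, expanding |w - a|^2 >= 0 bounds |w|^2 below by an expression that is
  real-affine in w and equals |a|^2 at w = a. The mean of that expression over the circle is |a|^2
  by the mean value property.\<close>

lemma circle_mean_norm_square_ge:
  fixes f :: "complex \<Rightarrow> complex"
  assumes holf: "f holomorphic_on cball z r" and r: "r > 0"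
  shows "ennreal (2 * pi * (norm (f z))\<^sup>2)
    \<le> (\<integral>\<^sup>+t. ennreal ((norm (f (z + of_real r * cis t)))\<^sup>2) * indicator {0..2 * pi} t \<partial>lborel)"
proof -
  define a where "a = f z"
  have cont: "continuous_on {0..2 * pi} (\<lambda>t. f (z + of_real r * cis t))"
    by (rule continuous_on_compose2[OF holomorphic_on_imp_continuous_on[OF holf]])
      (use r in \<open>auto simp: dist_norm norm_mult cis_conv_exp intro!: continuous_intros\<close>)
  have "((\<lambda>t. (norm (f (z + of_real r * cis t)))\<^sup>2) has_integral
      integral {0..2 * pi} (\<lambda>t. (norm (f (z + of_real r * cis t)))\<^sup>2)) {0..2 * pi}"
    by (intro integrable_integral integrable_continuous_real continuous_intros cont)
  moreover from this have "2 * pi * (norm a)\<^sup>2 \<le> integral {0..2 * pi} (\<lambda>t. (norm (f (z + of_real r * cis t)))\<^sup>2)"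
  proof (rule has_integral_le[rotated])
    have "((\<lambda>t. cnj a * f (z + of_real r * cis t)) has_integral (cnj a * (of_real (2 * pi) * f z))) {0..2 * pi}"
      by (intro has_integral_mult_right has_integral_circle_mean_value holf r)
    then have "((\<lambda>t. Re (cnj a * f (z + of_real r * cis t))) has_integral Re (cnj a * (of_real (2 * pi) * f z))) {0..2 * pi}"
      by (rule has_integral_Re)
    then have "((\<lambda>t. 2 * Re (cnj a * f (z + of_real r * cis t)) - (norm a)\<^sup>2) has_integral
        (2 * Re (cnj a * (of_real (2 * pi) * f z)) - measure lborel {0..2 * pi} *\<^sub>R (norm a)\<^sup>2)) {0..2 * pi}"
      by (intro has_integral_diff has_integral_mult_right has_integral_const_real)
    moreover have "2 * Re (cnj a * (of_real (2 * pi) * f z)) - measure lborel {0..2 * pi} *\<^sub>R (norm a)\<^sup>2 = 2 * pi * (norm a)\<^sup>2"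
      unfolding a_def[symmetric] cmod_power2 by (simp add: algebra_simps power2_eq_square)
    ultimately show "((\<lambda>t. 2 * Re (cnj a * f (z + of_real r * cis t)) - (norm a)\<^sup>2) has_integral 2 * pi * (norm a)\<^sup>2) {0..2 * pi}"
      by (simp only:)
  next
    fix t :: real
    define w where "w = f (z + of_real r * cis t)"
    have "0 \<le> (norm (w - a))\<^sup>2" by simp
    then show "2 * Re (cnj a * f (z + of_real r * cis t)) - (norm a)\<^sup>2 \<le> (norm (f (z + of_real r * cis t)))\<^sup>2"
      unfolding w_def[symmetric] cmod_power2 by (simp add: algebra_simps power2_eq_square)
  qed
  ultimately have "ennreal (2 * pi * (norm a)\<^sup>2) \<le> ennreal (integral {0..2 * pi} (\<lambda>t. (norm (f (z + of_real r * cis t)))\<^sup>2))"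
    by (intro ennreal_leI)
  also have "\<dots> = (\<integral>\<^sup>+t. ennreal ((norm (f (z + of_real r * cis t)))\<^sup>2) * indicator {0..2 * pi} t \<partial>lborel)"
    by (rule nn_integral_has_integral_lebesgue'[symmetric]) (auto intro!: integrable_integral integrable_continuous_real continuous_intros cont)
  finally show ?thesis by (simp add: a_def)
qed

section \<open>Area with respect to the logarithmic metric\<close>

lemma lborel_complex_eq_distr_pair:
  "lborel = distr (lborel \<Otimes>\<^sub>M lborel) borel (\<lambda>(x, y). Complex x y)"
proof (rule lborel_eqI)
  have meas [measurable]: "(\<lambda>(x, y). Complex x y) \<in> borel_measurable (lborel \<Otimes>\<^sub>M lborel)"
  proof -
    have "(\<lambda>p::real \<times> real. Complex (fst p) (snd p)) \<in> borel_measurable (borel \<Otimes>\<^sub>M borel)"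
      unfolding borel_prod by (intro borel_measurable_continuous_onI continuous_intros)
    then show ?thesis by (simp add: split_def measurable_def space_pair_measure)
  qed
  fix l u :: complex assume le: "\<And>b. b \<in> Basis \<Longrightarrow> l \<bullet> b \<le> u \<bullet> b"
  have lu: "Re l \<le> Re u" "Im l \<le> Im u" using le[of 1] le[of \<i>] by (auto simp: Basis_complex_def)
  have "(\<lambda>(x, y). Complex x y) -` box l u \<inter> space (lborel \<Otimes>\<^sub>M lborel) = box (Re l) (Re u) \<times> box (Im l) (Im u)"
    by (auto simp: in_box_complex_iff space_pair_measure)
  then have "emeasure (distr (lborel \<Otimes>\<^sub>M lborel) borel (\<lambda>(x, y). Complex x y)) (box l u)
      = emeasure (lborel \<Otimes>\<^sub>M lborel) (box (Re l) (Re u) \<times> box (Im l) (Im u))"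
    by (subst emeasure_distr) auto
  also have "\<dots> = ennreal (Re u - Re l) * ennreal (Im u - Im l)"
    using lu by (subst lborel.emeasure_pair_measure_Times) auto
  also have "\<dots> = ennreal (\<Prod>b\<in>Basis. (u - l) \<bullet> b)"
    using lu by (simp add: Basis_complex_def ennreal_mult')
  finally show "emeasure (distr (lborel \<Otimes>\<^sub>M lborel) borel (\<lambda>(x, y). Complex x y)) (box l u) = ennreal (\<Prod>b\<in>Basis. (u - l) \<bullet> b)" .
qed simp

lemma nn_integral_complex_iterated:
  assumes "F \<in> borel_measurable borel"
  shows "(\<integral>\<^sup>+z. F z \<partial>lborel) = (\<integral>\<^sup>+x. (\<integral>\<^sup>+y. F (Complex x y) \<partial>lborel) \<partial>lborel)"
proof -
  have meas: "(\<lambda>p::real \<times> real. Complex (fst p) (snd p)) \<in> borel_measurable (borel \<Otimes>\<^sub>M borel)"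
    unfolding borel_prod by (intro borel_measurable_continuous_onI continuous_intros)
  then have m: "(\<lambda>p. Complex (fst p) (snd p)) \<in> borel_measurable (lborel \<Otimes>\<^sub>M lborel)"
    by (simp add: measurable_def space_pair_measure)
  have "(\<integral>\<^sup>+z. F z \<partial>lborel) = (\<integral>\<^sup>+p. F (Complex (fst p) (snd p)) \<partial>(lborel \<Otimes>\<^sub>M lborel))"
    using assms m by (subst lborel_complex_eq_distr_pair) (simp add: nn_integral_distr split_def)
  also have "\<dots> = (\<integral>\<^sup>+x. (\<integral>\<^sup>+y. F (Complex x y) \<partial>lborel) \<partial>lborel)"
    using assms m by (subst lborel.nn_integral_fst[symmetric]) simp_all
  finally show ?thesis .
qed

text \<open>In logarithmic coordinates the integrand is the square of a holomorphic function of \<open>exp z\<close>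
  with value 1 at the origin, so its mean over every vertical segment is at least 1.\<close>

lemma logarithmic_area_ge:
  assumes holf: "f holomorphic_on ball 0 1" and inj: "inj_on f (ball 0 1)" and f0: "f 0 = 0"
    and L: "L > 0"
  shows "ennreal (2 * pi * L) \<le> (\<integral>\<^sup>+z. ennreal ((norm (deriv f (exp z) * exp z / f (exp z)))\<^sup>2) *
    indicator (box (Complex (- L) 0) (Complex 0 (2 * pi))) z \<partial>lborel)"
proof -
  \<comment> \<open>This is f z / z with its removable singularity filled in. Injectivity keeps it
    away from 0, also at the origin, where its value is the derivative of \<open>f\<close>.\<close>
  define q where "q = (\<lambda>z. if z = 0 then deriv f 0 else (f z - f 0) / (z - 0))"
  have holq: "q holomorphic_on ball 0 1" unfolding q_def by (rule pole_lemma_open[OF holf open_ball])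
  have qnz: "q z \<noteq> 0" if z: "z \<in> ball 0 1" for z
  proof (cases "z = 0")
    case True
    then show ?thesis using holomorphic_injective_imp_regular[OF holf open_ball inj z] by (simp add: q_def)
  next
    case False
    have "f z \<noteq> f 0" using inj_onD[OF inj, of z 0] False z by auto
    then show ?thesis using False by (simp add: q_def f0)
  qed
  \<comment> \<open>The logarithmic derivative z f'(z) / f(z), continued holomorphically by the
    value 1 at the origin.\<close>
  define \<kappa> where "\<kappa> = (\<lambda>z. deriv f z / q z)"
  have hol\<kappa>: "\<kappa> holomorphic_on ball 0 1"
    unfolding \<kappa>_def using qnz by (intro holomorphic_intros holomorphic_deriv[OF holf] holq) auto
  have \<kappa>0: "\<kappa> 0 = 1" using qnz[of 0] by (simp add: \<kappa>_def q_def)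
  have \<kappa>: "\<kappa> z = deriv f z * z / f z" if "z \<noteq> 0" for z using that by (simp add: \<kappa>_def q_def f0)
  define B where "B = box (Complex (- L) 0) (Complex 0 (2 * pi))"
  have B_iff: "Complex x y \<in> B \<longleftrightarrow> - L < x \<and> x < 0 \<and> 0 < y \<and> y < 2 * pi" for x y
    by (auto simp: B_def in_box_complex_iff)
  have in_ball: "exp z \<in> ball 0 1" if "z \<in> B" for z
    using that by (cases z) (auto simp: B_iff norm_exp)
  define F where "F = (\<lambda>z. ennreal ((norm (\<kappa> (exp z)))\<^sup>2) * indicator B z)"
  have F: "F \<in> borel_measurable borel"
  proof -
    have "continuous_on B (\<lambda>z. \<kappa> (exp z))"
      by (rule continuous_on_compose2[OF holomorphic_on_imp_continuous_on[OF hol\<kappa>]])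
        (use in_ball in \<open>auto intro!: continuous_intros\<close>)
    then have "(\<lambda>z. \<kappa> (exp z)) \<in> borel_measurable (restrict_space borel B)"
      by (rule borel_measurable_continuous_on_restrict)
    then have "(\<lambda>z. ennreal ((norm (\<kappa> (exp z)))\<^sup>2)) \<in> borel_measurable (restrict_space borel B)"
      by measurable
    then show ?thesis unfolding F_def by (subst (asm) borel_measurable_restrict_space_iff_ennreal) (auto simp: B_def)
  qed
  have inner: "ennreal (2 * pi) * indicator {- L<..<0} x \<le> (\<integral>\<^sup>+y. F (Complex x y) \<partial>lborel)" for x
  proof (cases "x \<in> {- L<..<0}")
    case True
    define r where "r = exp x"
    have r: "r > 0" "r < 1" using True by (auto simp: r_def)
    have "cball 0 r \<subseteq> ball (0::complex) 1" using r by auto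
    then have "\<kappa> holomorphic_on cball 0 r" using hol\<kappa> holomorphic_on_subset by blast
    from circle_mean_norm_square_ge[OF this r(1)]
    have "ennreal (2 * pi) \<le> (\<integral>\<^sup>+t. ennreal ((norm (\<kappa> (of_real r * cis t)))\<^sup>2) * indicator {0..2 * pi} t \<partial>lborel)"
      by (simp add: \<kappa>0)
    also have "\<dots> = (\<integral>\<^sup>+y. F (Complex x y) \<partial>lborel)"
    \<comment> \<open>The circle is integrated over a closed interval whereas the box is open; the
      two endpoints are a null set.\<close>
    proof (rule nn_integral_cong_AE)
      have "AE t in lborel. t \<noteq> 0 \<and> t \<noteq> 2 * pi"
        using AE_lborel_singleton[of "0::real"] AE_lborel_singleton[of "2 * pi"] by eventually_elim auto
      then show "AE t in lborel. ennreal ((norm (\<kappa> (of_real r * cis t)))\<^sup>2) * indicator {0..2 * pi} t = F (Complex x t)"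
      proof eventually_elim
        case (elim t)
        have "exp (Complex x t) = of_real r * cis t"
          by (simp add: exp_eq_polar[of "Complex x t"] r_def)
        then show ?case
          using elim True by (auto simp: F_def B_iff split: split_indicator)
      qed
    qed
    finally show ?thesis using True by simp
  qed simp
  have "ennreal (2 * pi * L) = (\<integral>\<^sup>+x. ennreal (2 * pi) * indicator {- L<..<0} x \<partial>lborel)"
    using L by (subst nn_integral_cmult_indicator) (auto simp: ennreal_mult)
  also have "\<dots> \<le> (\<integral>\<^sup>+x. (\<integral>\<^sup>+y. F (Complex x y) \<partial>lborel) \<partial>lborel)"
    by (intro nn_integral_mono inner)
  also have "\<dots> = (\<integral>\<^sup>+z. F z \<partial>lborel)"
    by (rule nn_integral_complex_iterated[OF F, symmetric])
  also have "\<dots> = (\<integral>\<^sup>+z. ennreal ((norm (deriv f (exp z) * exp z / f (exp z)))\<^sup>2) * indicator B z \<partial>lborel)"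
    unfolding F_def by (simp add: \<kappa>)
  finally show ?thesis unfolding B_def .
qed

lemma inj_on_exp_half_open:
  assumes "\<And>z. z \<in> S \<Longrightarrow> 0 \<le> Im z \<and> Im z < 2 * pi"
  shows "inj_on exp S"
proof (rule inj_onI)
  fix z w assume zw: "z \<in> S" "w \<in> S" "exp z = exp w"
  then obtain n :: int where n: "z = w + (of_int (2 * n) * pi) * \<i>" using exp_eq by metis
  have "\<bar>Im z - Im w\<bar> < 2 * pi" using assms[OF zw(1)] assms[OF zw(2)] by linarith
  moreover have "Im z - Im w = 2 * pi * n" using n by simp
  ultimately have "2 * pi * \<bar>real_of_int n\<bar> < 2 * pi * 1" by (simp add: abs_mult)
  then have "\<bar>real_of_int n\<bar> < 1" by (simp only: mult_less_cancel_left_pos pi_gt_zero mult_pos_pos zero_less_numeral)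
  then have "n = 0" by linarith
  then show "z = w" using n by simp
qed

text \<open>In the coordinate log w the density |w|^-2 becomes 1 and the ring becomes a rectangle
  with sides 2 ln(1/m) and 2\<pi>.\<close>

lemma logarithmic_area_ring_le:
  assumes m: "0 < m" "m < 1"
  shows "(\<integral>\<^sup>+w. ennreal (inverse ((norm w)\<^sup>2)) * indicator {w::complex. m \<le> norm w \<and> norm w \<le> 1 / m} w \<partial>lborel)
    \<le> ennreal (4 * pi * ln (1 / m))"
proof -
  define R where "R = {w::complex. m \<le> norm w \<and> norm w \<le> 1 / m}"
  define S where "S = {z. ln m \<le> Re z \<and> Re z \<le> - ln m \<and> 0 \<le> Im z \<and> Im z < 2 * pi}"
  have lnm: "ln m < 0" using m by simp
  have Sb: "S \<in> sets borel" unfolding S_def by measurable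
  have Rb: "R \<in> sets borel"
  proof -
    have "R = cball 0 (1/m) - ball 0 m" by (auto simp: R_def)
    then show ?thesis by simp
  qed
  have R: "exp ` S = R"
  proof
    show "exp ` S \<subseteq> R"
    proof
      fix w assume "w \<in> exp ` S"
      then obtain z where z: "z \<in> S" "w = exp z" by auto
      have "exp (ln m) \<le> exp (Re z)" "exp (Re z) \<le> exp (- ln m)" using z(1) by (auto simp: S_def)
      then show "w \<in> R" using m z(2) by (simp add: R_def norm_exp exp_minus inverse_eq_divide)
    qed
    show "R \<subseteq> exp ` S"
    proof
      fix w assume w: "w \<in> R"
      then have w0: "w \<noteq> 0" using m by (auto simp: R_def)
      define z where "z = Complex (ln (norm w)) (Arg2pi w)"
      have "exp z = of_real (exp (Re z)) * exp (\<i> * of_real (Im z))"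
        using exp_eq_polar[of z] by (simp only: cis_conv_exp)
      also have "\<dots> = of_real (norm w) * exp (\<i> * of_real (Arg2pi w))"
        using w0 by (simp add: z_def)
      also have "\<dots> = w" by (rule Arg2pi_eq[symmetric])
      finally have "exp z = w" .
      moreover have "ln m \<le> ln (norm w)" "ln (norm w) \<le> - ln m"
      proof -
        show "ln m \<le> ln (norm w)" using w m w0 by (subst ln_le_cancel_iff) (auto simp: R_def)
        have "ln (norm w) \<le> ln (1 / m)" using w m w0 by (subst ln_le_cancel_iff) (auto simp: R_def)
        then show "ln (norm w) \<le> - ln m" using m by (simp add: ln_div)
      qed
      ultimately show "w \<in> exp ` S"
        using Arg2pi_ge_0[of w] Arg2pi_lt_2pi[of w] by (intro image_eqI[of w exp z]) (auto simp: S_def z_def)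
    qed
  qed
  have nz: "w \<noteq> 0" if "w \<in> R" for w using that m by (auto simp: R_def)
  have fin: "(\<integral>\<^sup>+w. ennreal (inverse ((norm w)\<^sup>2)) * indicator R w \<partial>lborel) < \<infinity>"
  proof -
    have "(\<integral>\<^sup>+w. ennreal (inverse ((norm w)\<^sup>2)) * indicator R w \<partial>lborel)
        \<le> (\<integral>\<^sup>+w. ennreal (inverse (m\<^sup>2)) * indicator (cball (0::complex) (1/m)) w \<partial>lborel)"
    proof (rule nn_integral_mono)
      fix w :: complex
      have "inverse ((norm w)\<^sup>2) \<le> inverse (m\<^sup>2)" if "w \<in> R"
        using that m by (intro le_imp_inverse_le power_mono) (auto simp: R_def)
      then show "ennreal (inverse ((norm w)\<^sup>2)) * indicator R w \<le> ennreal (inverse (m\<^sup>2)) * indicator (cball 0 (1/m)) w"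
        by (auto simp: R_def intro!: ennreal_leI split: split_indicator)
    qed
    also have "\<dots> = ennreal (inverse (m\<^sup>2)) * emeasure lborel (cball (0::complex) (1/m))"
      by (rule nn_integral_cmult_indicator) simp
    also have "\<dots> < \<infinity>"
      using emeasure_bounded_finite[OF bounded_cball, of "0::complex" "1/m"]
      by (simp add: ennreal_mult_less_top)
    finally show ?thesis .
  qed
  have "(\<integral>\<^sup>+w. ennreal (inverse ((norm w)\<^sup>2)) * indicator R w \<partial>lborel)
      = (\<integral>\<^sup>+z. ennreal ((norm (exp z))\<^sup>2 * inverse ((norm (exp z))\<^sup>2)) * indicator S z \<partial>lborel)"
  proof -
    have "(\<integral>\<^sup>+z. ennreal ((norm (exp z))\<^sup>2 * inverse ((norm (exp z))\<^sup>2)) * indicator S z \<partial>lborel)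
        = (\<integral>\<^sup>+w. ennreal (inverse ((norm w)\<^sup>2)) * indicator (exp ` S) w \<partial>lborel)"
    proof (rule nn_integral_holomorphic_change_of_variables[where h = "\<lambda>w. inverse ((norm w)\<^sup>2)"])
      show "inj_on exp S" by (rule inj_on_exp_half_open) (auto simp: S_def)
      show "(exp has_field_derivative exp z) (at z)" for z :: complex by (rule DERIV_exp)
      show "(\<integral>\<^sup>+w. ennreal (inverse ((norm w)\<^sup>2)) * indicator (exp ` S) w \<partial>lborel) < \<infinity>"
        unfolding R by (rule fin)
    qed (use Sb Rb R in \<open>auto intro!: continuous_intros\<close>)
    then show ?thesis unfolding R ..
  qed
  also have "\<dots> \<le> (\<integral>\<^sup>+z. indicator (cbox (Complex (ln m) 0) (Complex (- ln m) (2 * pi))) z \<partial>lborel)"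
    by (intro nn_integral_mono) (auto simp: S_def in_cbox_complex_iff split: split_indicator)
  also have "\<dots> = emeasure lborel (cbox (Complex (ln m) 0) (Complex (- ln m) (2 * pi)))"
    by simp
  also have "\<dots> = ennreal (4 * pi * ln (1 / m))"
    using lnm m by (subst emeasure_lborel_cbox) (auto simp: Basis_complex_def ln_div algebra_simps)
  finally show ?thesis unfolding R_def .
qed

text \<open>The disc is connected and meets the image at 0, so if it left the image it would meet
  the frontier. That frontier lies in the image of the circle |z| = s, where |f| is at least
  m.\<close>

lemma open_disc_subset_image:
  assumes holf: "f holomorphic_on ball 0 1" and inj: "inj_on f (ball 0 1)" and f0: "f 0 = 0"
    and s: "0 < s" "s < 1" and m: "0 < m" and bd: "\<And>z. norm z = s \<Longrightarrow> m \<le> norm (f z)"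
  shows "ball 0 m \<subseteq> f ` ball 0 s"
proof (rule ccontr)
  assume no: "\<not> ?thesis"
  have sub: "cball (0::complex) s \<subseteq> ball 0 1" using s by auto
  have sub': "ball (0::complex) s \<subseteq> ball 0 1" using s by auto
  have op: "open (f ` ball 0 s)"
    by (rule open_mapping_thm3[OF holomorphic_on_subset[OF holf sub'] open_ball inj_on_subset[OF inj sub']])
  have "0 \<in> f ` ball 0 s" using s f0 by (intro image_eqI[of 0 f 0]) auto
  then have "0 \<in> ball 0 m \<inter> f ` ball 0 s" using m by simp
  then have "ball 0 m \<inter> f ` ball 0 s \<noteq> {}" by blast
  moreover have "ball 0 m - f ` ball 0 s \<noteq> {}" using no by blast
  ultimately have "ball 0 m \<inter> frontier (f ` ball 0 s) \<noteq> {}"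
    by (intro connected_Int_frontier connected_ball)
  then obtain w where w: "w \<in> ball 0 m" "w \<in> frontier (f ` ball 0 s)" by blast
  have "compact (f ` cball 0 s)"
    by (intro compact_continuous_image compact_cball holomorphic_on_imp_continuous_on holomorphic_on_subset[OF holf sub])
  then have "closure (f ` ball 0 s) \<subseteq> f ` cball 0 s"
    by (intro closure_minimal image_mono ball_subset_cball compact_imp_closed)
  then have "w \<in> f ` cball 0 s" "w \<notin> f ` ball 0 s"
    using w(2) op by (auto simp: frontier_def interior_open)
  then obtain z where "w = f z" "norm z = s" by force
  then show False using bd[of z] w(1) by simp
qed

text \<open>The images under \<open>f\<close> and \<open>1/f\<close> of an
  annulus \<open>s < |z| < 1\<close> are disjoint and lie in a ring about the origin; compare areas with respect
  to \<open>|dw| / |w|\<close>, which is invariant under inversion.\<close>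

theorem Bieberbach_Eilenberg_univalent:
  assumes holf: "f holomorphic_on ball 0 1" and inj: "inj_on f (ball 0 1)" and f0: "f 0 = 0"
    and BE: "\<And>z w. z \<in> ball 0 1 \<Longrightarrow> w \<in> ball 0 1 \<Longrightarrow> f z * f w \<noteq> 1"
  shows "norm (deriv f 0) \<le> 1"
proof (rule ccontr)
  assume "\<not> ?thesis"
  \<comment> \<open>Near 0 the map stretches by more than \<open>\<beta>\<close>, with
    \<open>\<beta> > 1\<close>; the area comparison will give \<open>\<beta> * s \<le> s\<close>, a
    contradiction.\<close>
  then obtain \<beta> where \<beta>: "1 < \<beta>" "\<beta> < norm (deriv f 0)" using dense[of 1 "norm (deriv f 0)"] by auto
  have "(f has_field_derivative deriv f 0) (at 0)"
    by (rule holomorphic_derivI[OF holf open_ball]) simp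
  then have "((\<lambda>z. norm (f z / z)) \<longlongrightarrow> norm (deriv f 0)) (at 0)"
    unfolding has_field_derivative_iff using f0 by (intro tendsto_norm) simp
  then have "\<forall>\<^sub>F z in at 0. \<beta> < norm (f z / z)" using \<beta>(2) by (rule order_tendstoD)
  then obtain e where e: "e > 0" "\<And>z. z \<noteq> 0 \<Longrightarrow> norm z < e \<Longrightarrow> \<beta> < norm (f z / z)"
    unfolding eventually_at by (auto simp: dist_norm)
  \<comment> \<open>The term \<open>e / 2\<close> keeps the circle of radius \<open>s\<close> where
    |f z| > \<beta> |z| holds; the other makes the inner radius \<open>m = \<beta> * s\<close> of
    the ring less than 1.\<close>
  define s where "s = min (e / 2) (1 / (2 * \<beta>))"
  have s: "0 < s" "s < e" "\<beta> * s < 1"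
  proof -
    show "0 < s" "s < e" using e \<beta> by (auto simp: s_def)
    have "\<beta> * s \<le> \<beta> * (1 / (2 * \<beta>))" using \<beta> by (intro mult_left_mono) (auto simp: s_def)
    also have "\<dots> < 1" using \<beta> by simp
    finally show "\<beta> * s < 1" .
  qed
  have s1: "s < 1"
  proof -
    have "s * 1 < s * \<beta>" using s \<beta> by (intro mult_strict_left_mono) auto
    then show ?thesis using s(3) by (simp add: mult.commute)
  qed
  define m where "m = \<beta> * s"
  have m: "0 < m" "m < 1" using s \<beta> by (auto simp: m_def)
  have bd: "m \<le> norm (f z)" if "norm z = s" for z
  proof -
    have z: "z \<noteq> 0" using that s by auto
    have "\<beta> < norm (f z) / s" using e(2)[OF z] that s by (simp add: norm_divide)
    then show ?thesis using s by (simp add: m_def field_simps)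
  qed
  have disc: "ball 0 m \<subseteq> f ` ball 0 s"
    by (rule open_disc_subset_image[OF holf inj f0 s(1) s1 m(1) bd])
  \<comment> \<open>The lower bound is injectivity, since the disc of radius \<open>m\<close> is
    already covered by the points with |z| < s. For the upper bound, a larger value would have its
    reciprocal in that disc, so two values of \<open>f\<close> would have product 1.\<close>
  have ring: "m \<le> norm (f z) \<and> norm (f z) \<le> 1 / m" if z: "s < norm z" "norm z < 1" for z
  proof
    show "m \<le> norm (f z)"
    proof (rule ccontr)
      assume "\<not> m \<le> norm (f z)"
      then have "f z \<in> f ` ball 0 s" using disc by auto
      then obtain z' where "norm z' < s" "f z = f z'" by auto
      then show False using inj z s1 by (auto dest: inj_onD)
    qed
    show "norm (f z) \<le> 1 / m"
    proof (rule ccontr)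
      assume no: "\<not> norm (f z) \<le> 1 / m"
      then have big: "1 / m < norm (f z)" by simp
      then have nz: "f z \<noteq> 0" using m by auto
      have "inverse (norm (f z)) < inverse (1 / m)" using big m by (intro less_imp_inverse_less) auto
      then have "inverse (f z) \<in> ball 0 m" using m by (simp add: norm_inverse)
      then obtain z' where z': "norm z' < s" "inverse (f z) = f z'" using disc by auto
      then have "f z * f z' = 1" using nz by (metis right_inverse)
      then show False using BE[of z z'] z z' s1 by auto
    qed
  qed
  define L where "L = - ln s"
  have L: "L > 0" using s s1 by (simp add: L_def)
  \<comment> \<open>One period of logarithmic coordinates for the annulus s < |z| < 1, slit along
    the positive reals.\<close>
  define B where "B = box (Complex (- L) 0) (Complex 0 (2 * pi))"
  have opB: "open B" unfolding B_def by (rule open_box)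
  define R where "R = {w::complex. m \<le> norm w \<and> norm w \<le> 1 / m}"
  define g where "g = (\<lambda>z. f (exp z))"
  define g' where "g' = (\<lambda>z. deriv f (exp z) * exp z)"
  have eB: "s < norm (exp z) \<and> norm (exp z) < 1" if "z \<in> B" for z
  proof -
    have "ln s < Re z" "Re z < 0" using that by (auto simp: B_def in_box_complex_iff L_def)
    then have "exp (ln s) < exp (Re z)" "exp (Re z) < 1" by simp_all
    then show ?thesis using s by (simp add: norm_exp)
  qed
  have holg: "g holomorphic_on B"
    unfolding g_def using eB
    by (intro holomorphic_on_compose_gen[OF _ holf, unfolded o_def] holomorphic_intros) auto
  have derg: "(g has_field_derivative g' z) (at z)" if "z \<in> B" for z
    unfolding g_def g'_def
    by (rule DERIV_chain2[OF holomorphic_derivI[OF holf open_ball] DERIV_exp]) (use eB[OF that] in auto)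
  have contg': "continuous_on B g'"
    unfolding g'_def using eB
    by (intro continuous_intros continuous_on_compose2[OF holomorphic_on_imp_continuous_on[OF holomorphic_deriv[OF holf open_ball]]]) auto
  have injg: "inj_on g B"
  proof (rule inj_onI)
    fix z w assume zw: "z \<in> B" "w \<in> B" "g z = g w"
    have "exp z = exp w" by (rule inj_onD[OF inj]) (use zw eB in \<open>auto simp: g_def\<close>)
    moreover have "inj_on exp B"
      by (rule inj_on_exp_half_open) (auto simp: B_def in_box_complex_iff)
    ultimately show "z = w" using zw by (auto dest: inj_onD)
  qed
  have gR: "g z \<in> R" if "z \<in> B" for z using ring eB[OF that] by (auto simp: R_def g_def)
  have gnz: "g z \<noteq> 0" if "z \<in> B" for z using gR[OF that] m by (auto simp: R_def)
  define J where "J = (\<lambda>A. \<integral>\<^sup>+w. ennreal (inverse ((norm (w::complex))\<^sup>2)) * indicator A w \<partial>lborel)"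
  have JR: "J R \<le> ennreal (4 * pi * ln (1 / m))"
    unfolding J_def R_def by (rule logarithmic_area_ring_le[OF m])
  have Jmono: "J A \<le> J A'" if "A \<subseteq> A'" for A A'
    unfolding J_def using that by (intro nn_integral_mono) (auto split: split_indicator)
  have J_fin: "J A < \<infinity>" if "A \<subseteq> R" for A
    using order.strict_trans1[OF order_trans[OF Jmono[OF that] JR] ennreal_less_top] by simp
  \<comment> \<open>Stated for a general \<open>k\<close> so that it serves both \<open>g\<close>
    and its reciprocal: their logarithmic derivatives have the same modulus.\<close>
  have area: "ennreal (2 * pi * L) \<le> J (k ` B)"
    if holk: "k holomorphic_on B" and injk: "inj_on k B" and kR: "k ` B \<subseteq> R"
      and derk: "\<And>z. z \<in> B \<Longrightarrow> (k has_field_derivative k' z) (at z)" and contk: "continuous_on B k'"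
      and eq: "\<And>z. z \<in> B \<Longrightarrow> norm (k' z / k z) = norm (g' z / g z)" for k k'
  proof -
    have "ennreal (2 * pi * L) \<le> (\<integral>\<^sup>+z. ennreal ((norm (deriv f (exp z) * exp z / f (exp z)))\<^sup>2) * indicator B z \<partial>lborel)"
      unfolding B_def by (rule logarithmic_area_ge[OF holf inj f0 L])
    also have "\<dots> = (\<integral>\<^sup>+z. ennreal ((norm (k' z))\<^sup>2 * inverse ((norm (k z))\<^sup>2)) * indicator B z \<partial>lborel)"
    proof (rule nn_integral_cong)
      fix z
      show "ennreal ((norm (deriv f (exp z) * exp z / f (exp z)))\<^sup>2) * indicator B z
          = ennreal ((norm (k' z))\<^sup>2 * inverse ((norm (k z))\<^sup>2)) * indicator B z"
      proof (cases "z \<in> B")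
        case True
        have "(norm (k' z))\<^sup>2 * inverse ((norm (k z))\<^sup>2) = (norm (k' z / k z))\<^sup>2"
          by (simp add: norm_divide power_divide inverse_eq_divide)
        then show ?thesis using eq[OF True] by (simp add: g'_def g_def)
      qed simp
    qed
    also have "\<dots> = J (k ` B)"
      unfolding J_def
    proof (rule nn_integral_holomorphic_change_of_variables)
      show "B \<in> sets borel" by (simp add: B_def)
      show "k ` B \<in> sets borel"
        using open_mapping_thm3[OF holk opB injk] by simp
      show "(\<integral>\<^sup>+w. ennreal (inverse ((norm w)\<^sup>2)) * indicator (k ` B) w \<partial>lborel) < \<infinity>"
        using J_fin[OF kR] by (simp add: J_def)
      show "(k has_field_derivative k' z) (at z)" if "z \<in> B" for z by (rule derk[OF that])
    qed (simp_all add: contk injk)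
    finally show ?thesis .
  qed
  have gBR: "g ` B \<subseteq> R" using gR by blast
  have igBR: "(\<lambda>z. inverse (g z)) ` B \<subseteq> R"
  proof clarify
    fix z assume z: "z \<in> B"
    have "m \<le> norm (g z)" "norm (g z) \<le> 1 / m" using gR[OF z] by (auto simp: R_def)
    moreover from this have "norm (g z) > 0" using m by linarith
    ultimately have "m \<le> 1 / norm (g z)" "1 / norm (g z) \<le> 1 / m"
      using m by (auto simp: field_simps)
    moreover have "norm (inverse (g z)) = 1 / norm (g z)" by (simp add: norm_inverse divide_inverse)
    ultimately show "inverse (g z) \<in> R" by (simp only: R_def mem_Collect_eq)
  qed
  have 1: "ennreal (2 * pi * L) \<le> J (g ` B)"
    by (rule area[OF holg injg gBR derg contg' refl])
  have 2: "ennreal (2 * pi * L) \<le> J ((\<lambda>z. inverse (g z)) ` B)"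
  proof (rule area)
    show "(\<lambda>z. inverse (g z)) holomorphic_on B" using holg gnz by (intro holomorphic_intros) auto
    show "inj_on (\<lambda>z. inverse (g z)) B" using injg by (auto simp: inj_on_def)
    show "(\<lambda>z. inverse (g z)) ` B \<subseteq> R" by (rule igBR)
    show "((\<lambda>z. inverse (g z)) has_field_derivative - (inverse (g z) * g' z * inverse (g z))) (at z)" if "z \<in> B" for z
      by (rule DERIV_inverse'[OF derg[OF that] gnz[OF that]])
    show "continuous_on B (\<lambda>z. - (inverse (g z) * g' z * inverse (g z)))"
      using gnz contg' holomorphic_on_imp_continuous_on[OF holg] by (intro continuous_intros) auto
    show "norm (- (inverse (g z) * g' z * inverse (g z)) / inverse (g z)) = norm (g' z / g z)" if "z \<in> B" for z
      using gnz[OF that] by (simp add: norm_mult norm_divide norm_inverse field_simps)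
  qed
  have "J (g ` B) + J ((\<lambda>z. inverse (g z)) ` B) = J (g ` B \<union> (\<lambda>z. inverse (g z)) ` B)"
  proof -
    have disj: "g ` B \<inter> (\<lambda>z. inverse (g z)) ` B = {}"
    proof (rule ccontr)
      assume "\<not> ?thesis"
      then obtain z w where zw: "z \<in> B" "w \<in> B" "g z = inverse (g w)" by auto
      then have "f (exp z) * f (exp w) = 1" using gnz[OF zw(2)] by (simp add: g_def)
      moreover have "exp z \<in> ball 0 1" "exp w \<in> ball 0 1" using eB zw by auto
      ultimately show False using BE by blast
    qed
    have "open (g ` B)" by (rule open_mapping_thm3[OF holg opB injg])
    moreover have "open ((\<lambda>z. inverse (g z)) ` B)"
    proof (rule open_mapping_thm3[OF _ opB])
      show "(\<lambda>z. inverse (g z)) holomorphic_on B" using holg gnz by (intro holomorphic_intros) auto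
      show "inj_on (\<lambda>z. inverse (g z)) B" using injg by (auto simp: inj_on_def)
    qed
    ultimately have [measurable]: "g ` B \<in> sets borel" "(\<lambda>z. inverse (g z)) ` B \<in> sets borel" by auto
    have ind: "indicator (g ` B \<union> (\<lambda>z. inverse (g z)) ` B) w
        = (indicator (g ` B) w + indicator ((\<lambda>z. inverse (g z)) ` B) w :: ennreal)" for w
      using disj by (auto split: split_indicator)
    show ?thesis
      unfolding J_def ind by (simp add: distrib_left nn_integral_add)
  qed
  also have "\<dots> \<le> J R"
    by (intro Jmono Un_least gBR igBR)
  also note JR
  finally have "J (g ` B) + J ((\<lambda>z. inverse (g z)) ` B) \<le> ennreal (4 * pi * ln (1 / m))" .
  \<comment> \<open>Two disjoint images of logarithmic area at least 2\<pi>L fit in a ring of area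
    at most 4\<pi> ln(1/m), so L <= ln(1/m), that is m <= s.\<close>
  then have "ennreal (2 * pi * L) + ennreal (2 * pi * L) \<le> ennreal (4 * pi * ln (1 / m))"
    by (rule order_trans[OF add_mono[OF 1 2]])
  then have "ennreal (2 * pi * L + 2 * pi * L) \<le> ennreal (4 * pi * ln (1 / m))"
    using L by (subst ennreal_plus) auto
  moreover have "0 \<le> ln (1 / m)" using m by (intro ln_ge_zero) auto
  ultimately have "2 * pi * L + 2 * pi * L \<le> 4 * pi * ln (1 / m)"
    by (subst (asm) ennreal_le_iff) auto
  then have "4 * pi * L \<le> 4 * pi * ln (1 / m)" by simp
  then have "L \<le> ln (1 / m)" by simp
  then have "ln m \<le> ln s" using m by (simp add: L_def ln_div)
  then have "m \<le> s" using m s by simp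
  moreover have "s * 1 < s * \<beta>" using s \<beta> by (intro mult_strict_left_mono) auto
  ultimately show False by (simp add: m_def mult.commute)
qed

section \<open>Simply connected planar domains\<close>

lemma Riemann_map_at_origin:
  assumes "open G" "simply_connected G" "0 \<in> G" "G \<noteq> UNIV"
  shows "\<exists>\<phi> \<psi>. \<phi> holomorphic_on G \<and> \<psi> holomorphic_on ball 0 1 \<and> \<phi> 0 = 0 \<and>
    (\<forall>z\<in>G. \<phi> z \<in> ball 0 1 \<and> \<psi> (\<phi> z) = z) \<and> (\<forall>z\<in>ball 0 1. \<psi> z \<in> G \<and> \<phi> (\<psi> z) = z)"
proof -
  have "G \<noteq> {}" using assms(3) by blast
  then obtain f g where f: "f holomorphic_on G" "g holomorphic_on ball 0 1"
    "\<forall>z\<in>G. f z \<in> ball 0 1 \<and> g (f z) = z" "\<forall>z\<in>ball 0 1. g z \<in> G \<and> f (g z) = z"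
    using assms simply_connected_eq_biholomorphic_to_disc[OF assms(1)] by blast
  have "f 0 \<in> ball 0 1" using f(3) assms(3) by blast
  then obtain a b where a: "a (f 0) = 0" "a holomorphic_on ball 0 1" "a ` ball 0 1 \<subseteq> ball 0 1"
    "b holomorphic_on ball 0 1" "b ` ball 0 1 \<subseteq> ball 0 1"
    "\<And>z. z \<in> ball 0 1 \<Longrightarrow> a (b z) = z" "\<And>z. z \<in> ball 0 1 \<Longrightarrow> b (a z) = z"
    by (rule ball_biholomorphism_exists) blast
  have fG: "f ` G \<subseteq> ball 0 1" using f(3) by blast
  have "(\<lambda>z. a (f z)) holomorphic_on G"
    using holomorphic_on_compose_gen[OF f(1) a(2) fG] by (simp add: o_def)
  moreover have "(\<lambda>z. g (b z)) holomorphic_on ball 0 1"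
    using holomorphic_on_compose_gen[OF a(4) f(2) a(5)] by (simp add: o_def)
  moreover have "\<forall>z\<in>G. a (f z) \<in> ball 0 1 \<and> g (b (a (f z))) = z"
  proof
    fix z assume z: "z \<in> G"
    then have fz: "f z \<in> ball 0 1" "g (f z) = z" using f(3) by blast+
    show "a (f z) \<in> ball 0 1 \<and> g (b (a (f z))) = z"
      using subsetD[OF a(3) imageI[OF fz(1)]] fz a(7)[OF fz(1)] by simp
  qed
  moreover have "\<forall>z\<in>ball 0 1. g (b z) \<in> G \<and> a (f (g (b z))) = z"
  proof
    fix z :: complex assume z: "z \<in> ball 0 1"
    then have bz: "b z \<in> ball 0 1" using a(5) by blast
    then have "g (b z) \<in> G" "f (g (b z)) = b z" using f(4) by blast+
    then show "g (b z) \<in> G \<and> a (f (g (b z))) = z" using a(6)[OF z] by simp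
  qed
  ultimately show ?thesis using a(1)
    by (intro exI[of _ "\<lambda>z. a (f z)"] exI[of _ "\<lambda>z. g (b z)"] conjI)
qed

text \<open>With \<open>\<sigma> = sqrt (1 - \<psi>/d)\<close>, the function \<open>(\<sigma> - 1) / (\<sigma> + 1)\<close> is
  univalent and never takes reciprocal values.\<close>

theorem Koebe_quarter_omitted_value:
  assumes hol: "\<psi> holomorphic_on ball 0 1" and inj: "inj_on \<psi> (ball 0 1)" and \<psi>0: "\<psi> 0 = 0"
    and d: "\<And>z. z \<in> ball 0 1 \<Longrightarrow> \<psi> z \<noteq> d"
  shows "norm (deriv \<psi> 0) \<le> 4 * norm d"
proof -
  have d0: "d \<noteq> 0" using d[of 0] \<psi>0 by auto
  have hol': "(\<lambda>z. 1 - \<psi> z / d) holomorphic_on ball 0 1"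
    using d0 by (intro holomorphic_intros hol) auto
  have nz: "1 - \<psi> z / d \<noteq> 0" if "z \<in> ball 0 1" for z
    using d[OF that] d0 by (auto simp: field_simps)
  obtain s where s: "s holomorphic_on ball 0 1" "\<And>z. z \<in> ball 0 1 \<Longrightarrow> 1 - \<psi> z / d = (s z)\<^sup>2"
    by (rule simply_connected_imp_holomorphic_sqrt[OF hol' convex_imp_simply_connected[OF convex_ball]
          open_imp_locally_path_connected[OF open_ball] nz]) blast+
  have s0: "(s 0)\<^sup>2 = 1" using s(2)[of 0] \<psi>0 by simp
  \<comment> \<open>\<open>s 0\<close> is 1 or -1; multiplying by it selects the branch of the
    square root with value 1 at the origin.\<close>
  define \<sigma> where "\<sigma> = (\<lambda>z. s 0 * s z)"
  have hol\<sigma>: "\<sigma> holomorphic_on ball 0 1" unfolding \<sigma>_def by (intro holomorphic_intros s)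
  have \<sigma>sq: "(\<sigma> z)\<^sup>2 = 1 - \<psi> z / d" if "z \<in> ball 0 1" for z
    using s(2)[OF that] s0 by (simp add: \<sigma>_def power_mult_distrib)
  have \<sigma>0: "\<sigma> 0 = 1" using s0 by (simp add: \<sigma>_def power2_eq_square)
  have \<psi>eq: "\<psi> z = d * (1 - (\<sigma> z)\<^sup>2)" if "z \<in> ball 0 1" for z
    using \<sigma>sq[OF that] d0 by (simp add: field_simps)
  have sq_inj: "z = w" if "z \<in> ball 0 1" "w \<in> ball 0 1" "(\<sigma> z)\<^sup>2 = (\<sigma> w)\<^sup>2" for z w
    by (rule inj_onD[OF inj _ that(1,2)]) (simp add: \<psi>eq[OF that(1)] \<psi>eq[OF that(2)] that(3))
  have \<sigma>nz: "\<sigma> z \<noteq> 0" if "z \<in> ball 0 1" for z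
    using \<sigma>sq[OF that] nz[OF that] by auto
  \<comment> \<open>Equal squares force equal points, so \<open>\<sigma>\<close> never takes
    opposite values. For the quotient \<open>f\<close> below this is exactly the absence of
    reciprocal values: the product of two values is 1 only if the two values of
    \<open>\<sigma>\<close> add up to 0.\<close>
  have \<sigma>neg: "\<sigma> z \<noteq> - \<sigma> w" if zw: "z \<in> ball 0 1" "w \<in> ball 0 1" for z w
  proof
    assume eq: "\<sigma> z = - \<sigma> w"
    have "z = w" by (rule sq_inj[OF zw]) (simp add: eq)
    then show False using eq \<sigma>nz[OF zw(2)] by simp
  qed
  have \<sigma>1: "\<sigma> z + 1 \<noteq> 0" if "z \<in> ball 0 1" for z
    using \<sigma>neg[OF that, of 0] \<sigma>0 by (auto simp: add_eq_0_iff2)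
  define f where "f = (\<lambda>z. (\<sigma> z - 1) / (\<sigma> z + 1))"
  have holf: "f holomorphic_on ball 0 1"
    unfolding f_def using \<sigma>1 by (intro holomorphic_intros hol\<sigma>) auto
  have "norm (deriv f 0) \<le> 1"
  proof (rule Bieberbach_Eilenberg_univalent[OF holf])
    show "inj_on f (ball 0 1)"
    proof (rule inj_onI)
      fix z w :: complex assume zw: "z \<in> ball 0 1" "w \<in> ball 0 1" "f z = f w"
      then have "(\<sigma> z - 1) * (\<sigma> w + 1) = (\<sigma> w - 1) * (\<sigma> z + 1)"
        using \<sigma>1[OF zw(1)] \<sigma>1[OF zw(2)] by (simp add: f_def field_simps)
      then have "2 * \<sigma> z = 2 * \<sigma> w" by (simp add: algebra_simps)
      then have "\<sigma> z = \<sigma> w" by simp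
      show "z = w" by (rule sq_inj[OF zw(1,2)]) (simp add: \<open>\<sigma> z = \<sigma> w\<close>)
    qed
    show "f 0 = 0" by (simp add: f_def \<sigma>0)
    show "f z * f w \<noteq> 1" if zw: "z \<in> ball 0 1" "w \<in> ball 0 1" for z w
    proof
      assume "f z * f w = 1"
      then have "(\<sigma> z - 1) * (\<sigma> w - 1) = (\<sigma> z + 1) * (\<sigma> w + 1)"
        using \<sigma>1[OF zw(1)] \<sigma>1[OF zw(2)] by (simp add: f_def)
      then have "2 * (\<sigma> z + \<sigma> w) = 0" by (simp add: algebra_simps)
      then show False using \<sigma>neg[OF zw] by (simp add: add_eq_0_iff2)
    qed
  qed
  \<comment> \<open>Koebe's 4 is made of two factors 2: one from differentiating \<sigma>^2, the
    other from the derivative 1/2 of (\<sigma> - 1)/(\<sigma> + 1) at \<sigma> = 1.\<close>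
  moreover have "deriv f 0 = - deriv \<psi> 0 / (4 * d)"
  proof -
    define c where "c = deriv \<sigma> 0"
    have D\<sigma>: "(\<sigma> has_field_derivative c) (at 0)"
      unfolding c_def by (rule holomorphic_derivI[OF hol\<sigma> open_ball]) simp
    have "((\<lambda>z. d * (1 - (\<sigma> z)\<^sup>2)) has_field_derivative - 2 * d * c) (at 0)"
      by (auto intro!: derivative_eq_intros D\<sigma> simp: \<sigma>0)
    moreover have "(\<psi> has_field_derivative deriv \<psi> 0) (at 0)"
      by (rule holomorphic_derivI[OF hol open_ball]) simp
    then have "((\<lambda>z. d * (1 - (\<sigma> z)\<^sup>2)) has_field_derivative deriv \<psi> 0) (at 0)"
      by (rule has_field_derivative_transform_within_open[OF _ open_ball, of _ _ _ 0 1]) (use \<psi>eq in auto)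
    ultimately have c: "deriv \<psi> 0 = - 2 * d * c" by (rule DERIV_unique[rotated])
    have "(f has_field_derivative (c * (1 + 1) - (1 - 1) * c) / ((1 + 1) * (1 + 1))) (at 0)"
      unfolding f_def by (auto intro!: derivative_eq_intros D\<sigma> simp: \<sigma>0)
    then have "deriv f 0 = c / 2" by (simp add: DERIV_imp_deriv)
    then show ?thesis using c d0 by (simp add: field_simps)
  qed
  ultimately show ?thesis using d0 by (simp add: norm_divide norm_mult field_simps)
qed

text \<open>\<open>F\<close> is the derivative of a Riemann map \<phi> fixing 0, scaled to value 1
  at 0. As |\<phi>'|^2 is the Jacobian, its squared norm is the disc area \<pi> times |\<psi>'(0)|^2
  for the inverse map \<psi>, and Koebe bounds |\<psi>'(0)| by 4|d|.\<close>

theorem simply_connected_L2_function: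
  assumes G: "open G" "simply_connected G" "0 \<in> G" and d: "d \<notin> G"
  shows "\<exists>F. F holomorphic_on G \<and> F 0 = 1 \<and>
    (\<integral>\<^sup>+w. ennreal ((norm (F w))\<^sup>2) * indicator G w \<partial>lborel) \<le> ennreal (16 * pi * (norm d)\<^sup>2)"
proof -
  have "G \<noteq> UNIV" using d by blast
  from Riemann_map_at_origin[OF G this] obtain \<phi> \<psi> where
    "\<phi> holomorphic_on G \<and> \<psi> holomorphic_on ball 0 1 \<and> \<phi> 0 = 0 \<and>
    (\<forall>z\<in>G. \<phi> z \<in> ball 0 1 \<and> \<psi> (\<phi> z) = z) \<and> (\<forall>z\<in>ball 0 1. \<psi> z \<in> G \<and> \<phi> (\<psi> z) = z)"
    by (elim exE)
  then have \<phi>: "\<phi> holomorphic_on G" "\<psi> holomorphic_on ball 0 1" "\<phi> 0 = 0"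
    "\<And>z. z \<in> G \<Longrightarrow> \<phi> z \<in> ball 0 1" "\<And>z. z \<in> G \<Longrightarrow> \<psi> (\<phi> z) = z"
    "\<And>z. z \<in> ball 0 1 \<Longrightarrow> \<psi> z \<in> G" "\<And>z. z \<in> ball 0 1 \<Longrightarrow> \<phi> (\<psi> z) = z"
    by simp_all
  have \<psi>0: "\<psi> 0 = 0" using \<phi>(3) \<phi>(5)[OF G(3)] by simp
  have inj\<psi>: "inj_on \<psi> (ball 0 1)" by (rule inj_on_inverseI[of _ \<phi>]) (rule \<phi>(7))
  have inj\<phi>: "inj_on \<phi> G" by (rule inj_on_inverseI[of _ \<psi>]) (rule \<phi>(5))
  have Koebe: "norm (deriv \<psi> 0) \<le> 4 * norm d"
    by (rule Koebe_quarter_omitted_value[OF \<phi>(2) inj\<psi> \<psi>0]) (use \<phi>(6) d in blast)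
  have im: "\<phi> ` G = ball 0 1"
  proof
    show "\<phi> ` G \<subseteq> ball 0 1" using \<phi>(4) by blast
    show "ball 0 1 \<subseteq> \<phi> ` G" 
    proof
      fix z :: complex assume z: "z \<in> ball 0 1"
      show "z \<in> \<phi> ` G" using \<phi>(6)[OF z] \<phi>(7)[OF z] by (intro image_eqI[of z \<phi> "\<psi> z"]) simp_all
    qed
  qed
  have D\<phi>: "(\<phi> has_field_derivative deriv \<phi> z) (at z)" if "z \<in> G" for z
    by (rule holomorphic_derivI[OF \<phi>(1) G(1) that])
  have contD: "continuous_on G (deriv \<phi>)"
    by (intro holomorphic_on_imp_continuous_on holomorphic_deriv \<phi> G)
  have prod: "deriv \<psi> 0 * deriv \<phi> 0 = 1"
  proof -
    have "(\<psi> has_field_derivative deriv \<psi> 0) (at (\<phi> 0))"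
      unfolding \<phi>(3) by (rule holomorphic_derivI[OF \<phi>(2) open_ball]) simp
    from DERIV_chain2[OF this D\<phi>[OF G(3)]]
    have "((\<lambda>z. \<psi> (\<phi> z)) has_field_derivative deriv \<psi> 0 * deriv \<phi> 0) (at 0)" .
    then have "((\<lambda>z. z) has_field_derivative deriv \<psi> 0 * deriv \<phi> 0) (at 0)"
      by (rule has_field_derivative_transform_within_open[OF _ G(1) G(3)]) (rule \<phi>(5))
    from DERIV_unique[OF this DERIV_ident] show ?thesis .
  qed
  define F where "F = (\<lambda>z. deriv \<psi> 0 * deriv \<phi> z)"
  have "F holomorphic_on G" unfolding F_def by (intro holomorphic_intros holomorphic_deriv \<phi> G)
  moreover have "F 0 = 1" using prod by (simp add: F_def)
  moreover have "(\<integral>\<^sup>+w. ennreal ((norm (F w))\<^sup>2) * indicator G w \<partial>lborel) \<le> ennreal (16 * pi * (norm d)\<^sup>2)"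
  proof -
    have disc: "(\<integral>\<^sup>+w. ennreal 1 * indicator (\<phi> ` G) w \<partial>lborel) = ennreal pi"
      unfolding im by (simp add: emeasure_ball unit_ball_vol_2)
    have eq: "(\<integral>\<^sup>+z. ennreal ((norm (deriv \<phi> z))\<^sup>2 * 1) * indicator G z \<partial>lborel) = (\<integral>\<^sup>+w. ennreal 1 * indicator (\<phi> ` G) w \<partial>lborel)"
    proof (rule nn_integral_holomorphic_change_of_variables[where h = "\<lambda>_. 1"])
      show "(\<phi> has_field_derivative deriv \<phi> z) (at z)" if "z \<in> G" for z by (rule D\<phi>[OF that])
      show "(\<integral>\<^sup>+w. ennreal 1 * indicator (\<phi> ` G) w \<partial>lborel) < \<infinity>" unfolding disc by simp
    qed (simp_all add: G im contD inj\<phi>)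
    have "(\<integral>\<^sup>+w. ennreal ((norm (F w))\<^sup>2) * indicator G w \<partial>lborel)
        = (\<integral>\<^sup>+w. ennreal ((norm (deriv \<psi> 0))\<^sup>2) * (ennreal ((norm (deriv \<phi> w))\<^sup>2) * indicator G w) \<partial>lborel)"
      by (intro nn_integral_cong) (simp add: F_def norm_mult power_mult_distrib ennreal_mult mult.assoc)
    also have "\<dots> = ennreal ((norm (deriv \<psi> 0))\<^sup>2) * (\<integral>\<^sup>+w. ennreal ((norm (deriv \<phi> w))\<^sup>2) * indicator G w \<partial>lborel)"
    proof (rule nn_integral_cmult)
      have "deriv \<phi> \<in> borel_measurable (restrict_space borel G)"
        by (rule borel_measurable_continuous_on_restrict[OF contD])
      then have "(\<lambda>z. ennreal ((norm (deriv \<phi> z))\<^sup>2)) \<in> borel_measurable (restrict_space borel G)"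
        by measurable
      then show "(\<lambda>w. ennreal ((norm (deriv \<phi> w))\<^sup>2) * indicator G w) \<in> borel_measurable lborel"
        using G(1) by (subst (asm) borel_measurable_restrict_space_iff_ennreal) auto
    qed
    also have "\<dots> = ennreal ((norm (deriv \<psi> 0))\<^sup>2 * pi)"
      using eq disc by (simp add: ennreal_mult)
    also have "\<dots> \<le> ennreal (16 * pi * (norm d)\<^sup>2)"
    proof (rule ennreal_leI)
      have "(norm (deriv \<psi> 0))\<^sup>2 \<le> (4 * norm d)\<^sup>2" using Koebe by (intro power_mono) auto
      then have "(norm (deriv \<psi> 0))\<^sup>2 * pi \<le> (4 * norm d)\<^sup>2 * pi" by (intro mult_right_mono) auto
      then show "(norm (deriv \<psi> 0))\<^sup>2 * pi \<le> 16 * pi * (norm d)\<^sup>2" by (simp add: power_mult_distrib mult_ac)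
    qed
    finally show ?thesis .
  qed
  ultimately show ?thesis by blast
qed

section \<open>Lebesgue measure in orthonormal coordinates\<close>

text \<open>Evaluate \<open>\<integral>\<integral> 1\<^sub>A(x) 1\<^sub>B(y - x)\<close> in both orders of integration.\<close>

lemma translation_invariant_measure_swap:
  fixes \<mu> :: "'a::euclidean_space measure"
  assumes sf: "sigma_finite_measure \<mu>" and sets [measurable_cong]: "sets \<mu> = sets borel"
    and inv: "\<And>a. distr \<mu> borel (\<lambda>x. x + a) = \<mu>"
    and A [measurable]: "A \<in> sets borel" and B [measurable]: "B \<in> sets borel"
  shows "emeasure \<mu> A * emeasure lborel B = emeasure \<mu> (uminus -` B) * emeasure lborel A"
proof -
  interpret \<mu>: sigma_finite_measure \<mu> by (rule sf)
  interpret pair_sigma_finite \<mu> lborel ..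
  have invl: "distr lborel borel (\<lambda>y. y + a) = lborel" for a :: 'a
  proof -
    have "(\<lambda>y. y + a) = (+) a" by (auto simp: add.commute)
    then show ?thesis by (simp only: lborel_distr_plus)
  qed
  have trans\<mu>: "(\<integral>\<^sup>+x. f x \<partial>\<mu>) = (\<integral>\<^sup>+x. f (x + a) \<partial>\<mu>)" if [measurable]: "f \<in> borel_measurable borel" for f a
  proof -
    have "(\<integral>\<^sup>+x. f x \<partial>\<mu>) = (\<integral>\<^sup>+x. f x \<partial>(distr \<mu> borel (\<lambda>x. x + a)))" using inv[of a] by simp
    then show ?thesis by (simp add: nn_integral_distr)
  qed
  have transl: "(\<integral>\<^sup>+x. f x \<partial>lborel) = (\<integral>\<^sup>+x. f (x + a) \<partial>lborel)" if [measurable]: "f \<in> borel_measurable borel" for f and a :: 'a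
  proof -
    have "(\<integral>\<^sup>+x. f x \<partial>lborel) = (\<integral>\<^sup>+x. f x \<partial>(distr lborel borel (\<lambda>x. x + a)))" using invl[of a] by simp
    then show ?thesis by (simp add: nn_integral_distr)
  qed
  have sp: "space \<mu> = UNIV" using sets_eq_imp_space_eq[OF sets] by simp
  have "(\<integral>\<^sup>+x. (\<integral>\<^sup>+y. indicator A x * indicator B (y - x) \<partial>lborel) \<partial>\<mu>) = emeasure \<mu> A * emeasure lborel B"
  proof -
    have "(\<integral>\<^sup>+y. indicator A x * indicator B (y - x) \<partial>lborel) = indicator A x * emeasure lborel B" for x :: 'a
    proof -
      have "(\<integral>\<^sup>+y. indicator A x * indicator B (y - x) \<partial>lborel) = (\<integral>\<^sup>+y. indicator A x * indicator B (y + x - x) \<partial>lborel)"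
        by (rule transl) measurable
      also have "\<dots> = indicator A x * emeasure lborel B"
        by (simp add: nn_integral_cmult)
      finally show ?thesis .
    qed
    then show ?thesis
      by (simp add: nn_integral_multc)
  qed
  moreover have "(\<integral>\<^sup>+x. (\<integral>\<^sup>+y. indicator A x * indicator B (y - x) \<partial>lborel) \<partial>\<mu>)
      = emeasure \<mu> (uminus -` B) * emeasure lborel A"
  proof -
    have uB [measurable]: "uminus -` B \<in> sets borel"
      by (rule measurable_sets_borel[OF _ B]) simp
    have "(\<integral>\<^sup>+x. (\<integral>\<^sup>+y. indicator A x * indicator B (y - x) \<partial>lborel) \<partial>\<mu>)
        = (\<integral>\<^sup>+y. (\<integral>\<^sup>+x. indicator A x * indicator B (y - x) \<partial>\<mu>) \<partial>lborel)"
      by (rule Fubini'[symmetric]) measurable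
    also have "\<dots> = (\<integral>\<^sup>+y. (\<integral>\<^sup>+x. indicator A (x + y) * indicator B (y - (x + y)) \<partial>\<mu>) \<partial>lborel)"
    proof (rule nn_integral_cong)
      fix y :: 'a
      show "(\<integral>\<^sup>+x. indicator A x * indicator B (y - x) \<partial>\<mu>) = (\<integral>\<^sup>+x. indicator A (x + y) * indicator B (y - (x + y)) \<partial>\<mu>)"
        by (rule trans\<mu>) measurable
    qed
    also have "\<dots> = (\<integral>\<^sup>+y. (\<integral>\<^sup>+x. indicator A (x + y) * indicator (uminus -` B) x \<partial>\<mu>) \<partial>lborel)"
      by (intro nn_integral_cong) (auto split: split_indicator)
    also have "\<dots> = (\<integral>\<^sup>+x. (\<integral>\<^sup>+y. indicator A (x + y) * indicator (uminus -` B) x \<partial>lborel) \<partial>\<mu>)"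
      by (rule Fubini') measurable
    also have "\<dots> = (\<integral>\<^sup>+x. emeasure lborel A * indicator (uminus -` B) x \<partial>\<mu>)"
    proof (rule nn_integral_cong)
      fix x :: 'a
      have "(\<integral>\<^sup>+y. indicator A (x + y) * indicator (uminus -` B) x \<partial>lborel) = (\<integral>\<^sup>+y. indicator A (y + x) \<partial>lborel) * indicator (uminus -` B) x"
        by (subst nn_integral_multc) (simp_all add: add.commute)
      also have "(\<integral>\<^sup>+y. indicator A (y + x) \<partial>lborel) = (\<integral>\<^sup>+y. indicator A y \<partial>lborel)"
        by (rule transl[symmetric]) measurable
      finally show "(\<integral>\<^sup>+y. indicator A (x + y) * indicator (uminus -` B) x \<partial>lborel) = emeasure lborel A * indicator (uminus -` B) x"
        by simp
    qed
    also have "\<dots> = emeasure \<mu> (uminus -` B) * emeasure lborel A"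
      by (subst nn_integral_cmult) (simp_all add: sets mult.commute)
    finally show ?thesis .
  qed
  ultimately show ?thesis by simp
qed

text \<open>The image measure is translation invariant and agrees with \<open>lborel\<close> on
  balls about 0, which an isometry preserves. The swapping identity, with the unit ball as
  \<open>B\<close>, carries this agreement over to every Borel set without any determinant.\<close>

lemma lborel_distr_linear_isometry:
  fixes U :: "'a::euclidean_space \<Rightarrow> 'a"
  assumes lin: "linear U" and iso: "\<And>x. norm (U x) = norm x"
  shows "distr lborel borel U = lborel"
proof -
  define \<mu> where "\<mu> = distr lborel borel U"
  have meas [measurable]: "U \<in> borel_measurable borel"
    using lin by (intro borel_measurable_continuous_onI linear_continuous_on) (simp add: linear_conv_bounded_linear)
  have inj: "inj U"
    unfolding linear_injective_0[OF lin]
  proof (intro allI impI)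
    show "x = 0" if "U x = 0" for x using iso[of x] that by simp
  qed
  then have surj: "surj U" using linear_injective_imp_surjective[OF lin] by blast
  have ball: "emeasure \<mu> (ball 0 r) = emeasure lborel (ball (0::'a) r)" for r
  proof -
    have "U -` ball 0 r = ball 0 r" using iso by auto
    then show ?thesis unfolding \<mu>_def by (subst emeasure_distr) auto
  qed
  have sets: "sets \<mu> = sets borel" by (simp add: \<mu>_def)
  have sp: "space \<mu> = UNIV" by (simp add: \<mu>_def)
  have "sigma_finite_measure \<mu>"
  proof
    show "\<exists>A. countable A \<and> A \<subseteq> sets \<mu> \<and> \<Union> A = space \<mu> \<and> (\<forall>a\<in>A. emeasure \<mu> a \<noteq> \<infinity>)"
    proof (intro exI conjI ballI)
      show "countable (range (\<lambda>k::nat. ball (0::'a) (real k)))" by simp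
      show "range (\<lambda>k::nat. ball (0::'a) (real k)) \<subseteq> sets \<mu>" by (auto simp: sets)
      show "\<Union> (range (\<lambda>k::nat. ball (0::'a) (real k))) = space \<mu>"
        unfolding sp by (auto intro: reals_Archimedean2)
      show "emeasure \<mu> a \<noteq> \<infinity>" if "a \<in> range (\<lambda>k::nat. ball (0::'a) (real k))" for a
        using that ball emeasure_bounded_finite[OF bounded_ball] by (auto simp: less_top)
    qed
  qed
  moreover have "distr \<mu> borel (\<lambda>x. x + a) = \<mu>" for a
  proof -
    obtain b where b: "a = U b" using surj by (metis surjD)
    have "distr \<mu> borel (\<lambda>x. x + a) = distr lborel borel (\<lambda>x. U x + a)"
      unfolding \<mu>_def by (subst distr_distr) (auto simp: o_def)
    also have "(\<lambda>x. U x + a) = (\<lambda>x. U (b + x))"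
      using linear_add[OF lin] by (auto simp: b add.commute)
    also have "distr lborel borel (\<lambda>x. U (b + x)) = distr (distr lborel borel ((+) b)) borel U"
      by (subst distr_distr) (auto simp: o_def)
    also have "\<dots> = \<mu>" by (simp add: lborel_distr_plus \<mu>_def)
    finally show ?thesis .
  qed
  ultimately have swap: "emeasure \<mu> A * emeasure lborel (ball (0::'a) 1) = emeasure \<mu> (uminus -` ball 0 1) * emeasure lborel A"
    if "A \<in> sets borel" for A
    using sets that by (intro translation_invariant_measure_swap) auto
  have um: "uminus -` ball (0::'a) 1 = ball 0 1" by auto
  have "unit_ball_vol (real DIM('a)) > 0" by (rule unit_ball_vol_pos) simp
  then have ub: "unit_ball_vol (real DIM('a)) \<noteq> 0" by linarith
  have pos: "emeasure lborel (ball (0::'a) 1) \<noteq> 0" "emeasure lborel (ball (0::'a) 1) \<noteq> \<infinity>"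
    using emeasure_bounded_finite[OF bounded_ball, of "0::'a" 1] ub by (simp_all add: emeasure_ball)
  have "emeasure \<mu> A = emeasure lborel A" if "A \<in> sets borel" for A
  proof -
    have "emeasure lborel (ball (0::'a) 1) * emeasure \<mu> A = emeasure lborel (ball (0::'a) 1) * emeasure lborel A"
      using swap[OF that] unfolding um ball by (simp only: mult.commute)
    then show ?thesis using pos by (simp add: ennreal_mult_cancel_left)
  qed
  then have "\<mu> = lborel" by (intro measure_eqI) (auto simp: sets)
  then show ?thesis by (simp add: \<mu>_def)
qed

section \<open>Lebesgue measure as a product over complex coordinates\<close>

lemma prod_Basis_vec:
  "(\<Prod>b\<in>(Basis :: (complex ^ 'n) set). f b) = (\<Prod>i\<in>UNIV. f (axis i 1) * f (axis i \<i>))"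
proof -
  have bij: "bij_betw (\<lambda>(i, u). axis i u) ((UNIV :: 'n set) \<times> {1, \<i>}) (Basis :: (complex ^ 'n) set)"
    unfolding bij_betw_def
  proof
    show "inj_on (\<lambda>(i, u). axis i u :: complex ^ 'n) (UNIV \<times> {1, \<i>})"
      by (auto simp: inj_on_def axis_eq_axis)
    show "(\<lambda>(i, u). axis i u) ` (UNIV \<times> {1, \<i>}) = (Basis :: (complex ^ 'n) set)"
      by (auto simp: Basis_vec_def Basis_complex_def)
  qed
  have "(\<Prod>b\<in>(Basis :: (complex ^ 'n) set). f b) = (\<Prod>p\<in>UNIV \<times> {1, \<i>}. f (case p of (i, u) \<Rightarrow> axis i u))"
    by (rule prod.reindex_bij_betw[OF bij, symmetric])
  also have "\<dots> = (\<Prod>i\<in>UNIV. \<Prod>u\<in>{1, \<i>}. f (axis i u))"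
    by (subst prod.cartesian_product) (simp add: split_def)
  also have "\<dots> = (\<Prod>i\<in>UNIV. f (axis i 1) * f (axis i \<i>))"
    by simp
  finally show ?thesis .
qed

text \<open>Numbering the coordinates by naturals through \<open>\<beta>\<close> matches the
  indexing of the points \<open>a j\<close> and permits induction on the number of coordinates; the
  two measures agree on boxes.\<close>

lemma lborel_complex_vec_eq_distr_PiM:
  fixes \<beta> :: "'n::finite \<Rightarrow> nat"
  assumes \<beta>: "bij_betw \<beta> UNIV I"
  shows "lborel = distr (PiM I (\<lambda>_. lborel :: complex measure)) borel (\<lambda>t. \<chi> i. t (\<beta> i))"
proof (rule lborel_eqI)
  have I: "I = \<beta> ` UNIV" using \<beta> by (simp add: bij_betw_def)
  have fin: "finite I" by (simp add: I)
  interpret product_sigma_finite "\<lambda>_::nat. lborel :: complex measure" ..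
  have \<beta>I: "\<beta> i \<in> I" for i by (simp add: I)
  have meas: "(\<lambda>t. \<chi> i. t (\<beta> i)) \<in> borel_measurable (PiM I (\<lambda>_. lborel :: complex measure))"
  proof (subst borel_measurable_euclidean_space, intro ballI)
    fix b :: "complex ^ 'n" assume "b \<in> Basis"
    then obtain i u where b: "b = axis i u" by (auto simp: Basis_vec_def)
    have "(\<lambda>t. t (\<beta> i)) \<in> borel_measurable (PiM I (\<lambda>_. lborel :: complex measure))"
      using measurable_component_singleton[OF \<beta>I[of i], of "\<lambda>_. lborel :: complex measure"] by simp
    then show "(\<lambda>t. (\<chi> i. t (\<beta> i)) \<bullet> b) \<in> borel_measurable (PiM I (\<lambda>_. lborel :: complex measure))"
      unfolding b inner_axis by simp
  qed
  fix l u :: "complex ^ 'n" assume lu: "\<And>b. b \<in> Basis \<Longrightarrow> l \<bullet> b \<le> u \<bullet> b"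
  have lu1: "Re (l $ i) \<le> Re (u $ i)" and lu2: "Im (l $ i) \<le> Im (u $ i)" for i
  proof -
    have "axis i 1 \<in> (Basis :: (complex ^ 'n) set)" "axis i \<i> \<in> (Basis :: (complex ^ 'n) set)"
      by (simp_all add: axis_in_Basis_iff Basis_complex_def)
    then show "Re (l $ i) \<le> Re (u $ i)" "Im (l $ i) \<le> Im (u $ i)"
      using lu[of "axis i 1"] lu[of "axis i \<i>"] by (simp_all add: inner_axis inner_complex_def)
  qed
  define \<gamma> where "\<gamma> = the_inv_into UNIV \<beta>"
  have inj: "inj \<beta>" using \<beta> by (simp add: bij_betw_def)
  have \<gamma>: "\<gamma> (\<beta> i) = i" for i by (simp add: \<gamma>_def the_inv_into_f_f inj)
  have "(\<lambda>t. \<chi> i. t (\<beta> i)) -` box l u \<inter> space (PiM I (\<lambda>_. lborel :: complex measure)) = PiE I (\<lambda>j. box (l $ \<gamma> j) (u $ \<gamma> j))"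
    (is "?L = ?R")
  proof (rule set_eqI)
    fix t :: "nat \<Rightarrow> complex"
    have "(\<chi> i. t (\<beta> i)) \<in> box l u \<longleftrightarrow> (\<forall>i. t (\<beta> i) \<in> box (l $ i) (u $ i))"
      unfolding mem_box Basis_vec_def by (simp add: inner_axis)
    also have "\<dots> \<longleftrightarrow> (\<forall>j\<in>I. t j \<in> box (l $ \<gamma> j) (u $ \<gamma> j))" by (simp add: I \<gamma>)
    finally show "t \<in> ?L \<longleftrightarrow> t \<in> ?R" by (auto simp: space_PiM PiE_def Pi_iff)
  qed
  then have "emeasure (distr (PiM I (\<lambda>_. lborel :: complex measure)) borel (\<lambda>t. \<chi> i. t (\<beta> i))) (box l u)
      = emeasure (PiM I (\<lambda>_. lborel :: complex measure)) (PiE I (\<lambda>j. box (l $ \<gamma> j) (u $ \<gamma> j)))"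
    using meas by (subst emeasure_distr) auto
  also have "\<dots> = (\<Prod>j\<in>I. emeasure lborel (box (l $ \<gamma> j) (u $ \<gamma> j)))"
    by (rule emeasure_PiM[OF fin]) simp
  also have "\<dots> = (\<Prod>i\<in>UNIV. emeasure lborel (box (l $ i) (u $ i)))"
    unfolding I by (subst prod.reindex[OF inj]) (simp add: o_def \<gamma>)
  also have "\<dots> = (\<Prod>i\<in>UNIV. ennreal ((u - l) \<bullet> axis i 1 * ((u - l) \<bullet> axis i \<i>)))"
  proof (rule prod.cong[OF refl])
    fix i
    show "emeasure lborel (box (l $ i) (u $ i)) = ennreal ((u - l) \<bullet> axis i 1 * ((u - l) \<bullet> axis i \<i>))"
      using lu1[of i] lu2[of i] by (subst emeasure_lborel_box) (auto simp: Basis_complex_def inner_axis)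
  qed
  also have "\<dots> = ennreal (\<Prod>b\<in>Basis. (u - l) \<bullet> b)"
    unfolding prod_Basis_vec using lu1 lu2 by (intro prod_ennreal) (simp add: inner_axis inner_complex_def)
  finally show "emeasure (distr (PiM I (\<lambda>_. lborel :: complex measure)) borel (\<lambda>t. \<chi> i. t (\<beta> i))) (box l u)
      = ennreal (\<Prod>b\<in>Basis. (u - l) \<bullet> b)" .
qed simp

text \<open>The shift of the \<open>j\<close>-th factor only involves coordinates below \<open>j\<close>, so integrating out the coordinates from the
  last one downwards removes them by translation invariance.\<close>

lemma nn_integral_triangular_product:
  fixes h :: "nat \<Rightarrow> complex \<Rightarrow> ennreal" and a :: "nat \<Rightarrow> nat \<Rightarrow> complex"
  assumes h: "\<And>j. h j \<in> borel_measurable borel"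
  shows "(\<integral>\<^sup>+t. (\<Prod>j=1..n. h j (t j + (\<Sum>k=1..<j. a j k * t k))) \<partial>(PiM {1..n} (\<lambda>_. lborel)))
    = (\<Prod>j=1..n. \<integral>\<^sup>+w. h j w \<partial>lborel)"
proof (induction n)
  case 0
  interpret product_sigma_finite "\<lambda>_::nat. lborel :: complex measure" ..
  show ?case by (simp add: PiM_empty nn_integral_count_space_finite)
next
  case (Suc n)
  interpret product_sigma_finite "\<lambda>_::nat. lborel :: complex measure" ..
  have meas: "(\<lambda>t. \<Prod>j=1..m. h j (t j + (\<Sum>k=1..<j. a j k * t k))) \<in> borel_measurable (PiM {1..n'} (\<lambda>_. lborel))"
    if "m \<le> n'" for m n'
  proof (intro borel_measurable_prod_ennreal measurable_compose[OF _ h])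
    fix j assume j: "j \<in> {1..m}"
    have comp: "(\<lambda>t. t k) \<in> borel_measurable (PiM {1..n'} (\<lambda>_. lborel :: complex measure))" if "k \<in> {1..j}" for k
      using measurable_component_singleton[of k "{1..n'}" "\<lambda>_. lborel :: complex measure"] that j \<open>m \<le> n'\<close> by simp
    show "(\<lambda>t. t j + (\<Sum>k=1..<j. a j k * t k)) \<in> borel_measurable (PiM {1..n'} (\<lambda>_. lborel))"
      using j by (intro borel_measurable_add borel_measurable_sum borel_measurable_times borel_measurable_const comp) auto
  qed
  define G where "G = (\<lambda>t. \<Prod>j=1..n. h j (t j + (\<Sum>k=1..<j. a j k * t k)))"
  have ins: "{1..Suc n} = insert (Suc n) {1..n}" by auto
  define G' where "G' = (\<lambda>t. \<Prod>j=1..Suc n. h j (t j + (\<Sum>k=1..<j. a j k * t k)))"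
  have mG: "G' \<in> borel_measurable (PiM {1..Suc n} (\<lambda>_. lborel))"
    unfolding G'_def by (rule meas) simp
  have "(\<integral>\<^sup>+t. (\<Prod>j=1..Suc n. h j (t j + (\<Sum>k=1..<j. a j k * t k))) \<partial>(PiM {1..Suc n} (\<lambda>_. lborel)))
      = (\<integral>\<^sup>+t. G' t \<partial>(PiM {1..Suc n} (\<lambda>_. lborel)))"
    by (simp only: G'_def)
  also have "\<dots> = (\<integral>\<^sup>+t. (\<integral>\<^sup>+y. G' (t(Suc n := y)) \<partial>lborel) \<partial>(PiM {1..n} (\<lambda>_. lborel)))"
    using mG unfolding ins by (intro product_nn_integral_insert) auto
  also have "\<dots> = (\<integral>\<^sup>+t. G t * (\<integral>\<^sup>+w. h (Suc n) w \<partial>lborel) \<partial>(PiM {1..n} (\<lambda>_. lborel)))"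
  proof (rule nn_integral_cong)
    fix t :: "nat \<Rightarrow> complex"
    define c where "c = (\<Sum>k=1..<Suc n. a (Suc n) k * t k)"
    have "G' (t(Suc n := y)) = G t * h (Suc n) (y + c)" for y
    proof -
      have "(\<Prod>j=1..n. h j ((t(Suc n := y)) j + (\<Sum>k=1..<j. a j k * (t(Suc n := y)) k))) = G t"
        unfolding G_def by (intro prod.cong refl arg_cong[where f="h _"] arg_cong2[where f="(+)"] sum.cong) auto
      moreover have "(\<Sum>k=1..<Suc n. a (Suc n) k * (t(Suc n := y)) k) = c"
        unfolding c_def by (intro sum.cong) auto
      ultimately show ?thesis unfolding G'_def ins by (subst prod.insert) (simp_all add: mult.commute)
    qed
    then have "(\<integral>\<^sup>+y. G' (t(Suc n := y)) \<partial>lborel)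
        = (\<integral>\<^sup>+y. G t * h (Suc n) (y + c) \<partial>lborel)" by simp
    also have "\<dots> = G t * (\<integral>\<^sup>+y. h (Suc n) (y + c) \<partial>lborel)"
      using h by (intro nn_integral_cmult) simp
    also have "(\<integral>\<^sup>+y. h (Suc n) (y + c) \<partial>lborel) = (\<integral>\<^sup>+w. h (Suc n) w \<partial>lborel)"
    proof -
      have "(\<integral>\<^sup>+w. h (Suc n) w \<partial>lborel) = (\<integral>\<^sup>+w. h (Suc n) w \<partial>(distr lborel borel ((+) c)))"
        by (simp add: lborel_distr_plus)
      then show ?thesis using h by (simp add: nn_integral_distr add.commute)
    qed
    finally show "(\<integral>\<^sup>+y. G' (t(Suc n := y)) \<partial>lborel)
        = G t * (\<integral>\<^sup>+w. h (Suc n) w \<partial>lborel)" .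
  qed
  also have "\<dots> = (\<integral>\<^sup>+t. G t \<partial>(PiM {1..n} (\<lambda>_. lborel))) * (\<integral>\<^sup>+w. h (Suc n) w \<partial>lborel)"
    unfolding G_def by (intro nn_integral_multc meas) simp
  also have "\<dots> = (\<Prod>j=1..Suc n. \<integral>\<^sup>+w. h j w \<partial>lborel)"
    unfolding G_def Suc.IH by simp
  finally show ?case .
qed

text \<open>Write exp(-N x) as the integral of exp(-s) over s > N x and exchange the order of
  integration; the inner integral is then the measure of a sublevel set.\<close>

lemma nn_integral_exp_layer_cake:
  fixes N :: "'a \<Rightarrow> real"
  assumes sf: "sigma_finite_measure M" and [measurable]: "N \<in> borel_measurable M" and N0: "\<And>x. 0 \<le> N x"
  shows "(\<integral>\<^sup>+x. ennreal (exp (- N x)) \<partial>M)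
    = (\<integral>\<^sup>+s. ennreal (exp (- s)) * indicator {0..} s * emeasure M {x \<in> space M. N x < s} \<partial>lborel)"
proof -
  interpret M: sigma_finite_measure M by (rule sf)
  interpret pair_sigma_finite M lborel ..
  have inner: "ennreal (exp (- N x)) = (\<integral>\<^sup>+s. ennreal (exp (- s)) * indicator {0..} s * (if N x < s then 1 else 0) \<partial>lborel)"
    if x: "x \<in> space M" for x
  proof -
    have "(\<integral>\<^sup>+s. ennreal (exp (- s)) * indicator {N x..} s \<partial>lborel) = ennreal (0 - (- exp (- N x)))"
    proof (rule nn_integral_FTC_atLeast[where F = "\<lambda>s. - exp (- s)"])
      have "((\<lambda>s::real. exp (- s)) \<longlongrightarrow> 0) at_top"
        by (rule filterlim_compose[OF exp_at_bot filterlim_uminus_at_bot_at_top])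
      from tendsto_minus[OF this] show "((\<lambda>s::real. - exp (- s)) \<longlongrightarrow> 0) at_top" by simp
    qed (auto intro!: derivative_eq_intros)
    moreover have "(\<integral>\<^sup>+s. ennreal (exp (- s)) * indicator {N x..} s \<partial>lborel)
        = (\<integral>\<^sup>+s. ennreal (exp (- s)) * indicator {0..} s * (if N x < s then 1 else 0) \<partial>lborel)"
    \<comment> \<open>The closed half-line and the strict inequality differ only at
      \<open>s = N x\<close>.\<close>
    proof (rule nn_integral_cong_AE)
      show "AE s in lborel. ennreal (exp (- s)) * indicator {N x..} s
          = ennreal (exp (- s)) * indicator {0..} s * (if N x < s then 1 else 0)"
        using AE_lborel_singleton[of "N x"]
      proof eventually_elim
        case (elim s)
        then show ?case using N0[of x] x by (auto split: split_indicator)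
      qed
    qed
    ultimately show ?thesis by simp
  qed
  have "(\<integral>\<^sup>+x. ennreal (exp (- N x)) \<partial>M)
      = (\<integral>\<^sup>+x. (\<integral>\<^sup>+s. ennreal (exp (- s)) * indicator {0..} s * (if N x < s then 1 else 0) \<partial>lborel) \<partial>M)"
    by (intro nn_integral_cong inner)
  also have "\<dots> = (\<integral>\<^sup>+s. (\<integral>\<^sup>+x. ennreal (exp (- s)) * indicator {0..} s * (if N x < s then 1 else 0) \<partial>M) \<partial>lborel)"
    by (rule Fubini'[symmetric]) measurable
  also have "\<dots> = (\<integral>\<^sup>+s. ennreal (exp (- s)) * indicator {0..} s * emeasure M {x \<in> space M. N x < s} \<partial>lborel)"
  proof (rule nn_integral_cong)
    fix s :: real
    have "(\<integral>\<^sup>+x. ennreal (exp (- s)) * indicator {0..} s * (if N x < s then 1 else 0) \<partial>M)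
        = (\<integral>\<^sup>+x. ennreal (exp (- s)) * indicator {0..} s * indicator {x \<in> space M. N x < s} x \<partial>M)"
      by (intro nn_integral_cong) (simp split: split_indicator)
    also have "\<dots> = ennreal (exp (- s)) * indicator {0..} s * emeasure M {x \<in> space M. N x < s}"
      by (rule nn_integral_cmult_indicator) measurable
    finally show "(\<integral>\<^sup>+x. ennreal (exp (- s)) * indicator {0..} s * (if N x < s then 1 else 0) \<partial>M)
        = ennreal (exp (- s)) * indicator {0..} s * emeasure M {x \<in> space M. N x < s}" .
  qed
  finally show ?thesis .
qed

section \<open>Coordinates with respect to an orthonormal family\<close>

lemma hermitian_inner_sum_left:
  "hermitian_inner (\<Sum>i\<in>I. c i *s v i) m = (\<Sum>i\<in>I. c i * hermitian_inner (v i) m)"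
  by (induction I rule: infinite_finite_induct) (simp_all add: hermitian_inner_add_left hermitian_inner_scale_left)

lemma hermitian_inner_sum_right:
  "hermitian_inner x (\<Sum>i\<in>I. c i *s v i) = (\<Sum>i\<in>I. cnj (c i) * hermitian_inner x (v i))"
  unfolding hermitian_inner_cnj[of "\<Sum>i\<in>I. c i *s v i" x, symmetric] hermitian_inner_sum_left
  by (simp add: hermitian_inner_cnj)

definition orthonormal_family :: "nat \<Rightarrow> (nat \<Rightarrow> complex ^ 'n::finite) \<Rightarrow> bool" where
  "orthonormal_family n e \<longleftrightarrow>
    (\<forall>i\<in>{1..n}. \<forall>j\<in>{1..n}. hermitian_inner (e i) (e j) = (if i = j then 1 else 0))"

lemma orthonormal_coordinate:
  assumes "orthonormal_family n e" "k \<in> {1..n}"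
  shows "hermitian_inner (\<Sum>j=1..n. t j *s e j) (e k) = t k"
proof -
  have "hermitian_inner (\<Sum>j=1..n. t j *s e j) (e k) = (\<Sum>j=1..n. if j = k then t j else 0)"
    unfolding hermitian_inner_sum_left
    by (intro sum.cong refl) (use assms in \<open>auto simp: orthonormal_family_def\<close>)
  then show ?thesis using assms(2) by simp
qed

lemma orthonormal_isometry:
  fixes e :: "nat \<Rightarrow> complex ^ 'n::finite" and \<beta> :: "'n \<Rightarrow> nat"
  assumes e: "orthonormal_family n e" and \<beta>: "bij_betw \<beta> UNIV {1..n}"
  shows "linear (\<lambda>x. \<Sum>i\<in>UNIV. x $ i *s e (\<beta> i))" "norm (\<Sum>i\<in>UNIV. x $ i *s e (\<beta> i)) = norm x"
proof -
  show "linear (\<lambda>x. \<Sum>i\<in>UNIV. x $ i *s e (\<beta> i))"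
  proof (rule linearI)
    show "(\<Sum>i\<in>UNIV. (x + y) $ i *s e (\<beta> i)) = (\<Sum>i\<in>UNIV. x $ i *s e (\<beta> i)) + (\<Sum>i\<in>UNIV. y $ i *s e (\<beta> i))" for x y
      by (simp add: vector_sadd_rdistrib sum.distrib)
    show "(\<Sum>i\<in>UNIV. (c *\<^sub>R x) $ i *s e (\<beta> i)) = c *\<^sub>R (\<Sum>i\<in>UNIV. x $ i *s e (\<beta> i))" for c x
      unfolding scaleR_sum_right by (intro sum.cong refl) (simp add: vec_eq_iff)
  qed
  have h: "hermitian_inner (e (\<beta> i)) (e (\<beta> k)) = (if i = k then 1 else 0)" for i k
  proof -
    have "\<beta> i \<in> {1..n}" "\<beta> k \<in> {1..n}" using \<beta> by (auto simp: bij_betw_def)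
    moreover have "\<beta> i = \<beta> k \<longleftrightarrow> i = k" using \<beta> by (auto simp: bij_betw_def inj_eq)
    ultimately show ?thesis using e unfolding orthonormal_family_def by simp
  qed
  have "hermitian_inner (\<Sum>i\<in>UNIV. x $ i *s e (\<beta> i)) (\<Sum>i\<in>UNIV. x $ i *s e (\<beta> i)) = hermitian_inner x x"
    unfolding hermitian_inner_sum_left hermitian_inner_sum_right h
    by (simp add: hermitian_inner_def if_distrib[of "(*) _"] mult.commute cong: if_cong)
  then have "(norm (\<Sum>i\<in>UNIV. x $ i *s e (\<beta> i)))\<^sup>2 = (norm x)\<^sup>2"
    unfolding hermitian_inner_self of_real_eq_iff .
  then show "norm (\<Sum>i\<in>UNIV. x $ i *s e (\<beta> i)) = norm x" by simp
qed

lemma sum_reindex_coordinates: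
  assumes "bij_betw \<beta> UNIV I"
  shows "(\<Sum>i\<in>UNIV. (\<chi> i. t (\<beta> i)) $ i *s e (\<beta> i)) = (\<Sum>j\<in>I. t j *s e j)"
  using sum.reindex_bij_betw[OF assms, of "\<lambda>j. t j *s e j"] by simp

text \<open>Spanning comes from counting: the map sending the standard basis to \<open>e\<close> is
  an isometry, hence injective, hence surjective in finite dimension.\<close>

lemma orthonormal_expansion:
  fixes e :: "nat \<Rightarrow> complex ^ 'n::finite"
  assumes e: "orthonormal_family CARD('n) e"
  shows "x = (\<Sum>j=1..CARD('n). hermitian_inner x (e j) *s e j)"
proof -
  obtain \<beta> :: "'n \<Rightarrow> nat" where \<beta>: "bij_betw \<beta> UNIV {1..CARD('n)}"
    using finite_same_card_bij[of "UNIV :: 'n set" "{1..CARD('n)}"] by auto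
  define U :: "complex ^ 'n \<Rightarrow> complex ^ 'n" where "U = (\<lambda>x. \<Sum>i\<in>UNIV. x $ i *s e (\<beta> i))"
  have lin: "linear U" and norm: "norm (U x) = norm x" for x
    unfolding U_def by (rule orthonormal_isometry[OF e \<beta>])+
  have "inj U"
    unfolding linear_injective_0[OF lin]
  proof (intro allI impI)
    show "x = 0" if "U x = 0" for x using norm[of x] that by simp
  qed
  then have "surj U" by (rule linear_injective_imp_surjective[OF lin]) simp
  then obtain y where y: "x = U y" by blast
  define t where "t = (\<lambda>j. y $ the_inv_into UNIV \<beta> j)"
  have "inj \<beta>" using \<beta> by (simp add: bij_betw_def)
  then have "y = (\<chi> i. t (\<beta> i))" by (simp add: t_def the_inv_into_f_f)
  then have x: "x = (\<Sum>j=1..CARD('n). t j *s e j)"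
    unfolding y U_def by (simp only: sum_reindex_coordinates[OF \<beta>])
  have "hermitian_inner x (e j) = t j" if "j \<in> {1..CARD('n)}" for j
    unfolding x by (rule orthonormal_coordinate[OF e that])
  then show ?thesis using x by simp
qed

lemma nn_integral_orthonormal_coordinates:
  fixes e :: "nat \<Rightarrow> complex ^ 'n::finite" and h :: "complex ^ 'n \<Rightarrow> ennreal"
  assumes e: "orthonormal_family CARD('n) e" and h: "h \<in> borel_measurable borel"
  shows "(\<integral>\<^sup>+x. h x \<partial>lborel) = (\<integral>\<^sup>+t. h (\<Sum>j=1..CARD('n). t j *s e j) \<partial>(PiM {1..CARD('n)} (\<lambda>_. lborel)))"
proof -
  obtain \<beta> :: "'n \<Rightarrow> nat" where \<beta>: "bij_betw \<beta> UNIV {1..CARD('n)}"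
    using finite_same_card_bij[of "UNIV :: 'n set" "{1..CARD('n)}"] by auto
  define U :: "complex ^ 'n \<Rightarrow> complex ^ 'n" where "U = (\<lambda>x. \<Sum>i\<in>UNIV. x $ i *s e (\<beta> i))"
  define V :: "(nat \<Rightarrow> complex) \<Rightarrow> complex ^ 'n" where "V = (\<lambda>t. \<chi> i. t (\<beta> i))"
  define P where "P = PiM {1..CARD('n)} (\<lambda>_. lborel :: complex measure)"
  have lin: "linear U" and norm: "norm (U x) = norm x" for x
    unfolding U_def by (rule orthonormal_isometry[OF e \<beta>])+
  have mU: "U \<in> borel_measurable borel"
    using lin by (intro borel_measurable_continuous_onI linear_continuous_on) (simp add: linear_conv_bounded_linear)
  have lb: "lborel = distr P borel V" unfolding P_def V_def by (rule lborel_complex_vec_eq_distr_PiM[OF \<beta>])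
  have mV: "V \<in> borel_measurable P"
  proof (subst borel_measurable_euclidean_space, intro ballI)
    fix b :: "complex ^ 'n" assume "b \<in> Basis"
    then obtain i u where b: "b = axis i u" by (auto simp: Basis_vec_def)
    have "\<beta> i \<in> {1..CARD('n)}" using \<beta> by (auto simp: bij_betw_def)
    then have "(\<lambda>t. t (\<beta> i)) \<in> borel_measurable P"
      using measurable_component_singleton[of "\<beta> i" "{1..CARD('n)}" "\<lambda>_. lborel :: complex measure"]
      by (simp add: P_def)
    then show "(\<lambda>t. V t \<bullet> b) \<in> borel_measurable P" unfolding b V_def inner_axis by simp
  qed
  have "(\<integral>\<^sup>+x. h x \<partial>lborel) = (\<integral>\<^sup>+x. h x \<partial>(distr lborel borel U))"
    by (simp only: lborel_distr_linear_isometry[OF lin norm])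
  also have "\<dots> = (\<integral>\<^sup>+x. h (U x) \<partial>lborel)"
    using h mU by (simp add: nn_integral_distr)
  also have "\<dots> = (\<integral>\<^sup>+x. h (U x) \<partial>(distr P borel V))" by (simp only: lb[symmetric])
  also have "\<dots> = (\<integral>\<^sup>+t. h (U (V t)) \<partial>P)"
    using h mU mV by (simp add: nn_integral_distr)
  finally show ?thesis
    unfolding P_def U_def V_def sum_reindex_coordinates[OF \<beta>] .
qed

text \<open>By homogeneity the set N < s has s^k times the volume of N < 1, where k is the real
  dimension, and the integral of s^k exp(-s) is k!. A volume can thus be read off from an integral
  that may factor.\<close>

lemma nn_integral_exp_homogeneous:
  fixes N :: "'a::euclidean_space \<Rightarrow> real"
  assumes meas [measurable]: "N \<in> borel_measurable borel" and N0: "\<And>x. 0 \<le> N x"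
    and hom: "\<And>s x. 0 < s \<Longrightarrow> N (s *\<^sub>R x) = s * N x"
  shows "(\<integral>\<^sup>+x. ennreal (exp (- N x)) \<partial>lborel) = emeasure lborel {x. N x < 1} * ennreal (fact DIM('a))"
proof -
  have scale: "emeasure lborel {x. N x < s} = ennreal (s ^ DIM('a)) * emeasure lborel {x. N x < 1}" if s: "0 < s" for s
  proof -
    have m: "(\<lambda>x::'a. 0 + s *\<^sub>R x) \<in> borel_measurable borel" by simp
    have sets: "{x. N x < s} \<in> sets borel" by measurable
    have "emeasure lborel {x. N x < s} = emeasure (density (distr lborel borel (\<lambda>x. 0 + s *\<^sub>R x)) (\<lambda>_. \<bar>s\<bar> ^ DIM('a))) {x. N x < s}"
      using lborel_affine[of s "0::'a"] s by simp
    also have "\<dots> = ennreal (s ^ DIM('a)) * emeasure (distr lborel borel (\<lambda>x. 0 + s *\<^sub>R x)) {x. N x < s}"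
      using sets s by (subst emeasure_density) (auto simp: nn_integral_cmult_indicator)
    also have "emeasure (distr lborel borel (\<lambda>x. 0 + s *\<^sub>R x)) {x. N x < s} = emeasure lborel {x. N x < 1}"
    proof -
      have "(\<lambda>x. 0 + s *\<^sub>R x) -` {x. N x < s} = {x. N x < 1}" using s by (auto simp: hom)
      then show ?thesis using m sets by (subst emeasure_distr) auto
    qed
    finally show ?thesis .
  qed
  have "(\<integral>\<^sup>+x. ennreal (exp (- N x)) \<partial>lborel)
      = (\<integral>\<^sup>+s. ennreal (exp (- s)) * indicator {0..} s * emeasure lborel {x \<in> space lborel. N x < s} \<partial>lborel)"
    by (rule nn_integral_exp_layer_cake[OF sigma_finite_lborel]) (simp_all add: N0)
  also have "\<dots> = (\<integral>\<^sup>+s. ennreal (s ^ DIM('a) * exp (- s)) * indicator {0..} s * emeasure lborel {x. N x < 1} \<partial>lborel)"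
  proof (rule nn_integral_cong)
    fix s :: real
    show "ennreal (exp (- s)) * indicator {0..} s * emeasure lborel {x \<in> space lborel. N x < s}
        = ennreal (s ^ DIM('a) * exp (- s)) * indicator {0..} s * emeasure lborel {x. N x < 1}"
    proof (cases "s > 0")
      case True
      then show ?thesis by (simp add: scale[OF True] ennreal_mult mult_ac)
    next
      case False
      have "\<not> N x < s" for x using N0[of x] False by linarith
      then have "{x \<in> space lborel. N x < s} = {}" by simp
      then show ?thesis using False by (cases "s = 0") simp_all
    qed
  qed
  also have "\<dots> = (\<integral>\<^sup>+s. ennreal (s ^ DIM('a) * exp (- s)) * indicator {0..} s \<partial>lborel) * emeasure lborel {x. N x < 1}"
    by (rule nn_integral_multc) measurable
  also have "\<dots> = ennreal (fact DIM('a)) * emeasure lborel {x. N x < 1}"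
    by (subst nn_intergal_power_times_exp_Ici) simp
  finally show ?thesis by (simp add: mult.commute)
qed

text \<open>The gauge is a sum over coordinates, so the exponential of its negative is a product and
  its integral factors. Each planar factor follows from the same homogeneity formula: the disc area
  times 2!, that is 2\<pi> d_j^2.\<close>

lemma emeasure_orthonormal_l1_ball:
  fixes e :: "nat \<Rightarrow> complex ^ 'n::finite" and d :: "nat \<Rightarrow> real"
  assumes e: "orthonormal_family CARD('n) e" and d: "\<And>j. j \<in> {1..CARD('n)} \<Longrightarrow> 0 < d j"
  shows "emeasure lborel {x. (\<Sum>j=1..CARD('n). norm (hermitian_inner x (e j)) / d j) < 1} * ennreal (fact (2 * CARD('n)))
    = ennreal ((2 * pi) ^ CARD('n) * (\<Prod>j=1..CARD('n). d j)\<^sup>2)"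
proof -
  define N where "N = (\<lambda>x. \<Sum>j=1..CARD('n). norm (hermitian_inner x (e j)) / d j)"
  have meas: "N \<in> borel_measurable borel"
    unfolding N_def by (intro borel_measurable_continuous_onI continuous_intros) (use d in force)
  have plane: "(\<integral>\<^sup>+w. ennreal (exp (- (norm (w::complex) / r))) \<partial>lborel) = ennreal (2 * pi * r\<^sup>2)" if r: "0 < r" for r
  proof -
    have "{w::complex. norm w / r < 1} = ball 0 r" using r by (auto simp: field_simps)
    then have "emeasure lborel {w::complex. norm w / r < 1} = ennreal (pi * r\<^sup>2)"
      using r by (simp add: emeasure_ball unit_ball_vol_2)
    moreover have "(\<integral>\<^sup>+w. ennreal (exp (- (norm (w::complex) / r))) \<partial>lborel)
        = emeasure lborel {w::complex. norm w / r < 1} * ennreal (fact DIM(complex))"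
      using r by (intro nn_integral_exp_homogeneous) auto
    moreover have "ennreal (pi * r\<^sup>2) * ennreal (fact DIM(complex)) = ennreal (pi * r\<^sup>2 * fact DIM(complex))"
      by (rule ennreal_mult[symmetric]) simp_all
    moreover have "pi * r\<^sup>2 * fact DIM(complex) = 2 * pi * r\<^sup>2" by simp
    ultimately show ?thesis by (simp only:)
  qed
  have "emeasure lborel {x. N x < 1} * ennreal (fact DIM(complex ^ 'n)) = (\<integral>\<^sup>+x. ennreal (exp (- N x)) \<partial>lborel)"
  proof (rule nn_integral_exp_homogeneous[symmetric, OF meas])
    show "0 \<le> N x" for x unfolding N_def by (intro sum_nonneg divide_nonneg_pos d) auto
    show "N (s *\<^sub>R x) = s * N x" if "0 < s" for s x
    proof -
      have "hermitian_inner (s *\<^sub>R x) m = of_real s * hermitian_inner x m" for m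
        by (simp add: hermitian_inner_def sum_distrib_left) (simp add: scaleR_conv_of_real mult.assoc)
      then show ?thesis using that by (simp add: N_def norm_mult sum_distrib_left)
    qed
  qed
  also have "\<dots> = (\<integral>\<^sup>+t. ennreal (exp (- N (\<Sum>j=1..CARD('n). t j *s e j))) \<partial>(PiM {1..CARD('n)} (\<lambda>_. lborel)))"
    by (rule nn_integral_orthonormal_coordinates[OF e]) (use meas in measurable)
  \<comment> \<open>With all shifts zero the triangular integration formula becomes plain
    integration of a product.\<close>
  also have "\<dots> = (\<integral>\<^sup>+t. (\<Prod>j=1..CARD('n). (\<lambda>w::complex. ennreal (exp (- (norm w / d j)))) (t j + (\<Sum>k=1..<j. 0 * t k))) \<partial>(PiM {1..CARD('n)} (\<lambda>_. lborel)))"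
  proof (rule nn_integral_cong)
    fix t :: "nat \<Rightarrow> complex"
    have "N (\<Sum>j=1..CARD('n). t j *s e j) = (\<Sum>j=1..CARD('n). norm (t j) / d j)"
      unfolding N_def by (intro sum.cong refl) (simp only: orthonormal_coordinate[OF e])
    then have "exp (- N (\<Sum>j=1..CARD('n). t j *s e j)) = (\<Prod>j=1..CARD('n). exp (- (norm (t j) / d j)))"
      by (simp add: exp_sum sum_negf[symmetric])
    then show "ennreal (exp (- N (\<Sum>j=1..CARD('n). t j *s e j)))
        = (\<Prod>j=1..CARD('n). (\<lambda>w::complex. ennreal (exp (- (norm w / d j)))) (t j + (\<Sum>k=1..<j. 0 * t k)))"
      by (simp add: prod_ennreal)
  qed
  also have "\<dots> = (\<Prod>j=1..CARD('n). \<integral>\<^sup>+w. ennreal (exp (- (norm (w::complex) / d j))) \<partial>lborel)"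
    by (rule nn_integral_triangular_product) simp
  also have "\<dots> = (\<Prod>j=1..CARD('n). ennreal (2 * pi * (d j)\<^sup>2))"
    by (intro prod.cong refl plane d)
  also have "\<dots> = ennreal (\<Prod>j=1..CARD('n). 2 * pi * (d j)\<^sup>2)"
    by (rule prod_ennreal) simp
  also have "(\<Prod>j=1..CARD('n). 2 * pi * (d j)\<^sup>2) = (2 * pi) ^ CARD('n) * (\<Prod>j=1..CARD('n). d j)\<^sup>2"
    by (simp add: prod.distrib prod_power_distrib)
  finally show ?thesis by (simp add: N_def mult.commute)
qed

section \<open>The Bergman kernel\<close>

lemma holomorphic_Cn_imp_continuous_on:
  assumes "holomorphic_Cn f D"
  shows "continuous_on D f"
proof (rule continuous_at_imp_continuous_on, intro ballI)
  fix z assume "z \<in> D"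
  then obtain f' where "(f has_derivative f') (at z)" using assms unfolding holomorphic_Cn_def by blast
  then show "isCont f z" by (rule has_derivative_continuous)
qed

lemma has_derivative_scale_vec:
  fixes z w :: "complex ^ 'n::finite"
  shows
  "((\<lambda>\<zeta>. z + \<zeta> *s w) has_derivative (\<lambda>\<zeta>. \<zeta> *s w)) (at \<zeta>0)"
proof -
  have "bounded_linear (\<lambda>\<zeta>. \<zeta> *s w)"
    unfolding linear_conv_bounded_linear[symmetric]
    by (rule linearI) (simp_all add: vector_sadd_rdistrib vec_eq_iff)
  then have "((\<lambda>\<zeta>. \<zeta> *s w) has_derivative (\<lambda>\<zeta>. \<zeta> *s w)) (at \<zeta>0)"
    by (rule bounded_linear_imp_has_derivative)
  from has_derivative_add[OF has_derivative_const[of z] this] show ?thesis by simp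
qed

lemma holomorphic_Cn_along_line:
  assumes f: "holomorphic_Cn f D" and sub: "\<And>\<zeta>. \<zeta> \<in> S \<Longrightarrow> z + \<zeta> *s w \<in> D"
  shows "(\<lambda>\<zeta>. f (z + \<zeta> *s w)) holomorphic_on S"
  unfolding holomorphic_on_def
proof
  fix \<zeta> assume \<zeta>: "\<zeta> \<in> S"
  obtain f' where f': "(f has_derivative f') (at (z + \<zeta> *s w))" "\<And>c v. f' (c *s v) = c * f' v"
    using f sub[OF \<zeta>] unfolding holomorphic_Cn_def by blast
  have "((\<lambda>\<zeta>. f (z + \<zeta> *s w)) has_derivative (\<lambda>h. f' (h *s w))) (at \<zeta>)"
    by (rule has_derivative_compose[OF has_derivative_scale_vec f'(1)])
  moreover have "(\<lambda>h. f' (h *s w)) = (*) (f' w)" by (rule ext) (simp only: f'(2) mult.commute)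
  ultimately have "((\<lambda>\<zeta>. f (z + \<zeta> *s w)) has_field_derivative f' w) (at \<zeta>)"
    by (simp add: has_field_derivative_def)
  then show "(\<lambda>\<zeta>. f (z + \<zeta> *s w)) field_differentiable at \<zeta> within S"
    using field_differentiable_def field_differentiable_at_within by blast
qed

lemma borel_measurable_norm_square_indicator:
  fixes f :: "complex ^ 'n::finite \<Rightarrow> complex"
  assumes "holomorphic_Cn f D" "open D"
  shows "(\<lambda>x. ennreal ((norm (f x))\<^sup>2) * indicator D x) \<in> borel_measurable borel"
proof -
  have "f \<in> borel_measurable (restrict_space borel D)"
    by (rule borel_measurable_continuous_on_restrict[OF holomorphic_Cn_imp_continuous_on[OF assms(1)]])
  then have "(\<lambda>x. ennreal ((norm (f x))\<^sup>2)) \<in> borel_measurable (restrict_space borel D)"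
    by measurable
  then show ?thesis using assms(2) by (subst (asm) borel_measurable_restrict_space_iff_ennreal) auto
qed

lemma norm_scale_vec: "norm (c *s x) = norm c * norm (x :: complex ^ 'n::finite)"
proof -
  have "of_real ((norm (c *s x))\<^sup>2) = c * cnj c * of_real ((norm x)\<^sup>2)"
    unfolding hermitian_inner_self[symmetric] by (simp add: hermitian_inner_scale_left hermitian_inner_scale_right)
  also have "\<dots> = of_real ((norm c * norm x)\<^sup>2)"
    by (simp add: power_mult_distrib complex_norm_square[symmetric])
  finally have "(norm (c *s x))\<^sup>2 = (norm c * norm x)\<^sup>2" by (simp only: of_real_eq_iff)
  then show ?thesis by simp
qed

text \<open>Integrate the one-variable mean value inequality on the disc \<open>z + c *s w\<close>
  over \<open>w\<close> in \<open>E\<close> and exchange the integrals. For each fixed angle,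
  rotation and translation preserve Lebesgue measure, so every angle contributes the same integral
  over \<open>D\<close>.\<close>

lemma circular_mean_norm_square:
  fixes f :: "complex ^ 'n::finite \<Rightarrow> complex"
  assumes f: "holomorphic_Cn f D" and D: "open D" and E: "E \<in> sets borel"
    and circ: "\<And>x c. x \<in> E \<Longrightarrow> norm c \<le> 1 \<Longrightarrow> z + c *s x \<in> D"
  shows "ennreal ((norm (f z))\<^sup>2) * emeasure lborel E
    \<le> (\<integral>\<^sup>+x. ennreal ((norm (f x))\<^sup>2) * indicator D x \<partial>lborel)"
proof -
  define g where "g = (\<lambda>x. ennreal ((norm (f x))\<^sup>2) * indicator D x)"
  have g [measurable]: "g \<in> borel_measurable borel"
    unfolding g_def by (rule borel_measurable_norm_square_indicator[OF f D])
  define T where "T = {0..2 * pi}"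
  have Tm [measurable]: "T \<in> sets borel" by (simp add: T_def)
  have circle: "ennreal (2 * pi * (norm (f z))\<^sup>2) * indicator E w \<le> (\<integral>\<^sup>+t. g (z + cis t *s w) * indicator T t \<partial>lborel)" for w
  proof (cases "w \<in> E")
    case True
    have "(\<lambda>\<zeta>. f (z + \<zeta> *s w)) holomorphic_on cball 0 1"
      by (rule holomorphic_Cn_along_line[OF f]) (use circ True in auto)
    from circle_mean_norm_square_ge[OF this]
    have "ennreal (2 * pi * (norm (f z))\<^sup>2) \<le> (\<integral>\<^sup>+t. ennreal ((norm (f (z + cis t *s w)))\<^sup>2) * indicator T t \<partial>lborel)"
      by (simp add: T_def)
    also have "\<dots> = (\<integral>\<^sup>+t. g (z + cis t *s w) * indicator T t \<partial>lborel)"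
      using circ[OF True] by (intro nn_integral_cong) (simp add: g_def)
    finally show ?thesis using True by simp
  qed simp
  have cm: "(\<lambda>p. z + cis (snd p) *s fst p) \<in> borel_measurable (borel \<Otimes>\<^sub>M borel)"
    unfolding borel_prod cis_conv_exp by (intro borel_measurable_continuous_onI continuous_intros)
  have rot: "(\<integral>\<^sup>+w. g (z + cis t *s w) \<partial>lborel) = (\<integral>\<^sup>+x. g x \<partial>lborel)" for t
  proof -
    have lin: "linear (\<lambda>w::complex ^ 'n. cis t *s w)"
      by (rule linearI) (simp_all add: vec_eq_iff algebra_simps)
    have cont: "(\<lambda>w::complex ^ 'n. cis t *s w) \<in> borel_measurable borel"
      by (intro borel_measurable_continuous_onI continuous_intros)
    have "(\<integral>\<^sup>+w. g (z + cis t *s w) \<partial>lborel) = (\<integral>\<^sup>+w. g (z + w) \<partial>(distr lborel borel (\<lambda>w. cis t *s w)))"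
      using cont by (subst nn_integral_distr) auto
    also have "\<dots> = (\<integral>\<^sup>+w. g (z + w) \<partial>lborel)"
      using lborel_distr_linear_isometry[OF lin] by (simp add: norm_scale_vec)
    also have "\<dots> = (\<integral>\<^sup>+x. g x \<partial>(distr lborel borel ((+) z)))"
      by (subst nn_integral_distr) auto
    also have "\<dots> = (\<integral>\<^sup>+x. g x \<partial>lborel)" by (simp only: lborel_distr_plus)
    finally show ?thesis .
  qed
  have "ennreal (2 * pi) * (ennreal ((norm (f z))\<^sup>2) * emeasure lborel E)
      = (\<integral>\<^sup>+w. ennreal (2 * pi * (norm (f z))\<^sup>2) * indicator E w \<partial>lborel)"
    using E by (subst nn_integral_cmult_indicator) (auto simp: ennreal_mult mult.assoc)
  also have "\<dots> \<le> (\<integral>\<^sup>+w. (\<integral>\<^sup>+t. g (z + cis t *s w) * indicator T t \<partial>lborel) \<partial>lborel)"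
    by (intro nn_integral_mono circle)
  also have "\<dots> = (\<integral>\<^sup>+t. (\<integral>\<^sup>+w. g (z + cis t *s w) * indicator T t \<partial>lborel) \<partial>lborel)"
  proof (rule lborel_pair.Fubini'[symmetric])
    have "(\<lambda>p. g (z + cis (snd p) *s fst p) * indicator T (snd p)) \<in> borel_measurable (borel \<Otimes>\<^sub>M borel)"
      using measurable_compose[OF cm g] by measurable
    then show "(\<lambda>(w, t). g (z + cis t *s w) * indicator T t) \<in> borel_measurable (lborel \<Otimes>\<^sub>M lborel)"
      by (simp add: split_def measurable_def space_pair_measure)
  qed
  also have "\<dots> = (\<integral>\<^sup>+t. (\<integral>\<^sup>+x. g x \<partial>lborel) * indicator T t \<partial>lborel)"
  proof (rule nn_integral_cong)
    fix t :: real
    have "(\<lambda>w. z + cis t *s w) \<in> borel_measurable borel"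
      by (intro borel_measurable_continuous_onI continuous_intros)
    then have "(\<integral>\<^sup>+w. g (z + cis t *s w) * indicator T t \<partial>lborel) = (\<integral>\<^sup>+w. g (z + cis t *s w) \<partial>lborel) * indicator T t"
      by (intro nn_integral_multc measurable_compose[OF _ g]) simp
    then show "(\<integral>\<^sup>+w. g (z + cis t *s w) * indicator T t \<partial>lborel) = (\<integral>\<^sup>+x. g x \<partial>lborel) * indicator T t"
      by (simp only: rot)
  qed
  also have "\<dots> = ennreal (2 * pi) * (\<integral>\<^sup>+x. g x \<partial>lborel)"
    by (subst nn_integral_cmult_indicator) (simp_all add: T_def mult.commute)
  finally show ?thesis
    unfolding g_def by (subst (asm) ennreal_mult_le_mult_iff) auto
qed

text \<open>Bridge between the Bochner integral over \<open>lebesgue\<close> in the norm and the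
  nonnegative integrals over \<open>lborel\<close>, in which all estimates are made.\<close>

lemma L2_norm_on_square:
  fixes f :: "complex ^ 'n::finite \<Rightarrow> complex"
  assumes "f \<in> L2h D"
  shows "(\<integral>\<^sup>+x. ennreal ((norm (f x))\<^sup>2) * indicator D x \<partial>lborel) = ennreal ((L2_norm_on D f)\<^sup>2)"
proof -
  have int: "integrable lebesgue (\<lambda>x. indicator D x *\<^sub>R (norm (f x))\<^sup>2)"
    using assms by (simp add: L2h_def set_integrable_def)
  have "(\<integral>\<^sup>+x. ennreal ((norm (f x))\<^sup>2) * indicator D x \<partial>lborel)
      = (\<integral>\<^sup>+x. ennreal (indicator D x *\<^sub>R (norm (f x))\<^sup>2) \<partial>lebesgue)"
    unfolding nn_integral_completion by (intro nn_integral_cong) (simp split: split_indicator)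
  also have "\<dots> = ennreal (\<integral>x. indicator D x *\<^sub>R (norm (f x))\<^sup>2 \<partial>lebesgue)"
    by (rule nn_integral_eq_integral[OF int]) simp
  also have "(\<integral>x. indicator D x *\<^sub>R (norm (f x))\<^sup>2 \<partial>lebesgue) = (L2_norm_on D f)\<^sup>2"
    unfolding L2_norm_on_def set_lebesgue_integral_def by (subst real_sqrt_pow2) simp_all
  finally show ?thesis .
qed

lemma L2h_memberI:
  fixes f :: "complex ^ 'n::finite \<Rightarrow> complex"
  assumes f: "holomorphic_Cn f D" and D: "open D"
    and fin: "(\<integral>\<^sup>+x. ennreal ((norm (f x))\<^sup>2) * indicator D x \<partial>lborel) < \<infinity>"
  shows "f \<in> L2h D"
proof -
  have "(\<lambda>x. enn2real (ennreal ((norm (f x))\<^sup>2) * indicator D x)) \<in> borel_measurable borel"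
    using borel_measurable_norm_square_indicator[OF f D] by measurable
  moreover have eq: "(\<lambda>x. enn2real (ennreal ((norm (f x))\<^sup>2) * indicator D x)) = (\<lambda>x. indicator D x *\<^sub>R (norm (f x))\<^sup>2)"
    by (auto simp: fun_eq_iff split: split_indicator)
  ultimately have meas: "(\<lambda>x. indicator D x *\<^sub>R (norm (f x))\<^sup>2) \<in> borel_measurable lborel" by simp
  have "integrable lborel (\<lambda>x. indicator D x *\<^sub>R (norm (f x))\<^sup>2)"
  proof (rule integrableI_bounded[OF meas])
    have "(\<integral>\<^sup>+x. ennreal (norm (indicator D x *\<^sub>R (norm (f x))\<^sup>2)) \<partial>lborel) = (\<integral>\<^sup>+x. ennreal ((norm (f x))\<^sup>2) * indicator D x \<partial>lborel)"
      by (intro nn_integral_cong) (simp split: split_indicator)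
    then show "(\<integral>\<^sup>+x. ennreal (norm (indicator D x *\<^sub>R (norm (f x))\<^sup>2)) \<partial>lborel) < \<infinity>" using fin by simp
  qed
  then have "integrable lebesgue (\<lambda>x. indicator D x *\<^sub>R (norm (f x))\<^sup>2)"
    using integrable_completion[OF meas] by simp
  then show ?thesis using f by (simp add: L2h_def set_integrable_def)
qed

lemma holomorphic_Cn_const: "holomorphic_Cn (\<lambda>_. c) D"
  unfolding holomorphic_Cn_def
proof
  fix z assume "z \<in> D"
  show "\<exists>f'. ((\<lambda>_. c) has_derivative f') (at z) \<and> (\<forall>c v. f' (c *s v) = c * f' v)"
    by (rule exI[of _ "\<lambda>_. 0"]) simp
qed

lemma holomorphic_Cn_mult:
  assumes "holomorphic_Cn f D" "holomorphic_Cn g D"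
  shows "holomorphic_Cn (\<lambda>x. f x * g x) D"
  unfolding holomorphic_Cn_def
proof
  fix z assume z: "z \<in> D"
  obtain f' where f': "(f has_derivative f') (at z)" "\<And>c v. f' (c *s v) = c * f' v"
    using assms(1) z unfolding holomorphic_Cn_def by blast
  obtain g' where g': "(g has_derivative g') (at z)" "\<And>c v. g' (c *s v) = c * g' v"
    using assms(2) z unfolding holomorphic_Cn_def by blast
  show "\<exists>h'. ((\<lambda>x. f x * g x) has_derivative h') (at z) \<and> (\<forall>c v. h' (c *s v) = c * h' v)"
    by (intro exI conjI, rule has_derivative_mult[OF f'(1) g'(1)])
      (simp add: f'(2) g'(2) algebra_simps)
qed

lemma holomorphic_Cn_prod:
  assumes "\<And>i. i \<in> I \<Longrightarrow> holomorphic_Cn (f i) D"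
  shows "holomorphic_Cn (\<lambda>x. \<Prod>i\<in>I. f i x) D"
  using assms
  by (induction I rule: infinite_finite_induct) (simp_all add: holomorphic_Cn_const holomorphic_Cn_mult)

lemma holomorphic_Cn_compose_functional:
  fixes D :: "(complex ^ 'n::finite) set"
  assumes F: "F holomorphic_on G" and G: "open G" and im: "\<And>x. x \<in> D \<Longrightarrow> hermitian_inner (x - z) m \<in> G"
  shows "holomorphic_Cn (\<lambda>x. F (hermitian_inner (x - z) m)) D"
  unfolding holomorphic_Cn_def
proof
  fix x assume x: "x \<in> D"
  have "bounded_linear (\<lambda>v::complex ^ 'n. hermitian_inner v m)"
    unfolding linear_conv_bounded_linear[symmetric]
  proof (rule linearI)
    show "hermitian_inner (x + y) m = hermitian_inner x m + hermitian_inner y m" for x y :: "complex ^ 'n"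
      by (rule hermitian_inner_add_left)
    show "hermitian_inner (r *\<^sub>R x) m = r *\<^sub>R hermitian_inner x m" for r and x :: "complex ^ 'n"
      by (simp add: hermitian_inner_def scaleR_sum_right)
  qed
  then have "((\<lambda>x. hermitian_inner (x - z) m) has_derivative (\<lambda>v. hermitian_inner v m)) (at x)"
    by (rule bounded_linear.has_derivative) (auto intro!: derivative_eq_intros)
  moreover have "(F has_derivative (*) (deriv F (hermitian_inner (x - z) m))) (at (hermitian_inner (x - z) m))"
    using holomorphic_derivI[OF F G im[OF x]] by (simp add: has_field_derivative_def)
  ultimately have "((\<lambda>x. F (hermitian_inner (x - z) m)) has_derivative
      (\<lambda>v. deriv F (hermitian_inner (x - z) m) * hermitian_inner v m)) (at x)"
    by (rule has_derivative_compose)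
  then show "\<exists>f'. ((\<lambda>x. F (hermitian_inner (x - z) m)) has_derivative f') (at x) \<and> (\<forall>c v. f' (c *s v) = c * f' v)"
    by (intro exI conjI) (assumption, simp add: hermitian_inner_scale_left)
qed

section \<open>Nearest boundary points and their orthonormal frame\<close>

lemma mem_nest_H_iff:
  "w \<in> nest_H z a j \<longleftrightarrow> (\<forall>k\<in>{1..j}. hermitian_inner w (a k - z) = 0)"
proof (induction j)
  case (Suc j)
  have "w \<in> hermitian_compl (complex_span1 v) \<longleftrightarrow> hermitian_inner w v = 0" for v
  proof
    assume "w \<in> hermitian_compl (complex_span1 v)"
    moreover have "v \<in> complex_span1 v" unfolding complex_span1_def by (rule CollectI, rule exI[of _ 1]) simp
    ultimately show "hermitian_inner w v = 0" by (simp add: hermitian_compl_def)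
  qed (auto simp: hermitian_compl_def complex_span1_def hermitian_inner_scale_right)
  moreover have "{1..Suc j} = insert (Suc j) {1..j}" by auto
  ultimately show ?case using Suc by simp
qed simp

lemma nest_D_eq: "nest_D D z a j = D \<inter> (+) z ` nest_H z a j"
  by (induction j) auto

text \<open>The slice is relatively open, so its relative frontier point \<open>a j\<close> lies
  outside \<open>D\<close>. A segment inside the slice's affine space that leaves \<open>D\<close>
  crosses the relative frontier, which is impossible within distance less than
  \<open>nest_d D z a j\<close>; this gives the ball.\<close>

lemma nearest_choice_properties:
  fixes D :: "(complex ^ 'n::finite) set"
  assumes D: "open D" and z: "z \<in> D" and a: "nearest_choice D z a"
    and j: "j \<in> {1..CARD('n)}"
  shows nearest_choice_notin: "a j \<notin> D"
    and nearest_choice_mem_H: "a j - z \<in> nest_H z a (j - 1)"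
    and nearest_choice_norm: "norm (a j - z) = nest_d D z a j"
    and nearest_choice_pos: "0 < nest_d D z a j"
    and nearest_choice_ball: "v \<in> nest_H z a (j - 1) \<Longrightarrow> norm v < nest_d D z a j \<Longrightarrow> z + v \<in> D"
proof -
  define A where "A = (+) z ` nest_H z a (j - 1)"
  define S where "S = nest_D D z a (j - 1)"
  have S: "S = D \<inter> A" unfolding S_def A_def by (rule nest_D_eq)
  have aj: "a j \<in> top_of_set A frontier_of S" and nrm: "norm (a j - z) = nest_d D z a j"
    using a j by (auto simp: nearest_choice_def nest_bd_def A_def S_def)
  have "a j \<in> A" using aj frontier_of_subset_topspace by fastforce
  have opS: "openin (top_of_set A) S" unfolding S using D by (simp add: openin_open_Int Int_commute)
  then have "a j \<notin> S" using aj by (simp add: frontier_of_def interior_of_openin)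
  then show notin: "a j \<notin> D" using \<open>a j \<in> A\<close> S by blast
  show "a j - z \<in> nest_H z a (j - 1)" using \<open>a j \<in> A\<close> by (auto simp: A_def)
  show "norm (a j - z) = nest_d D z a j" by (rule nrm)
  have "a j \<noteq> z" using notin z by blast
  then show "0 < nest_d D z a j" using nrm by (metis right_minus_eq zero_less_norm_iff)
  assume v: "v \<in> nest_H z a (j - 1)" "norm v < nest_d D z a j"
  have sH: "c *s w \<in> nest_H z a (j - 1)" if "w \<in> nest_H z a (j - 1)" for c w
    using that by (simp add: mem_nest_H_iff hermitian_inner_scale_left)
  show "z + v \<in> D"
  proof (rule ccontr)
    assume no: "z + v \<notin> D"
    define L where "L = (\<lambda>t::real. z + t *\<^sub>R v) ` {0..1}"
    have LA: "L \<subseteq> A"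
    proof
      fix x assume "x \<in> L"
      then obtain t :: real where t: "x = z + t *\<^sub>R v" by (auto simp: L_def)
      have "t *\<^sub>R v = of_real t *s v" by (simp add: vec_eq_iff) (simp add: scaleR_conv_of_real)
      then show "x \<in> A" unfolding t A_def using sH[OF v(1)] by simp
    qed
    have "connected L" unfolding L_def by (intro connected_continuous_image continuous_intros) simp
    then have "connectedin (top_of_set A) L" using LA by (simp add: connectedin_subtopology)
    moreover have "z \<in> L" "z + v \<in> L" by (auto simp: L_def intro: image_eqI[of _ _ 0] image_eqI[of _ _ 1])
    then have "L \<inter> S \<noteq> {}" "L - S \<noteq> {}" using no z LA unfolding S by blast+
    ultimately have "L \<inter> top_of_set A frontier_of S \<noteq> {}" by (rule connectedin_Int_frontier_of)
    then obtain q where q: "q \<in> L" "q \<in> top_of_set A frontier_of S" by blast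
    then obtain t where t: "0 \<le> t" "t \<le> 1" "q = z + t *\<^sub>R v" by (auto simp: L_def)
    have "nest_d D z a j \<le> dist z q"
      unfolding nest_d_def nest_bd_def using q(2) unfolding A_def S_def by (rule infdist_le)
    also have "dist z q = t * norm v" using t by (simp add: dist_norm)
    also have "\<dots> \<le> 1 * norm v" using t by (intro mult_right_mono) auto
    finally show False using v(2) by simp
  qed
qed

definition nearest_frame :: "complex ^ 'n::finite \<Rightarrow> (nat \<Rightarrow> complex ^ 'n) \<Rightarrow> nat \<Rightarrow> complex ^ 'n" where
  "nearest_frame z a j = of_real (inverse (norm (a j - z))) *s (a j - z)"

text \<open>Orthogonality is built into the choice: \<open>a i - z\<close> lies in the subspace
  orthogonal to all earlier directions, so only normalisation remains.\<close>

lemma nearest_frame_orthonormal: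
  fixes D :: "(complex ^ 'n::finite) set"
  assumes D: "open D" and z: "z \<in> D" and a: "nearest_choice D z a"
  shows "orthonormal_family CARD('n) (nearest_frame z a)"
proof -
  note props = nearest_choice_properties[OF D z a]
  have self: "hermitian_inner (nearest_frame z a j) (nearest_frame z a j) = 1" if j: "j \<in> {1..CARD('n)}" for j
  proof -
    have "norm (a j - z) > 0" using props(3,4)[OF j] by simp
    then have "norm (nearest_frame z a j) = 1"
      unfolding nearest_frame_def norm_scale_vec by (simp add: norm_inverse)
    then show ?thesis by (simp add: hermitian_inner_self)
  qed
  have lt: "hermitian_inner (nearest_frame z a i) (nearest_frame z a j) = 0"
    if "i \<in> {1..CARD('n)}" "j \<in> {1..CARD('n)}" "j < i" for i j
  proof -
    have "hermitian_inner (a i - z) (a j - z) = 0"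
      using props(2)[OF that(1)] that by (simp add: mem_nest_H_iff)
    then show ?thesis
      unfolding nearest_frame_def by (simp only: hermitian_inner_scale_left hermitian_inner_scale_right) simp
  qed
  have gt: "hermitian_inner (nearest_frame z a i) (nearest_frame z a j) = 0"
    if "i \<in> {1..CARD('n)}" "j \<in> {1..CARD('n)}" "i < j" for i j
  proof -
    have "cnj (hermitian_inner (nearest_frame z a j) (nearest_frame z a i)) = 0"
      using lt[OF that(2,1,3)] by simp
    then show ?thesis by (simp only: hermitian_inner_cnj)
  qed
  show ?thesis
    unfolding orthonormal_family_def
  proof (intro ballI)
    fix i j assume ij: "i \<in> {1..CARD('n)}" "j \<in> {1..CARD('n)}"
    show "hermitian_inner (nearest_frame z a i) (nearest_frame z a j) = (if i = j then 1 else 0)"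
      using self[OF ij(1)] lt[OF ij] gt[OF ij] by (cases i j rule: linorder_cases) auto
  qed
qed

lemma nearest_frame_mem_H:
  fixes D :: "(complex ^ 'n::finite) set"
  assumes D: "open D" and z: "z \<in> D" and a: "nearest_choice D z a"
    and k: "k \<in> {1..CARD('n)}" and j: "j \<in> {1..k}"
  shows "nearest_frame z a k \<in> nest_H z a (j - 1)"
proof -
  have "a k - z \<in> nest_H z a (k - 1)" by (rule nearest_choice_mem_H[OF D z a k])
  then have "hermitian_inner (a k - z) (a i - z) = 0" if "i \<in> {1..j - 1}" for i
    using that j by (auto simp: mem_nest_H_iff)
  then show ?thesis
    unfolding mem_nest_H_iff nearest_frame_def hermitian_inner_scale_left by simp
qed

text \<open>The hyperplane through \<open>a\<^sub>j\<close> missing \<open>D\<close> is tangent to the ball contained in the slice, so within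
  that slice its equation is determined: this gives the triangular structure.\<close>

lemma nearest_supporting_functional:
  fixes D :: "(complex ^ 'n::finite) set"
  assumes D: "open D" "C_convex D" and z: "z \<in> D" and a: "nearest_choice D z a"
    and j: "j \<in> {1..CARD('n)}"
  shows "\<exists>m. (\<forall>x\<in>D. hermitian_inner (x - z) m \<noteq> of_real (nest_d D z a j)) \<and>
    hermitian_inner (nearest_frame z a j) m = 1 \<and>
    (\<forall>k\<in>{j<..CARD('n)}. hermitian_inner (nearest_frame z a k) m = 0)"
proof -
  define d where "d = nest_d D z a j"
  define e where "e = nearest_frame z a"
  note props = nearest_choice_properties[OF D(1) z a j]
  have d: "d > 0" "norm (a j - z) = d" using props(3,4) by (auto simp: d_def)
  have orth: "orthonormal_family CARD('n) e" unfolding e_def by (rule nearest_frame_orthonormal[OF D(1) z a])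
  have u: "a j - z = of_real d *s e j" using d by (simp add: e_def nearest_frame_def vec_eq_iff)
  have "D \<noteq> {}" using z by blast
  then obtain m0 where m0: "\<And>x. x \<in> D \<Longrightarrow> hermitian_inner (x - a j) m0 \<noteq> 0"
    using C_convex_imp_linearly_convex[OF D _ props(1)] by metis
  define c where "c = hermitian_inner (e j) m0"
  have u0: "hermitian_inner (a j - z) m0 = of_real d * c"
    unfolding u c_def by (rule hermitian_inner_scale_left)
  have "hermitian_inner (z - a j) m0 = - hermitian_inner (a j - z) m0"
    by (simp add: hermitian_inner_diff_left)
  then have c: "c \<noteq> 0" using m0[OF z] u0 by auto
  \<comment> \<open>Rescaled to value 1 on \<open>e j\<close>; the conjugate appears because the
    form is conjugate-linear in its second argument.\<close>
  define m where "m = inverse (cnj c) *s m0"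
  have m: "hermitian_inner x m = hermitian_inner x m0 / c" for x
    unfolding m_def hermitian_inner_scale_right by (simp add: divide_inverse mult.commute)
  have ne: "hermitian_inner (x - z) m \<noteq> of_real d" if "x \<in> D" for x
  proof
    assume "hermitian_inner (x - z) m = of_real d"
    then have "hermitian_inner (x - z) m0 = of_real d * c" using c by (simp add: m field_simps)
    moreover have "hermitian_inner (x - a j) m0 = hermitian_inner (x - z) m0 - hermitian_inner (a j - z) m0"
      by (simp add: hermitian_inner_diff_left)
    ultimately show False using m0[OF that] u0 by simp
  qed
  have ej: "hermitian_inner (e j) m = 1" using c by (simp add: m c_def)
  have "hermitian_inner (e k) m = 0" if k: "k \<in> {j<..CARD('n)}" for k
  proof (rule ccontr)
    define b where "b = hermitian_inner (e k) m"
    assume "hermitian_inner (e k) m \<noteq> 0"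
    then have b: "norm b > 0" by (simp add: b_def)
    have k': "k \<in> {1..CARD('n)}" "j \<in> {1..k}" using k j by auto
    \<comment> \<open>With this \<open>s\<close>, \<open>w\<close> is the point nearest to the
      origin, in the span of \<open>e j\<close> and \<open>e k\<close>, at which the functional
      equals \<open>d\<close>. Its norm is d / sqrt(1 + |b|^2), so for nonzero \<open>b\<close> it
      falls strictly inside the ball of the slice, although the hyperplane misses
      \<open>D\<close>.\<close>
    define s where "s = d / (1 + (norm b)\<^sup>2)"
    define w where "w = of_real s *s (e j + cnj b *s e k)"
    have s: "s > 0" using d b by (simp add: s_def add_pos_nonneg)
    have "hermitian_inner (e j + cnj b *s e k) (e j + cnj b *s e k) = of_real (1 + (norm b)\<^sup>2)"
    proof -
      have h: "hermitian_inner (e j) (e j) = 1" "hermitian_inner (e k) (e k) = 1"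
        "hermitian_inner (e j) (e k) = 0" "hermitian_inner (e k) (e j) = 0"
        using orth k k'(1) j by (auto simp: orthonormal_family_def)
      have "hermitian_inner (e j + cnj b *s e k) x = hermitian_inner (e j) x + cnj b * hermitian_inner (e k) x" for x
        by (simp add: hermitian_inner_add_left hermitian_inner_scale_left)
      moreover have "hermitian_inner x (e j + cnj b *s e k) = hermitian_inner x (e j) + b * hermitian_inner x (e k)" for x
        using hermitian_inner_sum_right[of x "\<lambda>i. if i = j then 1 else cnj b" e "{j, k}"] k by simp
      ultimately show ?thesis using complex_norm_square[of b] by (simp add: h mult.commute)
    qed
    then have "(norm (e j + cnj b *s e k))\<^sup>2 = 1 + (norm b)\<^sup>2" unfolding hermitian_inner_self of_real_eq_iff .
    then have nw: "(norm w)\<^sup>2 = s\<^sup>2 * (1 + (norm b)\<^sup>2)"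
      unfolding w_def norm_scale_vec by (simp add: power_mult_distrib)
    have "w \<in> nest_H z a (j - 1)"
      unfolding mem_nest_H_iff
    proof
      fix i assume i: "i \<in> {1..j - 1}"
      have "e k \<in> nest_H z a (j - 1)"
        unfolding e_def by (rule nearest_frame_mem_H[OF D(1) z a k'])
      moreover have "e j \<in> nest_H z a (j - 1)"
        unfolding e_def by (rule nearest_frame_mem_H[OF D(1) z a j]) (use j in simp)
      ultimately have "hermitian_inner (e k) (a i - z) = 0" "hermitian_inner (e j) (a i - z) = 0"
        using i by (auto simp: mem_nest_H_iff)
      then show "hermitian_inner w (a i - z) = 0"
        by (simp only: w_def hermitian_inner_scale_left hermitian_inner_add_left) simp
    qed
    moreover have "norm w < d"
    proof (rule power2_less_imp_less)
      have pos: "1 + (norm b)\<^sup>2 > 1" using b by simp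
      have "(norm w)\<^sup>2 = d\<^sup>2 / (1 + (norm b)\<^sup>2)"
      proof -
        have "(d / q)\<^sup>2 * q = d\<^sup>2 / q" if "q > 0" for q :: real
          using that by (simp add: power2_eq_square)
        from this[of "1 + (norm b)\<^sup>2"] show ?thesis unfolding nw s_def using pos by linarith
      qed
      also have "\<dots> < d\<^sup>2 / 1"
      proof (rule divide_strict_left_mono[OF pos])
        show "0 < d\<^sup>2" using d(1) by simp
        show "0 < (1 + (norm b)\<^sup>2) * 1" by (simp add: add_pos_nonneg)
      qed
      also have "d\<^sup>2 / 1 = d\<^sup>2" by simp
      finally show "(norm w)\<^sup>2 < d\<^sup>2" .
    qed (use d in simp)
    ultimately have "z + w \<in> D" using props(5) by (simp add: d_def)
    moreover have "hermitian_inner (z + w - z) m = of_real d"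
    proof -
      have pos: "1 + (norm b)\<^sup>2 > 0" by (simp add: add_pos_nonneg)
      have "hermitian_inner w m = of_real s * (1 + cnj b * b)"
        by (simp only: w_def hermitian_inner_scale_left hermitian_inner_add_left ej b_def[symmetric])
      also have "1 + cnj b * b = of_real (1 + (norm b)\<^sup>2)"
        using complex_norm_square[of b] by (simp add: mult.commute)
      also have "of_real s * of_real (1 + (norm b)\<^sup>2) = (of_real (s * (1 + (norm b)\<^sup>2)) :: complex)" by simp
      also have "s * (1 + (norm b)\<^sup>2) = d" using pos by (simp add: s_def)
      finally show ?thesis by simp
    qed
    ultimately show False using ne by blast
  qed
  then show ?thesis using ne ej unfolding d_def e_def by blast
qed

text \<open>If \<open>z + x\<close> were outside, a hyperplane through it would miss
  \<open>D\<close>, with functional \<open>m\<close>. The discs in \<open>D\<close> force |m(e_j)|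
  <= |m(x)| / d_j, and expanding \<open>x\<close> in the frame yields |m(x)| < |m(x)|.\<close>

lemma l1_ball_subset_C_convex:
  fixes D :: "(complex ^ 'n::finite) set"
  assumes D: "open D" "C_convex D" and z: "z \<in> D"
    and e: "orthonormal_family CARD('n) e" and d: "\<And>j. j \<in> {1..CARD('n)} \<Longrightarrow> 0 < d j"
    and disc: "\<And>j \<zeta>. j \<in> {1..CARD('n)} \<Longrightarrow> norm \<zeta> < d j \<Longrightarrow> z + \<zeta> *s e j \<in> D"
    and x: "(\<Sum>j=1..CARD('n). norm (hermitian_inner x (e j)) / d j) < 1"
  shows "z + x \<in> D"
proof (rule ccontr)
  assume "z + x \<notin> D"
  moreover have "D \<noteq> {}" using z by blast
  ultimately obtain m where m: "\<And>y. y \<in> D \<Longrightarrow> hermitian_inner (y - (z + x)) m \<noteq> 0"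
    using C_convex_imp_linearly_convex[OF D] by metis
  define \<mu> where "\<mu> = norm (hermitian_inner x m)"
  have "hermitian_inner (z - (z + x)) m = - hermitian_inner x m"
    by (simp only: hermitian_inner_diff_left hermitian_inner_add_left) simp
  then have \<mu>0: "\<mu> > 0" using m[OF z] by (simp add: \<mu>_def)
  have bound: "norm (hermitian_inner (e j) m) \<le> \<mu> / d j" if j: "j \<in> {1..CARD('n)}" for j
  proof (rule ccontr)
    assume "\<not> ?thesis"
    then have gt: "\<mu> / d j < norm (hermitian_inner (e j) m)" by simp
    then have nz: "hermitian_inner (e j) m \<noteq> 0" using \<mu>0 d[OF j] by (auto simp: divide_less_0_iff)
    \<comment> \<open>The parameter at which the complex line through \<open>z\<close> in direction
      \<open>e j\<close> meets the hyperplane; it would lie inside the disc contained in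
      \<open>D\<close>.\<close>
    define \<zeta> where "\<zeta> = hermitian_inner x m / hermitian_inner (e j) m"
    have "norm \<zeta> < d j" using gt nz d[OF j] by (simp add: \<zeta>_def norm_divide \<mu>_def[symmetric] field_simps)
    then have "z + \<zeta> *s e j \<in> D" by (rule disc[OF j])
    moreover have "hermitian_inner (z + \<zeta> *s e j - (z + x)) m = \<zeta> * hermitian_inner (e j) m - hermitian_inner x m"
      by (simp add: hermitian_inner_diff_left hermitian_inner_add_left hermitian_inner_scale_left)
    moreover have "\<dots> = 0" using nz by (simp add: \<zeta>_def)
    ultimately show False using m by metis
  qed
  have "\<mu> = norm (\<Sum>j=1..CARD('n). hermitian_inner x (e j) * hermitian_inner (e j) m)"
    unfolding \<mu>_def by (subst orthonormal_expansion[OF e, of x]) (simp only: hermitian_inner_sum_left)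
  also have "\<dots> \<le> (\<Sum>j=1..CARD('n). norm (hermitian_inner x (e j)) * norm (hermitian_inner (e j) m))"
    by (rule order_trans[OF norm_sum]) (simp add: norm_mult)
  also have "\<dots> \<le> (\<Sum>j=1..CARD('n). norm (hermitian_inner x (e j)) / d j * \<mu>)"
  proof (rule sum_mono)
    fix j assume j: "j \<in> {1..CARD('n)}"
    have "norm (hermitian_inner x (e j)) * norm (hermitian_inner (e j) m) \<le> norm (hermitian_inner x (e j)) * (\<mu> / d j)"
      by (intro mult_left_mono bound[OF j]) simp
    then show "norm (hermitian_inner x (e j)) * norm (hermitian_inner (e j) m) \<le> norm (hermitian_inner x (e j)) / d j * \<mu>"
      by (simp add: mult.commute)
  qed
  also have "\<dots> = (\<Sum>j=1..CARD('n). norm (hermitian_inner x (e j)) / d j) * \<mu>"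
    by (simp only: sum_distrib_right)
  also have "\<dots> < 1 * \<mu>" by (rule mult_strict_right_mono[OF x \<mu>0])
  finally show False by simp
qed

section \<open>Bounds for the Bergman kernel\<close>

lemma Bergman_kernel_upper:
  fixes D :: "(complex ^ 'n::finite) set"
  assumes D: "open D" "C_convex D" and z: "z \<in> D" and a: "nearest_choice D z a"
  shows "Bergman_kernel D z * ennreal ((p_D D z a)\<^sup>2) \<le> ennreal (fact (2 * CARD('n)) / (2 * pi) ^ CARD('n))"
proof -
  define d where "d = nest_d D z a"
  define e where "e = nearest_frame z a"
  define E where "E = {x. (\<Sum>j=1..CARD('n). norm (hermitian_inner x (e j)) / d j) < 1}"
  define V where "V = emeasure lborel E"
  have p: "p_D D z a = (\<Prod>j=1..CARD('n). d j)" by (simp add: p_D_def d_def)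
  have orth: "orthonormal_family CARD('n) e" unfolding e_def by (rule nearest_frame_orthonormal[OF D(1) z a])
  have d: "0 < d j" if "j \<in> {1..CARD('n)}" for j
    unfolding d_def by (rule nearest_choice_pos[OF D(1) z a that])
  have ppos: "0 < p_D D z a" unfolding p by (intro prod_pos ballI d)
  have disc: "z + \<zeta> *s e j \<in> D" if j: "j \<in> {1..CARD('n)}" and \<zeta>: "norm \<zeta> < d j" for j \<zeta>
  proof (rule nearest_choice_ball[OF D(1) z a j])
    have "e j \<in> nest_H z a (j - 1)" unfolding e_def using j by (intro nearest_frame_mem_H[OF D(1) z a]) auto
    then show "\<zeta> *s e j \<in> nest_H z a (j - 1)" by (simp add: mem_nest_H_iff hermitian_inner_scale_left)
    have "hermitian_inner (e j) (e j) = 1" using orth j by (simp add: orthonormal_family_def)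
    then have "(norm (e j))\<^sup>2 = 1" unfolding hermitian_inner_self by (simp only: of_real_eq_1_iff)
    then have "norm (e j) = 1" using norm_ge_zero[of "e j"] by (auto simp: power2_eq_1_iff)
    then show "norm (\<zeta> *s e j) < nest_d D z a j" using \<zeta> by (simp add: norm_scale_vec d_def)
  qed
  have E: "E \<in> sets borel"
  proof -
    have "open E" unfolding E_def by (intro open_Collect_less continuous_intros) (use d in force)
    then show ?thesis by simp
  qed
  \<comment> \<open>The gauge scales by |c|, so \<open>E\<close> is balanced; the mean value
    argument uses the whole closed disc through each of its points.\<close>
  have circ: "z + c *s x \<in> D" if x: "x \<in> E" and c: "norm c \<le> 1" for x c
  proof (rule l1_ball_subset_C_convex[OF D z orth d disc])
    have "(\<Sum>j=1..CARD('n). norm (hermitian_inner (c *s x) (e j)) / d j) = norm c * (\<Sum>j=1..CARD('n). norm (hermitian_inner x (e j)) / d j)"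
      by (simp add: hermitian_inner_scale_left norm_mult sum_distrib_left)
    also have "\<dots> \<le> 1 * (\<Sum>j=1..CARD('n). norm (hermitian_inner x (e j)) / d j)"
      by (intro mult_right_mono c sum_nonneg divide_nonneg_pos d) auto
    also have "\<dots> < 1" using x by (simp add: E_def)
    finally show "(\<Sum>j=1..CARD('n). norm (hermitian_inner (c *s x) (e j)) / d j) < 1" .
  qed
  have vol: "V * ennreal (fact (2 * CARD('n))) = ennreal ((2 * pi) ^ CARD('n) * (p_D D z a)\<^sup>2)"
    unfolding V_def E_def p by (rule emeasure_orthonormal_l1_ball[OF orth d])
  have "ennreal ((norm (f z))\<^sup>2) \<le> ennreal (fact (2 * CARD('n)) / ((2 * pi) ^ CARD('n) * (p_D D z a)\<^sup>2))"
    if f: "f \<in> L2h D" "L2_norm_on D f \<le> 1" for f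
  proof -
    have hol: "holomorphic_Cn f D" using f(1) by (simp add: L2h_def)
    have "ennreal ((norm (f z))\<^sup>2) * V \<le> (\<integral>\<^sup>+x. ennreal ((norm (f x))\<^sup>2) * indicator D x \<partial>lborel)"
      unfolding V_def by (rule circular_mean_norm_square[OF hol D(1) E circ])
    also have "\<dots> = ennreal ((L2_norm_on D f)\<^sup>2)" by (rule L2_norm_on_square[OF f(1)])
    also have "\<dots> \<le> ennreal 1"
    proof (rule ennreal_leI)
      have "0 \<le> L2_norm_on D f"
        unfolding L2_norm_on_def set_lebesgue_integral_def by (intro real_sqrt_ge_zero Bochner_Integration.integral_nonneg) simp
      then show "(L2_norm_on D f)\<^sup>2 \<le> 1" using f(2) by (simp add: power_le_one)
    qed
    \<comment> \<open>Multiplying by (2n)! replaces the volume by its closed form without a division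
      in \<open>ennreal\<close>.\<close>
    finally have "ennreal ((norm (f z))\<^sup>2) * V * ennreal (fact (2 * CARD('n))) \<le> ennreal 1 * ennreal (fact (2 * CARD('n)))"
      by (intro mult_right_mono) auto
    then have "ennreal ((norm (f z))\<^sup>2 * ((2 * pi) ^ CARD('n) * (p_D D z a)\<^sup>2)) \<le> ennreal (fact (2 * CARD('n)))"
      unfolding mult.assoc vol by (simp only: ennreal_mult[symmetric] zero_le_power2 ennreal_1 mult_1)
        (simp add: ennreal_mult[symmetric])
    then have "(norm (f z))\<^sup>2 * ((2 * pi) ^ CARD('n) * (p_D D z a)\<^sup>2) \<le> fact (2 * CARD('n))"
      by (subst (asm) ennreal_le_iff) simp_all
    then show ?thesis
      using ppos by (intro ennreal_leI) (subst pos_le_divide_eq, simp_all)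
  qed
  then have "Bergman_kernel D z \<le> ennreal (fact (2 * CARD('n)) / ((2 * pi) ^ CARD('n) * (p_D D z a)\<^sup>2))"
    unfolding Bergman_kernel_def by (intro SUP_least) auto
  then have "Bergman_kernel D z * ennreal ((p_D D z a)\<^sup>2)
      \<le> ennreal (fact (2 * CARD('n)) / ((2 * pi) ^ CARD('n) * (p_D D z a)\<^sup>2)) * ennreal ((p_D D z a)\<^sup>2)"
    by (intro mult_right_mono) auto
  also have "\<dots> = ennreal (fact (2 * CARD('n)) / ((2 * pi) ^ CARD('n) * (p_D D z a)\<^sup>2) * (p_D D z a)\<^sup>2)"
    by (rule ennreal_mult[symmetric]) auto
  also have "fact (2 * CARD('n)) / ((2 * pi) ^ CARD('n) * (p_D D z a)\<^sup>2) * (p_D D z a)\<^sup>2 = fact (2 * CARD('n)) / (2 * pi) ^ CARD('n)"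
    using ppos by simp
  finally show ?thesis .
qed

lemma Bergman_kernel_lower:
  fixes D :: "(complex ^ 'n::finite) set"
  assumes D: "open D" "C_convex D" and z: "z \<in> D" and a: "nearest_choice D z a"
  shows "ennreal (1 / (16 * pi) ^ CARD('n)) \<le> Bergman_kernel D z * ennreal ((p_D D z a)\<^sup>2)"
proof -
  define d where "d = nest_d D z a"
  define e where "e = nearest_frame z a"
  have p: "p_D D z a = (\<Prod>j=1..CARD('n). d j)" by (simp add: p_D_def d_def)
  have orth: "orthonormal_family CARD('n) e" unfolding e_def by (rule nearest_frame_orthonormal[OF D(1) z a])
  have d: "0 < d j" if "j \<in> {1..CARD('n)}" for j
    unfolding d_def by (rule nearest_choice_pos[OF D(1) z a that])
  have ppos: "0 < p_D D z a" unfolding p by (intro prod_pos ballI d)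
  have "\<forall>j\<in>{1..CARD('n)}. \<exists>m. (\<forall>x\<in>D. hermitian_inner (x - z) m \<noteq> of_real (d j)) \<and>
      hermitian_inner (e j) m = 1 \<and> (\<forall>k\<in>{j<..CARD('n)}. hermitian_inner (e k) m = 0)"
    unfolding d_def e_def using nearest_supporting_functional[OF D z a] by (intro ballI)
  then obtain m where "\<forall>j\<in>{1..CARD('n)}. (\<forall>x\<in>D. hermitian_inner (x - z) (m j) \<noteq> of_real (d j)) \<and>
      hermitian_inner (e j) (m j) = 1 \<and> (\<forall>k\<in>{j<..CARD('n)}. hermitian_inner (e k) (m j) = 0)"
    by (rule bchoice[THEN exE])
  then have m: "\<And>j x. j \<in> {1..CARD('n)} \<Longrightarrow> x \<in> D \<Longrightarrow> hermitian_inner (x - z) (m j) \<noteq> of_real (d j)"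
    "\<And>j. j \<in> {1..CARD('n)} \<Longrightarrow> hermitian_inner (e j) (m j) = 1"
    "\<And>j k. j \<in> {1..CARD('n)} \<Longrightarrow> k \<in> {j<..CARD('n)} \<Longrightarrow> hermitian_inner (e k) (m j) = 0"
    by simp_all
  \<comment> \<open>Each image contains 0, coming from \<open>z\<close>, and omits
    \<open>d j\<close>; the planar estimate then supplies the factor 16\<pi> d_j^2.\<close>
  define G where "G = (\<lambda>j. (\<lambda>x. hermitian_inner (x - z) (m j)) ` D)"
  have G: "open (G j) \<and> simply_connected (G j)" if j: "j \<in> {1..CARD('n)}" for j
  proof -
    have aff: "complex_affine UNIV" by (simp add: complex_affine_def)
    have "open ((\<lambda>x. hermitian_inner x (m j)) ` (D \<inter> UNIV))" "simply_connected ((\<lambda>x. hermitian_inner x (m j)) ` (D \<inter> UNIV))"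
      by (rule functional_image_C_convex[OF D aff UNIV_I m(2)[OF j]])+
    moreover have "G j = (+) (- hermitian_inner z (m j)) ` (\<lambda>x. hermitian_inner x (m j)) ` (D \<inter> UNIV)"
      unfolding G_def image_image by (simp add: hermitian_inner_diff_left)
    ultimately show ?thesis
      using open_translation homeomorphic_simply_connected_eq homeomorphic_translation by (metis (no_types, lifting))
  qed
  have "\<forall>j\<in>{1..CARD('n)}. \<exists>F. F holomorphic_on G j \<and> F 0 = 1 \<and>
      (\<integral>\<^sup>+w. ennreal ((norm (F w))\<^sup>2) * indicator (G j) w \<partial>lborel) \<le> ennreal (16 * pi * (d j)\<^sup>2)"
  proof
    fix j assume j: "j \<in> {1..CARD('n)}"
    have "hermitian_inner (z - z) (m j) \<in> G j" unfolding G_def using z by (rule imageI)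
    then have 0: "0 \<in> G j" by simp
    have dG: "of_real (d j) \<notin> G j"
    proof
      assume "of_real (d j) \<in> G j"
      then obtain x where "x \<in> D" "of_real (d j) = hermitian_inner (x - z) (m j)" by (auto simp: G_def)
      then show False using m(1)[OF j, of x] by simp
    qed
    have "norm (complex_of_real (d j)) = d j" using d[OF j] by simp
    then show "\<exists>F. F holomorphic_on G j \<and> F 0 = 1 \<and>
      (\<integral>\<^sup>+w. ennreal ((norm (F w))\<^sup>2) * indicator (G j) w \<partial>lborel) \<le> ennreal (16 * pi * (d j)\<^sup>2)"
      using simply_connected_L2_function[OF conjunct1[OF G[OF j]] conjunct2[OF G[OF j]] 0 dG] by simp
  qed
  then obtain F where "\<forall>j\<in>{1..CARD('n)}. F j holomorphic_on G j \<and> F j 0 = 1 \<and>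
      (\<integral>\<^sup>+w. ennreal ((norm (F j w))\<^sup>2) * indicator (G j) w \<partial>lborel) \<le> ennreal (16 * pi * (d j)\<^sup>2)"
    by (rule bchoice[THEN exE])
  then have F: "\<And>j. j \<in> {1..CARD('n)} \<Longrightarrow> F j holomorphic_on G j" "\<And>j. j \<in> {1..CARD('n)} \<Longrightarrow> F j 0 = 1"
    "\<And>j. j \<in> {1..CARD('n)} \<Longrightarrow> (\<integral>\<^sup>+w. ennreal ((norm (F j w))\<^sup>2) * indicator (G j) w \<partial>lborel) \<le> ennreal (16 * pi * (d j)\<^sup>2)"
    by simp_all
  define C where "C = (16 * pi) ^ CARD('n) * (p_D D z a)\<^sup>2"
  have C: "C > 0" using ppos by (simp add: C_def)
  define \<Phi> where "\<Phi> = (\<lambda>x. \<Prod>j=1..CARD('n). F j (hermitian_inner (x - z) (m j)))"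
  have hol\<Phi>: "holomorphic_Cn \<Phi> D"
    unfolding \<Phi>_def
  proof (rule holomorphic_Cn_prod)
    fix j assume j: "j \<in> {1..CARD('n)}"
    show "holomorphic_Cn (\<lambda>x. F j (hermitian_inner (x - z) (m j))) D"
      by (rule holomorphic_Cn_compose_functional[OF F(1)[OF j] conjunct1[OF G[OF j]]]) (simp add: G_def)
  qed
  have \<Phi>z: "\<Phi> z = 1" unfolding \<Phi>_def by (intro prod.neutral ballI) (simp add: F(2))
  \<comment> \<open>Extended by zero to indices outside 1..n, because the triangular formula asks
    for measurability at every index.\<close>
  define H where "H = (\<lambda>j w. if j \<in> {1..CARD('n)} then ennreal ((norm (F j w))\<^sup>2) * indicator (G j) w else 0)"
  have H: "H j \<in> borel_measurable borel" for j
  proof (cases "j \<in> {1..CARD('n)}")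
    case True
    have "F j \<in> borel_measurable (restrict_space borel (G j))"
      by (rule borel_measurable_continuous_on_restrict[OF holomorphic_on_imp_continuous_on[OF F(1)[OF True]]])
    then have "(\<lambda>w. ennreal ((norm (F j w))\<^sup>2)) \<in> borel_measurable (restrict_space borel (G j))"
      by measurable
    then have "(\<lambda>w. ennreal ((norm (F j w))\<^sup>2) * indicator (G j) w) \<in> borel_measurable borel"
      using G[OF True] by (subst (asm) borel_measurable_restrict_space_iff_ennreal) auto
    then show ?thesis unfolding H_def using True by simp
  next
    case False
    then have "H j w = 0" for w by (simp only: H_def if_False)
    then have "H j = (\<lambda>_. 0)" by (rule ext)
    then show ?thesis by simp
  qed
  have bound: "(\<integral>\<^sup>+x. ennreal ((norm (\<Phi> x))\<^sup>2) * indicator D x \<partial>lborel) \<le> ennreal C"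
  proof -
    define Q where "Q = (\<lambda>x. \<Prod>j=1..CARD('n). H j (hermitian_inner x (m j)))"
    have Q: "Q \<in> borel_measurable borel"
      unfolding Q_def
      by (intro borel_measurable_prod_ennreal measurable_compose[OF _ H] borel_measurable_continuous_onI continuous_intros)
    \<comment> \<open>Only an inequality: \<open>Q\<close> lives on the full preimage of the product
      of the sets \<open>G j\<close>, which contains the translate of \<open>D\<close> by
      \<open>- z\<close> but may be larger.\<close>
    have "(\<integral>\<^sup>+x. ennreal ((norm (\<Phi> x))\<^sup>2) * indicator D x \<partial>lborel) \<le> (\<integral>\<^sup>+x. Q (- z + x) \<partial>lborel)"
    proof (rule nn_integral_mono)
      fix x
      show "ennreal ((norm (\<Phi> x))\<^sup>2) * indicator D x \<le> Q (- z + x)"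
      proof (cases "x \<in> D")
        case True
        have "Q (- z + x) = (\<Prod>j=1..CARD('n). ennreal ((norm (F j (hermitian_inner (x - z) (m j))))\<^sup>2))"
          unfolding Q_def
        proof (rule prod.cong[OF refl])
          fix j assume j: "j \<in> {1..CARD('n)}"
          have "hermitian_inner (x - z) (m j) \<in> G j" unfolding G_def using True by (rule imageI)
          then show "H j (hermitian_inner (- z + x) (m j)) = ennreal ((norm (F j (hermitian_inner (x - z) (m j))))\<^sup>2)"
            using j by (simp add: H_def)
        qed
        also have "\<dots> = ennreal ((norm (\<Phi> x))\<^sup>2)"
          unfolding \<Phi>_def prod_norm[symmetric] prod_power_distrib by (rule prod_ennreal) simp
        finally show ?thesis using True by simp
      qed simp
    qed
    also have "\<dots> = (\<integral>\<^sup>+x. Q x \<partial>(distr lborel borel ((+) (- z))))"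
      using Q by (subst nn_integral_distr) auto
    also have "\<dots> = (\<integral>\<^sup>+x. Q x \<partial>lborel)" by (simp only: lborel_distr_plus)
    also have "\<dots> = (\<integral>\<^sup>+t. Q (\<Sum>j=1..CARD('n). t j *s e j) \<partial>(PiM {1..CARD('n)} (\<lambda>_. lborel)))"
      by (rule nn_integral_orthonormal_coordinates[OF orth Q])
    \<comment> \<open>\<open>m j\<close> is 1 on \<open>e j\<close> and vanishes on all later frame
      vectors, so in coordinates it is \<open>t j\<close> plus a combination of earlier
      coordinates.\<close>
    also have "\<dots> = (\<integral>\<^sup>+t. (\<Prod>j=1..CARD('n). H j (t j + (\<Sum>k=1..<j. hermitian_inner (e k) (m j) * t k))) \<partial>(PiM {1..CARD('n)} (\<lambda>_. lborel)))"
    proof (rule nn_integral_cong)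
      fix t :: "nat \<Rightarrow> complex"
      show "Q (\<Sum>j=1..CARD('n). t j *s e j) = (\<Prod>j=1..CARD('n). H j (t j + (\<Sum>k=1..<j. hermitian_inner (e k) (m j) * t k)))"
        unfolding Q_def
      proof (rule prod.cong[OF refl])
        fix j assume j: "j \<in> {1..CARD('n)}"
        have split: "{1..CARD('n)} = {1..<j} \<union> insert j {j<..CARD('n)}" using j by auto
        have "hermitian_inner (\<Sum>k=1..CARD('n). t k *s e k) (m j) = (\<Sum>k=1..CARD('n). t k * hermitian_inner (e k) (m j))"
          by (rule hermitian_inner_sum_left)
        also have "\<dots> = (\<Sum>k=1..<j. t k * hermitian_inner (e k) (m j)) + (\<Sum>k\<in>insert j {j<..CARD('n)}. t k * hermitian_inner (e k) (m j))"
          unfolding split by (rule sum.union_disjoint) auto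
        also have "(\<Sum>k\<in>insert j {j<..CARD('n)}. t k * hermitian_inner (e k) (m j)) = t j + (\<Sum>k\<in>{j<..CARD('n)}. t k * hermitian_inner (e k) (m j))"
          using m(2)[OF j] by simp
        also have "(\<Sum>k\<in>{j<..CARD('n)}. t k * hermitian_inner (e k) (m j)) = 0"
          by (intro sum.neutral ballI) (simp add: m(3)[OF j])
        finally show "H j (hermitian_inner (\<Sum>j=1..CARD('n). t j *s e j) (m j)) = H j (t j + (\<Sum>k=1..<j. hermitian_inner (e k) (m j) * t k))"
          by (simp add: add.commute mult.commute)
      qed
    qed
    also have "\<dots> = (\<Prod>j=1..CARD('n). \<integral>\<^sup>+w. H j w \<partial>lborel)"
      by (rule nn_integral_triangular_product[OF H])
    also have "\<dots> \<le> (\<Prod>j=1..CARD('n). ennreal (16 * pi * (d j)\<^sup>2))"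
      by (rule prod_mono_ennreal) (use F(3) in \<open>simp add: H_def\<close>)
    also have "\<dots> = ennreal (\<Prod>j=1..CARD('n). 16 * pi * (d j)\<^sup>2)"
      by (rule prod_ennreal) simp
    also have "(\<Prod>j=1..CARD('n). 16 * pi * (d j)\<^sup>2) = C"
      unfolding C_def p by (simp add: prod.distrib prod_power_distrib)
    finally show ?thesis .
  qed
  \<comment> \<open>Scaling by 1/sqrt C brings the norm down to at most 1 and leaves the squared
    modulus 1/C at \<open>z\<close>; times the square of \<open>p_D D z a\<close> this is exactly
    (16\<pi>)^-n.\<close>
  define f where "f = (\<lambda>x. of_real (inverse (sqrt C)) * \<Phi> x)"
  have holf: "holomorphic_Cn f D" unfolding f_def by (intro holomorphic_Cn_mult holomorphic_Cn_const hol\<Phi>)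
  have fsq: "(norm (f x))\<^sup>2 = (norm (\<Phi> x))\<^sup>2 / C" for x
    using C by (simp add: f_def norm_mult power_mult_distrib norm_inverse power_inverse divide_inverse)
  have fint: "(\<integral>\<^sup>+x. ennreal ((norm (f x))\<^sup>2) * indicator D x \<partial>lborel) \<le> 1"
  proof -
    have "(\<integral>\<^sup>+x. ennreal ((norm (f x))\<^sup>2) * indicator D x \<partial>lborel)
        = (\<integral>\<^sup>+x. ennreal (1 / C) * (ennreal ((norm (\<Phi> x))\<^sup>2) * indicator D x) \<partial>lborel)"
      using C by (intro nn_integral_cong) (simp add: fsq ennreal_mult[symmetric] mult.assoc[symmetric])
    also have "\<dots> = ennreal (1 / C) * (\<integral>\<^sup>+x. ennreal ((norm (\<Phi> x))\<^sup>2) * indicator D x \<partial>lborel)"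
      using borel_measurable_norm_square_indicator[OF hol\<Phi> D(1)] by (intro nn_integral_cmult) simp
    also have "\<dots> \<le> ennreal (1 / C) * ennreal C" by (intro mult_left_mono bound) simp
    also have "\<dots> = 1" using C by (simp add: ennreal_mult[symmetric])
    finally show ?thesis .
  qed
  have fL2: "f \<in> L2h D"
    by (rule L2h_memberI[OF holf D(1)]) (rule order.strict_trans1[OF fint], simp)
  have "ennreal ((L2_norm_on D f)\<^sup>2) \<le> 1" using fint unfolding L2_norm_on_square[OF fL2] .
  then have "(L2_norm_on D f)\<^sup>2 \<le> 1\<^sup>2" by (simp add: ennreal_le_1)
  then have "L2_norm_on D f \<le> 1" by (rule power2_le_imp_le) simp
  then have "ennreal ((norm (f z))\<^sup>2) \<le> Bergman_kernel D z"
    unfolding Bergman_kernel_def using fL2 by (intro SUP_upper) simp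
  then have "ennreal (1 / C) * ennreal ((p_D D z a)\<^sup>2) \<le> Bergman_kernel D z * ennreal ((p_D D z a)\<^sup>2)"
    by (intro mult_right_mono) (simp_all add: fsq \<Phi>z)
  moreover have "ennreal (1 / C) * ennreal ((p_D D z a)\<^sup>2) = ennreal (1 / (16 * pi) ^ CARD('n))"
    using C ppos by (subst ennreal_mult[symmetric]) (simp_all add: C_def)
  ultimately show ?thesis by simp
qed

theorem theorem13:
  fixes D :: "(complex ^ 'n::finite) set"
  assumes "domain_Cn D"
    and "C_convex D"
    and "contains_no_complex_line D"
  shows "\<forall>z\<in>D. \<forall>a. nearest_choice D z a \<longrightarrow>
    ennreal (1 / (16 * pi) ^ CARD('n)) \<le> Bergman_kernel D z * ennreal ((p_D D z a)\<^sup>2) \<and>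
    Bergman_kernel D z * ennreal ((p_D D z a)\<^sup>2) \<le> ennreal (fact (2 * CARD('n)) / (2 * pi) ^ CARD('n))"
proof -
  have "open D" using assms(1) by (simp add: domain_Cn_def)
  then show ?thesis
    using Bergman_kernel_lower[OF _ assms(2)] Bergman_kernel_upper[OF _ assms(2)] by blast
qed

end
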